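(* Let $Q$ be a polygon in the plane $\mathbb{C}$ with a triangulation $T(Q)$, and let $\tilde Q$ be the associated ideal polyhedron in $\mathbb{H}^3$, as defined in the context. Let $e_1,\dots,e_k$ be a minimal cutset of the 1-skeleton of $\tilde Q$, and let $\Sigma$ be the sum of the dihedral angles of $\tilde Q$ at $e_1,\dots,e_k$. If $e_1,\dots,e_k$ are not all incident to one vertex, then $\Sigma<(k-2)\pi$. If $e_1,\dots,e_k$ are all incident to one vertex, then $\Sigma=(k-2)\pi$.
   Context: Let $Q$ be a (not necessarily convex) simple polygon in the plane $\mathbb{C}$, whose interior is triangulated (by Euclidean triangles, possibly with additional vertices in the interior) in such a way that the edges of $Q$ are edges of the triangulation $T(Q)$. Regard $\mathbb{C}\cup\{\infty\}$ as the ideal boundary of the upper half-space model of $\mathbb{H}^3$. Then $\tilde Q$ is the (not necessarily convex) ideal polyhedron whose vertices are the vertices of $T(Q)$ together with one vertex $v_\infty$ at $\infty$, and whose faces are: for each triangle $ABC$ of $T(Q)$, the ideal triangle with vertices $A,B,C$, and for each edge $vw$ of $Q$, the ideal triangle with vertices $v,w,v_\infty$. The polyhedron $\tilde Q$ is the region lying above (on the $\infty$-side of) the ideal triangles over $T(Q)$; it is star-shaped with respect to $v_\infty$, and $T(Q)$ is its projection to $\mathbb{C}$. Its edges are the edges of $T(Q)$ together with the edges $v\,v_\infty$ for $v$ a vertex of $Q$. Dihedral angles are interior dihedral angles. Explicitly: (i) the dihedral angle at $v\,v_\infty$ is the interior Euclidean angle of $Q$ at $v$; (ii) the dihedral angle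 at a boundary edge $vw$ of $Q$ is the Euclidean angle at the third vertex of the unique triangle of $T(Q)$ containing $vw$; (iii) the dihedral angle at a non-boundary edge $AB$ of $T(Q)$ is the sum of the Euclidean angles at $C$ and $D$ of the two triangles $ACB$ and $ADB$ of $T(Q)$ abutting along $AB$. A set of edges of a (connected) graph is a cutset if the removal of those edges disconnects the graph; a cutset is minimal if no proper subset of it is a cutset. *)

theory Defs
  imports "HOL-Analysis.Analysis"
begin

fun polygonal_path :: "complex list \<Rightarrow> real \<Rightarrow> complex" where
  "polygonal_path [] = linepath 0 0"
| "polygonal_path [a] = linepath a a"
| "polygonal_path [a, b] = linepath a b"
| "polygonal_path (a # b # c # xs) = linepath a b +++ polygonal_path (b # c # xs)"

definition polygon_boundary :: "complex list \<Rightarrow> complex set" where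
  "polygon_boundary p = path_image (polygonal_path (p @ [hd p]))"

text \<open>A polygon is given by the cyclic list of its vertices, in either orientation. An angle
  of \<open>\<pi>\<close> at a vertex is allowed.\<close>

definition simple_polygon :: "complex list \<Rightarrow> bool" where
  "simple_polygon p \<longleftrightarrow> 3 \<le> length p \<and> simple_path (polygonal_path (p @ [hd p]))"

definition polygon_interior :: "complex list \<Rightarrow> complex set" where
  "polygon_interior p = inside (polygon_boundary p)"

definition polygon_edges :: "complex list \<Rightarrow> complex set set" where
  "polygon_edges p = {{p ! i, p ! (Suc i mod length p)} |i. i < length p}"

definition euclidean_angle :: "complex \<Rightarrow> complex \<Rightarrow> complex \<Rightarrow> real" where
  "euclidean_angle A C B = arccos (((A - C) \<bullet> (B - C)) / (norm (A - C) * norm (B - C)))"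

text \<open>The interior angle of a plane region \<open>R\<close> at a boundary point \<open>v\<close> is the angular measure of
  the set of directions pointing from \<open>v\<close> into \<open>R\<close>. At a reflex vertex of a polygon
  it exceeds \<open>\<pi>\<close>.\<close>

definition interior_angle :: "complex set \<Rightarrow> complex \<Rightarrow> real" where
  "interior_angle R v =
     measure lebesgue {\<theta> \<in> {0..<2 * pi}. \<forall>\<^sub>F r in at_right 0. v + of_real r * cis \<theta> \<in> R}"

definition triangle_vertices :: "complex set \<Rightarrow> complex set" where
  "triangle_vertices t = {v. v extreme_point_of t}"

definition triangulation_edges :: "complex set set \<Rightarrow> complex set set" where
  "triangulation_edges T = {e. card e = 2 \<and> (\<exists>t\<in>T. e \<subseteq> triangle_vertices t)}"

text \<open>\<open>T\<close> is the set of closed (solid) triangles. As each edge of the polygon is an edge of a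
  triangle, the vertices of \<open>T\<close> on the boundary are exactly the vertices of the polygon.\<close>

definition triangulates_polygon :: "complex set set \<Rightarrow> complex list \<Rightarrow> bool" where
  "triangulates_polygon T p \<longleftrightarrow>
     triangulation T \<and> (\<forall>t\<in>T. 2 simplex t) \<and>
     \<Union>T = polygon_boundary p \<union> polygon_interior p \<and>
     polygon_edges p \<subseteq> triangulation_edges T"

text \<open>Points of the ideal boundary of the upper half-space. An ideal triangle is
  represented by the set of its three ideal vertices, a complete geodesic by the set of its two
  endpoints.\<close>

datatype ideal_point = Finite complex | Infinity

definition ideal_faces :: "complex list \<Rightarrow> complex set set \<Rightarrow> ideal_point set set" where
  "ideal_faces p T =
     {Finite ` triangle_vertices t |t. t \<in> T} \<union>
     {insert Infinity (Finite ` e) |e. e \<in> polygon_edges p}"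

definition ideal_vertices :: "complex set set \<Rightarrow> ideal_point set" where
  "ideal_vertices T = insert Infinity (Finite ` (\<Union>t\<in>T. triangle_vertices t))"

definition ideal_edges :: "complex list \<Rightarrow> complex set set \<Rightarrow> ideal_point set set" where
  "ideal_edges p T = {e. card e = 2 \<and> (\<exists>f\<in>ideal_faces p T. e \<subseteq> f)}"

text \<open>Interior dihedral angle of the polyhedron at the geodesic with the given endpoints.
  The upper half-space model is conformal, so at a vertical edge it is the angle of the polygon.
  At an edge \<open>AB\<close> of the triangulation it is the sum of the angles opposite to \<open>AB\<close> in the
  triangles with edge \<open>AB\<close>; there is one such triangle for an edge of the polygon and there are
  two for any other edge. The value at \<open>Infinity Infinity\<close> is a dummy.\<close>

fun dihedral_angle ::
  "complex list \<Rightarrow> complex set set \<Rightarrow> ideal_point \<Rightarrow> ideal_point \<Rightarrow> real" where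
  "dihedral_angle p T (Finite v) Infinity = interior_angle (polygon_interior p) v"
| "dihedral_angle p T Infinity (Finite v) = interior_angle (polygon_interior p) v"
| "dihedral_angle p T (Finite A) (Finite B) =
     (\<Sum>C | convex hull {A, B, C} \<in> T. euclidean_angle A C B)"
| "dihedral_angle p T Infinity Infinity = 0"

lemma dihedral_angle_commute: "dihedral_angle p T x y = dihedral_angle p T y x"
  by (cases x; cases y) (simp_all add: insert_commute euclidean_angle_def inner_commute mult.commute)

definition edge_dihedral_angle ::
  "complex list \<Rightarrow> complex set set \<Rightarrow> ideal_point set \<Rightarrow> real" where
  "edge_dihedral_angle p T e = (THE a. \<forall>x y. e = {x, y} \<longrightarrow> a = dihedral_angle p T x y)"

lemma edge_dihedral_angle_doubleton: "edge_dihedral_angle p T {x, y} = dihedral_angle p T x y"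
  unfolding edge_dihedral_angle_def
proof (rule the_equality)
  show "\<forall>u v. {x, y} = {u, v} \<longrightarrow> dihedral_angle p T x y = dihedral_angle p T u v"
    by (metis dihedral_angle_commute doubleton_eq_iff)
qed blast

text \<open>A graph is given by its vertex set and its set of edges, which are two-element sets.\<close>

definition graph_connected :: "'a set \<Rightarrow> 'a set set \<Rightarrow> bool" where
  "graph_connected V E \<longleftrightarrow> (\<forall>u\<in>V. \<forall>v\<in>V. (u, v) \<in> {(x, y). {x, y} \<in> E}\<^sup>*)"

definition cutset :: "'a set \<Rightarrow> 'a set set \<Rightarrow> 'a set set \<Rightarrow> bool" where
  "cutset V E C \<longleftrightarrow> C \<subseteq> E \<and> \<not> graph_connected V (E - C)"

definition minimal_cutset :: "'a set \<Rightarrow> 'a set set \<Rightarrow> 'a set set \<Rightarrow> bool" where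
  "minimal_cutset V E C \<longleftrightarrow> cutset V E C \<and> (\<forall>D. D \<subset> C \<longrightarrow> \<not> cutset V E D)"

end

theory Submission
  imports Defs
begin

text \<open>
  A minimal cutset is the set of edges between two connected parts \<open>A\<close> and \<open>B\<close> of the vertex set; let
  \<open>\<infinity> \<in> B\<close>. The ideal faces form a triangulated sphere. A connected proper subcomplex of a sphere
  has Euler characteristic at most 1, because its triangles can be collapsed through free edges
  without disconnecting the graph; the characteristics of the subcomplexes spanned by \<open>A\<close> and \<open>B\<close>
  add up to 2, so both are 1. Counting faces by the number of their vertices in \<open>A\<close> and adding up
  triangle angles then gives \<open>\<Sigma> = (k - 2) \<pi> - 2 \<Theta>\<close>, where \<open>\<Theta>\<close> sums the angle at the vertex in \<open>B\<close>
  over the triangles of \<open>T\<close> with exactly two vertices in \<open>A\<close>. There are no such triangles exactly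
  when \<open>A\<close> or \<open>B\<close> is a single vertex.

  The only input from plane topology is \<open>V + F \<ge> E + 2\<close>. The complement of the closed region is
  connected, so circle-valued maps on the region have continuous logarithms; hence every integer
  1-cocycle of \<open>T\<close> is a coboundary, and collapsing \<open>T\<close> to a forest bounds the number of edges.
\<close>

section \<open>Cuts and collapses\<close>

text \<open>Apart from V + F \<ge> E + 2, the counting on the surface holds for a triangulated torus
  as well, so this inequality is where the plane has to enter. The characteristics of the two sides
  add up because the faces with vertices on both sides are as many as the cut edges: a cut edge lies
  in two faces, and a mixed face has two cut edges.

  The angle count charges a cut edge of \<open>T\<close> to the angles opposite to it and a vertical
  cut edge to the triangle angles at its finite end. Once the full angle 2 \<pi> is added for every
  vertex of A inside the polygon, a triangle with one or three vertices in A receives \<pi>, and a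
  triangle with two receives 2 \<pi> minus twice the angle at its vertex in B. This correction is
  the source of \<Theta>, and positivity of angles makes the inequality strict. The Euler
  characteristic of the side A converts the numbers of triangles and vertices into k - 2.\<close>

definition cut_connected :: "'a set \<Rightarrow> 'a set set \<Rightarrow> bool" where
  "cut_connected V E \<longleftrightarrow>
     (\<forall>S. S \<subseteq> V \<and> S \<noteq> {} \<and> S \<noteq> V \<longrightarrow> (\<exists>x\<in>S. \<exists>y\<in>V - S. {x, y} \<in> E))"

definition boundary_edges :: "'a set set \<Rightarrow> 'a set \<Rightarrow> 'a set set" where
  "boundary_edges E A = {e \<in> E. e \<inter> A \<noteq> {} \<and> \<not> e \<subseteq> A}"

lemma cut_connectedD:
  assumes "cut_connected V E" "S \<subseteq> V" "S \<noteq> {}" "S \<noteq> V"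
  obtains x y where "x \<in> S" "y \<in> V - S" "{x, y} \<in> E"
  using assms unfolding cut_connected_def by blast

text \<open>Connectivity by cuts asks for a single crossing edge instead of a path, which is easier
  to preserve when edges are removed or vertices are added.\<close>

lemma graph_connected_iff_cut_connected:
  assumes "\<And>e. e \<in> E \<Longrightarrow> e \<subseteq> V"
  shows "graph_connected V E \<longleftrightarrow> cut_connected V E"
proof
  assume conn: "graph_connected V E"
  show "cut_connected V E"
    unfolding cut_connected_def
  proof (intro allI impI, rule ccontr)
    fix S assume S: "S \<subseteq> V \<and> S \<noteq> {} \<and> S \<noteq> V" and no: "\<not> (\<exists>x\<in>S. \<exists>y\<in>V - S. {x, y} \<in> E)"
    then obtain u v where uv: "u \<in> S" "v \<in> V" "v \<notin> S" by blast
    have "(u, v) \<in> {(x, y). {x, y} \<in> E}\<^sup>*"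
      using conn uv S unfolding graph_connected_def by blast
    then have "v \<in> S"
    proof (induction rule: rtrancl_induct)
      case base then show ?case by (fact uv(1))
    next
      case (step y z)
      then show ?case using no assms by blast
    qed
    with uv show False by blast
  qed
next
  assume conn: "cut_connected V E"
  show "graph_connected V E"
    unfolding graph_connected_def
  proof (intro ballI, rule ccontr)
    fix u v assume uv: "u \<in> V" "v \<in> V" "(u, v) \<notin> {(x, y). {x, y} \<in> E}\<^sup>*"
    define S where "S = {w \<in> V. (u, w) \<in> {(x, y). {x, y} \<in> E}\<^sup>*}"
    have "S \<subseteq> V" "S \<noteq> {}" "S \<noteq> V"
      using uv unfolding S_def by auto
    then obtain x y where xy: "x \<in> S" "y \<in> V - S" "{x, y} \<in> E"
      using conn by (elim cut_connectedD)
    then have "(u, y) \<in> {(x, y). {x, y} \<in> E}\<^sup>*"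
      unfolding S_def by (auto intro: rtrancl_into_rtrancl)
    with xy show False unfolding S_def by blast
  qed
qed

lemma boundary_edges_Diff:
  assumes "\<And>e. e \<in> E \<Longrightarrow> e \<subseteq> V"
  shows "boundary_edges E (V - A) = boundary_edges E A"
  using assms unfolding boundary_edges_def by blast

lemma not_cut_connected_boundary:
  assumes "A \<subseteq> V" "A \<noteq> {}" "A \<noteq> V"
  shows "\<not> cut_connected V (E - boundary_edges E A)"
proof
  assume "cut_connected V (E - boundary_edges E A)"
  then obtain x y where "x \<in> A" "y \<in> V - A" "{x, y} \<in> E - boundary_edges E A"
    using assms by (elim cut_connectedD)
  then show False unfolding boundary_edges_def by blast
qed

text \<open>If a side \<open>A\<close> fell apart into \<open>S\<close> and \<open>A - S\<close>, the boundaries of both parts would be cutsets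
  inside the minimal one, hence equal; but they are disjoint.\<close>

lemma minimal_cutset_side_connected:
  assumes E: "\<And>e. e \<in> E \<Longrightarrow> e \<subseteq> V \<and> card e = 2"
    and conn: "cut_connected V E"
    and A: "A \<subseteq> V" "A \<noteq> {}" "A \<noteq> V"
    and min: "\<And>S. S \<subseteq> V \<Longrightarrow> S \<noteq> {} \<Longrightarrow> S \<noteq> V \<Longrightarrow> boundary_edges E S \<subseteq> boundary_edges E A
      \<Longrightarrow> boundary_edges E S = boundary_edges E A"
  shows "cut_connected A {e \<in> E. e \<subseteq> A}"
  unfolding cut_connected_def
proof (intro allI impI, rule ccontr)
  fix S assume S: "S \<subseteq> A \<and> S \<noteq> {} \<and> S \<noteq> A"
    and "\<not> (\<exists>x\<in>S. \<exists>y\<in>A - S. {x, y} \<in> {e \<in> E. e \<subseteq> A})"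
  then have no: "\<And>x y. x \<in> S \<Longrightarrow> y \<in> A - S \<Longrightarrow> {x, y} \<notin> E" using S by blast
  have no': "\<not> (e \<inter> S \<noteq> {} \<and> e \<inter> (A - S) \<noteq> {})" if e: "e \<in> E" for e
  proof
    assume ne: "e \<inter> S \<noteq> {} \<and> e \<inter> (A - S) \<noteq> {}"
    obtain a b where "e = {a, b}" using E[OF e] by (auto simp: card_2_iff)
    with ne have "e = {a, b} \<and> a \<in> S \<and> b \<in> A - S \<or> e = {b, a} \<and> b \<in> S \<and> a \<in> A - S" by auto
    then show False using no e by metis
  qed
  have "boundary_edges E S \<subseteq> boundary_edges E A" "boundary_edges E (A - S) \<subseteq> boundary_edges E A"
    using S no' unfolding boundary_edges_def by blast+
  then have "boundary_edges E S = boundary_edges E A" "boundary_edges E (A - S) = boundary_edges E A"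
    using min S A by (metis Diff_subset Diff_eq_empty_iff order.trans subset_antisym)+
  moreover have "boundary_edges E S \<inter> boundary_edges E (A - S) = {}"
    using no' unfolding boundary_edges_def by blast
  ultimately have "boundary_edges E A = {}" by blast
  then show False using not_cut_connected_boundary[OF A, of E] conn by simp
qed

text \<open>Removing C leaves some nonempty proper vertex set A without outgoing edges. All edges
  leaving A then belong to C and already form a cutset, so by minimality they are C.\<close>

lemma minimal_cutset_sides:
  assumes E: "\<And>e. e \<in> E \<Longrightarrow> e \<subseteq> V \<and> card e = 2"
    and conn: "cut_connected V E"
    and C: "minimal_cutset V E C"
  obtains A where "A \<subseteq> V" "A \<noteq> {}" "A \<noteq> V" "C = boundary_edges E A"
    "cut_connected A {e \<in> E. e \<subseteq> A}" "cut_connected (V - A) {e \<in> E. e \<subseteq> V - A}"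
proof -
  have gc: "graph_connected V (E - D) \<longleftrightarrow> cut_connected V (E - D)" for D
    by (rule graph_connected_iff_cut_connected) (use E in blast)
  have "\<not> cut_connected V (E - C)"
    using C gc unfolding minimal_cutset_def cutset_def by blast
  then obtain A where A: "A \<subseteq> V" "A \<noteq> {}" "A \<noteq> V"
    and no: "\<not> (\<exists>x\<in>A. \<exists>y\<in>V - A. {x, y} \<in> E - C)"
    unfolding cut_connected_def by blast
  have cut: "cutset V E (boundary_edges E S)" if "S \<subseteq> V" "S \<noteq> {}" "S \<noteq> V" for S
    using not_cut_connected_boundary[OF that, of E] gc
    unfolding cutset_def boundary_edges_def by blast
  have sub: "boundary_edges E A \<subseteq> C"
  proof
    fix e assume e: "e \<in> boundary_edges E A"
    then obtain x y where "x \<in> e" "x \<in> A" "y \<in> e" "y \<notin> A" unfolding boundary_edges_def by blast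
    moreover from this have "e = {x, y}" "y \<in> V"
      using E[of e] e by (auto simp: card_2_iff boundary_edges_def)
    ultimately show "e \<in> C" using no e unfolding boundary_edges_def by blast
  qed
  have min: "boundary_edges E S = C"
    if "S \<subseteq> V" "S \<noteq> {}" "S \<noteq> V" "boundary_edges E S \<subseteq> C" for S
    using C cut[OF that(1-3)] that(4) unfolding minimal_cutset_def by blast
  have CA: "C = boundary_edges E A" using min[OF A sub] by simp
  have CB: "C = boundary_edges E (V - A)"
    using CA boundary_edges_Diff[of E V A] E by blast
  show ?thesis
  proof (rule that[OF A CA])
    show "cut_connected A {e \<in> E. e \<subseteq> A}"
      by (rule minimal_cutset_side_connected[OF E conn A]) (use min CA in auto)
    show "cut_connected (V - A) {e \<in> E. e \<subseteq> V - A}"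
      by (rule minimal_cutset_side_connected[OF E conn]) (use min CB A in auto)
  qed
qed

text \<open>Growing a tree: a largest vertex set S that spans at least |S| - 1 edges must be V,
  because an edge leaving S would supply both a new vertex and a new edge.\<close>

lemma cut_connected_card_le:
  assumes "finite V" and "finite E" and "cut_connected V E"
  shows "card V \<le> card E + 1"
proof (cases "V = {}")
  case False
  then obtain r where r: "r \<in> V" by blast
  define P where "P S \<longleftrightarrow> S \<subseteq> V \<and> S \<noteq> {} \<and> card S \<le> card {e \<in> E. e \<subseteq> S} + 1" for S
  have "P {r}" unfolding P_def using r by auto
  moreover have "\<forall>S. P S \<longrightarrow> card S < Suc (card V)"
    unfolding P_def using assms(1) card_mono less_Suc_eq_le by blast
  ultimately obtain S where S: "P S" and max: "\<And>S'. P S' \<Longrightarrow> card S' \<le> card S"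
    using ex_has_greatest_nat[of P "{r}" card "Suc (card V)"] by blast
  have "S = V"
  proof (rule ccontr)
    assume "S \<noteq> V"
    then obtain x y where xy: "x \<in> S" "y \<in> V - S" "{x, y} \<in> E"
      using cut_connectedD[OF assms(3), of S] S unfolding P_def by metis
    have fin: "finite S" using S assms(1) finite_subset unfolding P_def by blast
    have "card (insert {x, y} {e \<in> E. e \<subseteq> S}) \<le> card {e \<in> E. e \<subseteq> insert y S}"
      using xy assms(2) by (intro card_mono) auto
    moreover have "{x, y} \<notin> {e \<in> E. e \<subseteq> S}" using xy by auto
    ultimately have "P (insert y S)"
      using S xy fin assms(2) unfolding P_def by auto
    then have "card (insert y S) \<le> card S" by (rule max)
    then show False using xy fin by auto
  qed
  moreover have "card {e \<in> E. e \<subseteq> S} \<le> card E" using assms(2) by (intro card_mono) auto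
  ultimately show ?thesis using S unfolding P_def by auto
qed simp

section \<open>Collapsing triangles through free edges\<close>

definition free_edge :: "'a set set \<Rightarrow> 'a set \<Rightarrow> 'a set \<Rightarrow> bool" where
  "free_edge X t e \<longleftrightarrow> t \<in> X \<and> e \<subseteq> t \<and> card e = 2 \<and> (\<forall>t'\<in>X. e \<subseteq> t' \<longrightarrow> t' = t)"

text \<open>Quantifying over all subfamilies, instead of fixing an order of removal, makes the
  property pass to subfamilies, as the inductions below require.\<close>

definition collapsible :: "'a set set \<Rightarrow> bool" where
  "collapsible X \<longleftrightarrow> (\<forall>Y. Y \<subseteq> X \<and> Y \<noteq> {} \<longrightarrow> (\<exists>t e. free_edge Y t e))"

lemma collapsibleD: "collapsible X \<Longrightarrow> Y \<subseteq> X \<Longrightarrow> Y \<noteq> {} \<Longrightarrow> \<exists>t e. free_edge Y t e"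
  unfolding collapsible_def by blast

lemma collapsible_subset: "collapsible X \<Longrightarrow> Y \<subseteq> X \<Longrightarrow> collapsible Y"
  unfolding collapsible_def by blast

lemma card_3_third:
  assumes "card t = 3" "e \<subseteq> t" "card e = 2"
  obtains a b d where "e = {a, b}" "t = {a, b, d}" "a \<noteq> b" "a \<noteq> d" "b \<noteq> d"
proof -
  obtain a b where ab: "e = {a, b}" "a \<noteq> b" using assms(3) by (auto simp: card_2_iff)
  have fin: "finite t" using assms(1) card.infinite by fastforce
  then have "card (t - e) = 1" using assms finite_subset by (subst card_Diff_subset) auto
  then obtain d where d: "t - e = {d}" by (auto simp: card_1_singleton_iff)
  then have "t = {a, b, d}" "d \<noteq> a" "d \<noteq> b" using ab assms(2) by auto
  then show ?thesis using ab that by metis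
qed

text \<open>Removing a triangle together with a free edge keeps the graph connected, since the other two
  edges of the triangle remain.\<close>

lemma collapse_connected_card_le:
  assumes "finite V" "finite E" "finite X" "cut_connected V E" "collapsible X"
    and "\<And>t. t \<in> X \<Longrightarrow> card t = 3"
    and "\<And>t e. t \<in> X \<Longrightarrow> e \<subseteq> t \<Longrightarrow> card e = 2 \<Longrightarrow> e \<in> E"
    and "\<And>e. e \<in> E \<Longrightarrow> e \<subseteq> V"
  shows "card V + card X \<le> card E + 1"
  using assms(3,2,4-)
proof (induction "card X" arbitrary: X E)
  case 0
  then show ?case using cut_connected_card_le[OF assms(1)] by simp
next
  case (Suc n)
  have "X \<noteq> {}" using Suc.hyps(2) by auto
  then obtain t e where te: "free_edge X t e"
    using Suc.prems(4) collapsibleD[of X X] by blast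
  then have t: "t \<in> X" "e \<subseteq> t" "card e = 2" and free: "\<And>t'. t' \<in> X \<Longrightarrow> e \<subseteq> t' \<Longrightarrow> t' = t"
    unfolding free_edge_def by blast+
  obtain a b d where abd: "e = {a, b}" "t = {a, b, d}" "a \<noteq> b" "a \<noteq> d" "b \<noteq> d"
    using card_3_third[OF Suc.prems(5)[OF t(1)] t(2,3)] by metis
  have E: "{a, b} \<in> E" "{a, d} \<in> E" "{b, d} \<in> E"
    using Suc.prems(6)[OF t(1)] abd by auto
  have "card V + card (X - {t}) \<le> card (E - {e}) + 1"
  proof (rule Suc.hyps(1))
    show "n = card (X - {t})" using Suc.hyps(2) t by simp
    show "cut_connected V (E - {e})"
      unfolding cut_connected_def
    proof (intro allI impI)
      fix S assume S: "S \<subseteq> V \<and> S \<noteq> {} \<and> S \<noteq> V"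
      obtain x y where xy: "x \<in> S" "y \<in> V - S" "{x, y} \<in> E"
        using cut_connectedD[OF Suc.prems(3), of S] S by metis
      show "\<exists>x\<in>S. \<exists>y\<in>V - S. {x, y} \<in> E - {e}"
      proof (cases "{x, y} = e")
        case False then show ?thesis using xy by blast
      next
        case True
        \<comment> \<open>The other two sides of the triangle join \<open>x\<close> to
          \<open>y\<close> through \<open>d\<close>; whichever side of the cut contains
          \<open>d\<close>, one of them crosses it.\<close>
        then have xd: "{x, d} \<in> E" "{y, d} \<in> E" "{x, d} \<noteq> e" "{y, d} \<noteq> e"
          using abd E by (auto simp: doubleton_eq_iff)
        have "d \<in> V" using Suc.prems(7) E by blast
        then show ?thesis using xd xy by (cases "d \<in> S") (auto simp: insert_commute)
      qed
    qed
    show "collapsible (X - {t})" using Suc.prems(4) by (rule collapsible_subset) blast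
    show "finite (X - {t})" "finite (E - {e})" using Suc.prems by simp_all
    show "\<And>s. s \<in> X - {t} \<Longrightarrow> card s = 3" using Suc.prems(5) by blast
    show "\<And>e'. e' \<in> E - {e} \<Longrightarrow> e' \<subseteq> V" using Suc.prems(7) by blast
    show "e' \<in> E - {e}" if "s \<in> X - {t}" "e' \<subseteq> s" "card e' = 2" for s e'
      using Suc.prems(6)[of s e'] that free[of s] by blast
  qed
  moreover have "e \<in> E" using E abd by simp
  then have "card (E - {e}) + 1 = card E" "card (X - {t}) + 1 = card X"
    using Suc.prems(1,2) t(1) card_Suc_Diff1 by fastforce+
  ultimately show ?case by linarith
qed

text \<open>A graph on which every integer 1-cochain is a coboundary is a forest: the subset \<open>D\<close> of its
  edges is recovered from the parities of a potential of the indicator cochain of \<open>D\<close>.\<close>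

lemma coboundary_card_le:
  assumes fin: "finite V" "finite E" and r: "r \<in> V"
    and E: "\<And>e. e \<in> E \<Longrightarrow> e \<subseteq> V \<and> card e = 2"
    and cob: "\<And>c :: 'a \<Rightarrow> 'a \<Rightarrow> int. (\<And>x y. c x y = - c y x) \<Longrightarrow>
      \<exists>g. \<forall>x y. {x, y} \<in> E \<longrightarrow> c x y = g y - g x"
  shows "card E + 1 \<le> card V"
proof -
  define hd where "hd e = (SOME x. x \<in> e)" for e :: "'a set"
  have hd: "hd e \<in> e" if "e \<in> E" for e
  proof -
    have "e \<noteq> {}" using E[OF that] by auto
    then show ?thesis unfolding hd_def by (simp add: some_in_eq)
  qed
  \<comment> \<open>The indicator of \<open>D\<close>, given a sign by an arbitrary orientation of
    each edge to make it antisymmetric. Its parity still tells membership in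
    \<open>D\<close>.\<close>
  define c :: "'a set set \<Rightarrow> 'a \<Rightarrow> 'a \<Rightarrow> int" where
    "c D x y = (if x \<noteq> y \<and> {x, y} \<in> D then (if hd {x, y} = x then 1 else -1) else 0)" for D x y
  have "\<exists>g :: 'a \<Rightarrow> int. g r = 0 \<and> (\<forall>x y. {x, y} \<in> E \<longrightarrow> c D x y = g y - g x)"
    if D: "D \<subseteq> E" for D
  proof -
    have "c D x y = - c D y x" for x y
      using hd[of "{x, y}"] D unfolding c_def by (auto simp: insert_commute)
    then obtain g where "\<forall>x y. {x, y} \<in> E \<longrightarrow> c D x y = g y - g x" using cob by blast
    then show ?thesis by (intro exI[of _ "\<lambda>x. g x - g r"]) simp
  qed
  then obtain g :: "'a set set \<Rightarrow> 'a \<Rightarrow> int" where g: "\<And>D. D \<subseteq> E \<Longrightarrow> g D r = 0"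
    "\<And>D x y. D \<subseteq> E \<Longrightarrow> {x, y} \<in> E \<Longrightarrow> c D x y = g D y - g D x" by metis
  \<comment> \<open>With the potential normalised to 0 at \<open>r\<close>, its parities form a
    subset of V - {r}. As \<open>D\<close> can be read off from it, 2^|E| sets inject into 2^(|V| -
    1).\<close>
  define P where "P D = {x \<in> V - {r}. odd (g D x)}" for D
  have mem: "{x, y} \<in> D \<longleftrightarrow> (x \<in> P D) \<noteq> (y \<in> P D)" if "D \<subseteq> E" "{x, y} \<in> E" for D x y
  proof -
    have ne: "x \<noteq> y" "x \<in> V" "y \<in> V" using E[OF that(2)] by auto
    have odd_iff: "z \<in> P D \<longleftrightarrow> odd (g D z)" if "z \<in> V" for z
      using that g(1)[OF \<open>D \<subseteq> E\<close>] unfolding P_def by auto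
    have "odd (c D x y) \<longleftrightarrow> {x, y} \<in> D" using ne unfolding c_def by auto
    moreover have "odd (c D x y) \<longleftrightarrow> odd (g D x) \<noteq> odd (g D y)"
      unfolding g(2)[OF that] by auto
    ultimately show ?thesis using odd_iff ne by blast
  qed
  have "inj_on P (Pow E)"
  proof (rule inj_onI)
    fix D D' assume *: "D \<in> Pow E" "D' \<in> Pow E" "P D = P D'"
    have "e \<in> D \<longleftrightarrow> e \<in> D'" if e: "e \<in> E" for e
    proof -
      obtain x y where "e = {x, y}" using E[OF e] by (auto simp: card_2_iff)
      then show ?thesis using mem[of D x y] mem[of D' x y] * e by simp
    qed
    then show "D = D'" using * by blast
  qed
  moreover have "P ` Pow E \<subseteq> Pow (V - {r})" unfolding P_def by blast
  ultimately have "card (Pow E) \<le> card (Pow (V - {r}))"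
    using fin by (meson card_inj_on_le finite_Diff finite_Pow_iff)
  then have "(2::nat) ^ card E \<le> 2 ^ card (V - {r})" using fin by (simp add: card_Pow)
  then have "card E \<le> card (V - {r})" by simp
  moreover have "card V = Suc (card (V - {r}))" using fin r card_Suc_Diff1[of V r] by simp
  ultimately show ?thesis by linarith
qed

definition cocycle :: "'a set set \<Rightarrow> ('a \<Rightarrow> 'a \<Rightarrow> int) \<Rightarrow> bool" where
  "cocycle X c \<longleftrightarrow> (\<forall>x y. c x y = - c y x) \<and>
     (\<forall>t\<in>X. \<forall>x\<in>t. \<forall>y\<in>t. \<forall>z\<in>t. c x y + c y z = c x z)"

lemma cocycle_add: "cocycle X c \<Longrightarrow> t \<in> X \<Longrightarrow> x \<in> t \<Longrightarrow> y \<in> t \<Longrightarrow> z \<in> t \<Longrightarrow> c x y + c y z = c x z"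
  unfolding cocycle_def by blast

lemma cocycle_antisym: "cocycle X c \<Longrightarrow> c x y = - c y x"
  unfolding cocycle_def by blast

text \<open>A triangle can be removed together with a free edge, because a cocycle on the rest extends
  uniquely over the removed edge.\<close>

lemma collapse_coboundary_card_le:
  assumes "finite V" "r \<in> V" "finite E" "finite X" "collapsible X"
    and "\<And>t. t \<in> X \<Longrightarrow> card t = 3"
    and "\<And>t e. t \<in> X \<Longrightarrow> e \<subseteq> t \<Longrightarrow> card e = 2 \<Longrightarrow> e \<in> E"
    and "\<And>e. e \<in> E \<Longrightarrow> e \<subseteq> V \<and> card e = 2"
    and "\<And>c. cocycle X c \<Longrightarrow> \<exists>g. \<forall>x y. {x, y} \<in> E \<longrightarrow> c x y = g y - g x"
  shows "card E + 1 \<le> card V + card X"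
  using assms(4,3,5-)
proof (induction "card X" arbitrary: X E)
  case 0
  then have X: "X = {}" by simp
  have "card E + 1 \<le> card V"
  proof (rule coboundary_card_le[OF assms(1) "0.prems"(2) assms(2)])
    fix c :: "'a \<Rightarrow> 'a \<Rightarrow> int" assume "\<And>x y. c x y = - c y x"
    then have "cocycle X c" unfolding cocycle_def X by blast
    then show "\<exists>g. \<forall>x y. {x, y} \<in> E \<longrightarrow> c x y = g y - g x" by (rule "0.prems"(7))
  qed (use "0.prems"(6) in blast)
  then show ?case by simp
next
  case (Suc n)
  have "X \<noteq> {}" using Suc.hyps(2) by auto
  then obtain t e where te: "free_edge X t e"
    using Suc.prems(3) collapsibleD[of X X] by blast
  then have t: "t \<in> X" "e \<subseteq> t" "card e = 2" and free: "\<And>t'. t' \<in> X \<Longrightarrow> e \<subseteq> t' \<Longrightarrow> t' = t"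
    unfolding free_edge_def by blast+
  obtain a b d where abd: "e = {a, b}" "t = {a, b, d}" "a \<noteq> b" "a \<noteq> d" "b \<noteq> d"
    using card_3_third[OF Suc.prems(4)[OF t(1)] t(2,3)] by metis
  have "card (E - {e}) + 1 \<le> card V + card (X - {t})"
  proof (rule Suc.hyps(1))
    show "n = card (X - {t})" using Suc.hyps(2) t by simp
    show "collapsible (X - {t})" using Suc.prems(3) by (rule collapsible_subset) blast
    fix c assume c: "cocycle (X - {t}) c"
    \<comment> \<open>The value on the removed edge is dictated by the cocycle condition in
      \<open>t\<close>; it is the value along the detour through \<open>d\<close>.\<close>
    define c' where "c' x y = (if x = a \<and> y = b then c a d + c d b
      else if x = b \<and> y = a then c b d + c d a else c x y)" for x y
    have anti: "c x y = - c y x" for x y using c unfolding cocycle_def by blast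
    have zero: "c x x = 0" for x using anti[of x x] by simp
    have c'e: "c' x y = c x y" if "{x, y} \<noteq> e" for x y
      using that abd(1) unfolding c'_def by (metis insert_commute)
    have "cocycle X c'"
      unfolding cocycle_def
    proof (intro conjI allI ballI)
      fix x y show "c' x y = - c' y x"
        using anti[of a d] anti[of d b] anti[of x y] abd(3) unfolding c'_def by (smt (verit))
    next
      fix s x y z assume s: "s \<in> X" "x \<in> s" "y \<in> s" "z \<in> s"
      show "c' x y + c' y z = c' x z"
      proof (cases "s = t")
        case True
        then have "x \<in> {a, b, d}" "y \<in> {a, b, d}" "z \<in> {a, b, d}" using s abd by auto
        then show ?thesis
          using anti[of a d] anti[of d b] abd(3-5) zero unfolding c'_def by auto
      next
        case False
        then have "\<not> e \<subseteq> s" using free s by blast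
        then have "{x, y} \<noteq> e" "{y, z} \<noteq> e" "{x, z} \<noteq> e" using s by blast+
        then show ?thesis using c s False c'e unfolding cocycle_def by (metis insertE Diff_iff empty_iff)
      qed
    qed
    then obtain g where "\<forall>x y. {x, y} \<in> E \<longrightarrow> c' x y = g y - g x" using Suc.prems(7) by blast
    then show "\<exists>g. \<forall>x y. {x, y} \<in> E - {e} \<longrightarrow> c x y = g y - g x"
      using c'e by (metis DiffE singletonI)
  next
    show "finite (X - {t})" "finite (E - {e})" using Suc.prems by simp_all
    show "\<And>s. s \<in> X - {t} \<Longrightarrow> card s = 3" using Suc.prems(4) by blast
    show "\<And>e'. e' \<in> E - {e} \<Longrightarrow> e' \<subseteq> V \<and> card e' = 2" using Suc.prems(6) by blast
    show "e' \<in> E - {e}" if "s \<in> X - {t}" "e' \<subseteq> s" "card e' = 2" for s e'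
      using Suc.prems(5)[of s e'] that free[of s] by blast
  qed
  moreover have "e \<in> E" using Suc.prems(5) t by simp
  then have "card (E - {e}) + 1 = card E" "card (X - {t}) + 1 = card X"
    using Suc.prems(1,2) t(1) card_Suc_Diff1 by fastforce+
  ultimately show ?case by linarith
qed

section \<open>Triangulated spheres\<close>

definition skeleton_edges :: "'a set set \<Rightarrow> 'a set set" where
  "skeleton_edges F = {e. card e = 2 \<and> (\<exists>t\<in>F. e \<subseteq> t)}"

lemma skeleton_edgesI: "t \<in> F \<Longrightarrow> x \<in> t \<Longrightarrow> y \<in> t \<Longrightarrow> x \<noteq> y \<Longrightarrow> {x, y} \<in> skeleton_edges F"
  unfolding skeleton_edges_def by auto

lemma skeleton_edges_subset: "e \<in> skeleton_edges F \<Longrightarrow> e \<subseteq> \<Union>F \<and> card e = 2"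
  unfolding skeleton_edges_def by blast

lemma card_3E:
  assumes "card t = 3"
  obtains a b d where "t = {a, b, d}" "a \<noteq> b" "a \<noteq> d" "b \<noteq> d"
  using assms by (auto simp: card_3_iff)

lemma two_subsets_of_three:
  assumes "a \<noteq> b" "a \<noteq> d" "b \<noteq> d"
  shows "e \<subseteq> {a, b, d} \<and> card e = 2 \<longleftrightarrow> e \<in> {{a, b}, {a, d}, {b, d}}"
proof
  assume e: "e \<subseteq> {a, b, d} \<and> card e = 2"
  then obtain x y where "e = {x, y}" "x \<noteq> y" by (auto simp: card_2_iff)
  with e show "e \<in> {{a, b}, {a, d}, {b, d}}" by (auto simp: doubleton_eq_iff)
qed (use assms in auto)

lemma sum_card_incidence:
  assumes "finite D" "finite F"
  shows "(\<Sum>e\<in>D. card {t \<in> F. e \<subseteq> t}) = (\<Sum>t\<in>F. card {e \<in> D. e \<subseteq> t})"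
proof -
  have "(\<Sum>e\<in>D. card {t \<in> F. e \<subseteq> t}) = (\<Sum>e\<in>D. \<Sum>t\<in>F. if e \<subseteq> t then 1 else 0)"
    using assms by (simp add: sum.If_cases Int_def)
  also have "\<dots> = (\<Sum>t\<in>F. \<Sum>e\<in>D. if e \<subseteq> t then 1 else 0)" by (rule sum.swap)
  also have "\<dots> = (\<Sum>t\<in>F. card {e \<in> D. e \<subseteq> t})"
    using assms by (simp add: sum.If_cases Int_def)
  finally show ?thesis .
qed

text \<open>A closed triangulated surface in combinatorial form, with connectedness through edges
  and not merely through vertices. The axioms leave the genus open.\<close>

locale closed_surface =
  fixes F :: "'a set set"
  assumes finite_faces: "finite F"
    and card_face: "t \<in> F \<Longrightarrow> card t = 3"
    and two_faces: "e \<in> skeleton_edges F \<Longrightarrow> card {t \<in> F. e \<subseteq> t} = 2"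
    and strongly_connected: "X \<subseteq> F \<Longrightarrow> X \<noteq> {} \<Longrightarrow>
      (\<And>t s. t \<in> X \<Longrightarrow> s \<in> F \<Longrightarrow> card (t \<inter> s) = 2 \<Longrightarrow> s \<in> X) \<Longrightarrow> X = F"
begin

abbreviation "V \<equiv> \<Union>F"
abbreviation "E \<equiv> skeleton_edges F"

definition faces_meeting :: "'a set \<Rightarrow> nat \<Rightarrow> 'a set set" where
  "faces_meeting A j = {t \<in> F. card (t \<inter> A) = j}"

lemma finite_face: "t \<in> F \<Longrightarrow> finite t"
  using card_face[of t] card.infinite by fastforce

lemma finite_vertices: "finite V"
  using finite_faces finite_face by blast

lemma finite_edges: "finite E"
  by (rule finite_subset[of _ "Pow V"]) (use finite_vertices skeleton_edges_subset in auto)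

text \<open>A nonempty family of faces that is not everything has a face adjacent to one outside.
  Their common edge lies in no third face, so it is free in the family.\<close>

lemma collapsible_proper:
  assumes "X \<subseteq> F" "X \<noteq> F"
  shows "collapsible X"
  unfolding collapsible_def
proof (intro allI impI)
  fix Y assume Y: "Y \<subseteq> X \<and> Y \<noteq> {}"
  have "\<exists>t s. t \<in> Y \<and> s \<in> F \<and> card (t \<inter> s) = 2 \<and> s \<notin> Y"
    using strongly_connected[of Y] Y assms by blast
  then obtain t s where ts: "t \<in> Y" "s \<in> F" "card (t \<inter> s) = 2" "s \<notin> Y" by blast
  have t: "t \<in> F" "t \<noteq> s" using ts Y assms by auto
  then have "t \<inter> s \<in> E" unfolding skeleton_edges_def using ts by blast
  then have "card {u \<in> F. t \<inter> s \<subseteq> u} = 2" by (rule two_faces)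
  moreover have "{t, s} \<subseteq> {u \<in> F. t \<inter> s \<subseteq> u}" "card {t, s} = 2" using t ts by auto
  ultimately have "{u \<in> F. t \<inter> s \<subseteq> u} = {t, s}"
    using finite_faces by (metis (no_types, lifting) card_subset_eq finite_Collect_conjI finite_subset mem_Collect_eq subsetI)
  then have "free_edge Y t (t \<inter> s)"
    unfolding free_edge_def using ts Y assms by blast
  then show "\<exists>t e. free_edge Y t e" by blast
qed

text \<open>If no edge leaves S, every face meeting S lies in S, so the faces meeting S are closed
  under adjacency and must be all faces.\<close>

lemma cut_connected_skeleton: "cut_connected V E"
  unfolding cut_connected_def
proof (intro allI impI, rule ccontr)
  fix S assume S: "S \<subseteq> V \<and> S \<noteq> {} \<and> S \<noteq> V" and no: "\<not> (\<exists>x\<in>S. \<exists>y\<in>V - S. {x, y} \<in> E)"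
  define X where "X = {t \<in> F. t \<inter> S \<noteq> {}}"
  have X: "t \<subseteq> S" if "t \<in> X" for t
    using that no skeleton_edgesI[of t F] unfolding X_def by blast
  have "X = F"
  proof (rule strongly_connected)
    show "X \<subseteq> F" "X \<noteq> {}" using S unfolding X_def by blast+
    fix t s assume "t \<in> X" "s \<in> F" "card (t \<inter> s) = 2"
    moreover from this have "t \<inter> s \<noteq> {}" by auto
    ultimately show "s \<in> X" using X[of t] unfolding X_def by blast
  qed
  then show False using X S by blast
qed

text \<open>Since A omits a vertex, the faces inside A omit a face, so they are collapsible and the
  collapse bound applies.\<close>

lemma euler_char_le:
  assumes "A \<subseteq> V" "A \<noteq> V" "cut_connected A {e \<in> E. e \<subseteq> A}"
  shows "card A + card {t \<in> F. t \<subseteq> A} \<le> card {e \<in> E. e \<subseteq> A} + 1"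
proof (rule collapse_connected_card_le)
  show "finite A" using assms finite_vertices finite_subset by blast
  show "collapsible {t \<in> F. t \<subseteq> A}" by (rule collapsible_proper) (use assms in blast)+
  show "finite {e \<in> E. e \<subseteq> A}" "finite {t \<in> F. t \<subseteq> A}"
    using finite_edges finite_faces by simp_all
  show "cut_connected A {e \<in> E. e \<subseteq> A}" by (fact assms)
qed (use card_face in \<open>auto simp: skeleton_edges_def\<close>)

section \<open>Counting faces and edges by their vertices in A\<close>

lemma card_vertices_split:
  assumes "A \<subseteq> V"
  shows "card V = card A + card (V - A)"
  using assms finite_vertices by (metis card_Un_disjoint Diff_disjoint Un_Diff_cancel
    finite_Diff finite_subset sup.absorb2)

lemma card_Int_face_le:
  assumes "t \<in> F" shows "card (t \<inter> A) \<le> 3"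
  using card_mono[of t "t \<inter> A"] finite_face[OF assms] card_face[OF assms] by simp

lemma faces_meeting_3: "faces_meeting A 3 = {t \<in> F. t \<subseteq> A}"
proof -
  have "card (t \<inter> A) = 3 \<longleftrightarrow> t \<subseteq> A" if t: "t \<in> F" for t
    using card_subset_eq[OF finite_face[OF t], of "t \<inter> A"] card_face[OF t]
    by (auto simp: Int_absorb2)
  then show ?thesis unfolding faces_meeting_def by blast
qed

lemma faces_meeting_0:
  assumes "A \<subseteq> V"
  shows "faces_meeting A 0 = {t \<in> F. t \<subseteq> V - A}"
proof -
  have "card (t \<inter> A) = 0 \<longleftrightarrow> t \<subseteq> V - A" if t: "t \<in> F" for t
    using finite_face[OF t] t by auto
  then show ?thesis unfolding faces_meeting_def by blast
qed

lemma card_faces_split: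
  "card F = card (faces_meeting A 0) + card (faces_meeting A 1)
     + card (faces_meeting A 2) + card (faces_meeting A 3)"
proof -
  have "F = faces_meeting A 0 \<union> (faces_meeting A 1 \<union> (faces_meeting A 2 \<union> faces_meeting A 3))"
  proof -
    have "card (t \<inter> A) = 0 \<or> card (t \<inter> A) = 1 \<or> card (t \<inter> A) = 2 \<or> card (t \<inter> A) = 3"
      if "t \<in> F" for t
      using card_Int_face_le[OF that, of A] by linarith
    then show ?thesis unfolding faces_meeting_def by blast
  qed
  then have "card F = card (faces_meeting A 0 \<union> (faces_meeting A 1 \<union> (faces_meeting A 2 \<union> faces_meeting A 3)))"
    by simp
  also have "\<dots> = card (faces_meeting A 0) + card (faces_meeting A 1 \<union> (faces_meeting A 2 \<union> faces_meeting A 3))"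
    using finite_faces unfolding faces_meeting_def by (intro card_Un_disjoint) auto
  also have "card (faces_meeting A 1 \<union> (faces_meeting A 2 \<union> faces_meeting A 3)) =
    card (faces_meeting A 1) + card (faces_meeting A 2 \<union> faces_meeting A 3)"
    using finite_faces unfolding faces_meeting_def by (intro card_Un_disjoint) auto
  also have "card (faces_meeting A 2 \<union> faces_meeting A 3) =
    card (faces_meeting A 2) + card (faces_meeting A 3)"
    using finite_faces unfolding faces_meeting_def by (intro card_Un_disjoint) auto
  finally show ?thesis by simp
qed

lemma card_edges_split:
  assumes "A \<subseteq> V"
  shows "card E = card {e \<in> E. e \<subseteq> A} + card {e \<in> E. e \<subseteq> V - A} + card (boundary_edges E A)"
proof -
  have "E = {e \<in> E. e \<subseteq> A} \<union> {e \<in> E. e \<subseteq> V - A} \<union> boundary_edges E A"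
    using skeleton_edges_subset unfolding boundary_edges_def by blast
  then have "card E = card ({e \<in> E. e \<subseteq> A} \<union> {e \<in> E. e \<subseteq> V - A} \<union> boundary_edges E A)" by simp
  also have "\<dots> = card ({e \<in> E. e \<subseteq> A} \<union> {e \<in> E. e \<subseteq> V - A}) + card (boundary_edges E A)"
    using finite_edges unfolding boundary_edges_def by (intro card_Un_disjoint) auto
  also have "card ({e \<in> E. e \<subseteq> A} \<union> {e \<in> E. e \<subseteq> V - A}) =
    card {e \<in> E. e \<subseteq> A} + card {e \<in> E. e \<subseteq> V - A}"
  proof (intro card_Un_disjoint)
    have "e \<noteq> {}" if "e \<in> E" for e using skeleton_edges_subset[OF that] by auto
    then show "{e \<in> E. e \<subseteq> A} \<inter> {e \<in> E. e \<subseteq> V - A} = {}" by blast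
  qed (use finite_edges in auto)
  finally show ?thesis .
qed

lemma sum_over_faces_meeting:
  fixes g :: "nat \<Rightarrow> nat"
  shows "(\<Sum>t\<in>F. g (card (t \<inter> A))) = g 0 * card (faces_meeting A 0) + g 1 * card (faces_meeting A 1)
    + g 2 * card (faces_meeting A 2) + g 3 * card (faces_meeting A 3)"
proof -
  have "(\<Sum>t\<in>F. g (card (t \<inter> A))) =
    (\<Sum>t\<in>F. \<Sum>j\<in>{0,1,2,3}. if card (t \<inter> A) = j then g j else 0)"
  proof (rule sum.cong)
    fix t assume "t \<in> F"
    then have "card (t \<inter> A) \<in> {0, 1, 2, 3}"
      using card_Int_face_le[of t A] by (auto simp: le_Suc_eq numeral_eq_Suc)
    then show "g (card (t \<inter> A)) = (\<Sum>j\<in>{0,1,2,3}. if card (t \<inter> A) = j then g j else 0)"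
      by auto
  qed simp
  also have "\<dots> = (\<Sum>j\<in>{0,1,2,3}. \<Sum>t\<in>F. if card (t \<inter> A) = j then g j else 0)"
    by (rule sum.swap)
  also have "\<dots> = (\<Sum>j\<in>{0,1,2,3}. g j * card (faces_meeting A j))"
    using finite_faces unfolding faces_meeting_def
    by (intro sum.cong) (simp_all add: sum.If_cases Int_def)
  finally show ?thesis by simp
qed

lemma face_edges_card:
  assumes t: "t \<in> F"
  shows "card {e \<in> boundary_edges E A. e \<subseteq> t} = (if card (t \<inter> A) \<in> {1, 2} then 2 else 0)"
    and "card {e \<in> {e \<in> E. e \<subseteq> A}. e \<subseteq> t} = (if card (t \<inter> A) = 2 then 1 else if card (t \<inter> A) = 3 then 3 else 0)"
proof -
  obtain a b d where abd: "t = {a, b, d}" "a \<noteq> b" "a \<noteq> d" "b \<noteq> d"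
    using card_face[OF t] by (rule card_3E)
  have "e \<in> E \<and> e \<subseteq> t \<longleftrightarrow> e \<subseteq> t \<and> card e = 2" for e
    using t unfolding skeleton_edges_def by blast
  then have et: "e \<in> E \<and> e \<subseteq> t \<longleftrightarrow> e \<in> {{a, b}, {a, d}, {b, d}}" for e
    unfolding abd(1) two_subsets_of_three[OF abd(2-4)] by simp
  have ne: "{a, b} \<noteq> {a, d}" "{a, b} \<noteq> {b, d}" "{a, d} \<noteq> {b, d}"
    using abd by (auto simp: doubleton_eq_iff)
  have 1: "{e \<in> boundary_edges E A. e \<subseteq> t} =
    {e \<in> {{a, b}, {a, d}, {b, d}}. e \<inter> A \<noteq> {} \<and> \<not> e \<subseteq> A}"
  proof -
    have "{e \<in> boundary_edges E A. e \<subseteq> t} = {e. (e \<in> E \<and> e \<subseteq> t) \<and> e \<inter> A \<noteq> {} \<and> \<not> e \<subseteq> A}"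
      unfolding boundary_edges_def by blast
    then show ?thesis unfolding et .
  qed
  have 2: "{e \<in> {e \<in> E. e \<subseteq> A}. e \<subseteq> t} = {e \<in> {{a, b}, {a, d}, {b, d}}. e \<subseteq> A}"
  proof -
    have "{e \<in> {e \<in> E. e \<subseteq> A}. e \<subseteq> t} = {e. (e \<in> E \<and> e \<subseteq> t) \<and> e \<subseteq> A}" by blast
    then show ?thesis unfolding et .
  qed
  have filt: "{e \<in> {p, q, r}. P e} = (if P p then {p} else {}) \<union> (if P q then {q} else {}) \<union> (if P r then {r} else {})"
    for p q r :: "'a set" and P by auto
  have tA: "t \<inter> A = (if a \<in> A then {a} else {}) \<union> (if b \<in> A then {b} else {}) \<union> (if d \<in> A then {d} else {})"
    unfolding abd by auto
  show "card {e \<in> boundary_edges E A. e \<subseteq> t} = (if card (t \<inter> A) \<in> {1, 2} then 2 else 0)"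
    unfolding 1 filt tA using ne abd(2-4) by (cases "a \<in> A"; cases "b \<in> A"; cases "d \<in> A") auto
  show "card {e \<in> {e \<in> E. e \<subseteq> A}. e \<subseteq> t} = (if card (t \<inter> A) = 2 then 1 else if card (t \<inter> A) = 3 then 3 else 0)"
    unfolding 2 filt tA using ne abd(2-4) by (cases "a \<in> A"; cases "b \<in> A"; cases "d \<in> A") auto
qed

text \<open>Incidences counted twice: a cut edge lies in two faces, and a face with one or two
  vertices in A has exactly two cut edges.\<close>

lemma card_boundary_edges:
  "card (boundary_edges E A) = card (faces_meeting A 1) + card (faces_meeting A 2)"
proof -
  have sub: "boundary_edges E A \<subseteq> E" unfolding boundary_edges_def by blast
  have "2 * card (boundary_edges E A) = (\<Sum>e\<in>boundary_edges E A. card {t \<in> F. e \<subseteq> t})"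
    using two_faces sub by (simp add: subset_iff)
  also have "\<dots> = (\<Sum>t\<in>F. card {e \<in> boundary_edges E A. e \<subseteq> t})"
    using finite_faces finite_subset[OF sub finite_edges] by (rule sum_card_incidence[rotated])
  also have "\<dots> = (\<Sum>t\<in>F. (\<lambda>j. if j \<in> {1, 2} then 2 else 0) (card (t \<inter> A)))"
    by (intro sum.cong refl) (simp add: face_edges_card)
  also have "\<dots> = 2 * (card (faces_meeting A 1) + card (faces_meeting A 2))"
    by (subst sum_over_faces_meeting) simp
  finally show ?thesis by simp
qed

text \<open>Incidences again: a face with two vertices in A has one edge inside A, and a face
  contained in A has three.\<close>

lemma card_inner_edges:
  "2 * card {e \<in> E. e \<subseteq> A} = card (faces_meeting A 2) + 3 * card (faces_meeting A 3)"
proof -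
  have "2 * card {e \<in> E. e \<subseteq> A} = (\<Sum>e\<in>{e \<in> E. e \<subseteq> A}. card {t \<in> F. e \<subseteq> t})"
    using two_faces by simp
  also have "\<dots> = (\<Sum>t\<in>F. card {e \<in> {e \<in> E. e \<subseteq> A}. e \<subseteq> t})"
    using finite_faces finite_edges by (intro sum_card_incidence) auto
  also have "\<dots> = (\<Sum>t\<in>F. (\<lambda>j. if j = 2 then 1 else if j = 3 then 3 else 0) (card (t \<inter> A)))"
    by (intro sum.cong refl) (simp only: face_edges_card)
  also have "\<dots> = card (faces_meeting A 2) + 3 * card (faces_meeting A 3)"
    by (subst sum_over_faces_meeting) simp
  finally show ?thesis .
qed

end

locale triangulated_sphere = closed_surface +
  assumes euler: "card (skeleton_edges F) + 2 \<le> card (\<Union>F) + card F"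
begin

text \<open>Both sides of a bond have Euler characteristic at most 1, and these add up to at least 2.\<close>

lemma bond_card:
  assumes "A \<subseteq> V" "A \<noteq> {}" "A \<noteq> V"
    and "cut_connected A {e \<in> E. e \<subseteq> A}" "cut_connected (V - A) {e \<in> E. e \<subseteq> V - A}"
  shows "2 * card A = 2 + card (faces_meeting A 2) + card (faces_meeting A 3)"
proof -
  have "card A + card (faces_meeting A 3) \<le> card {e \<in> E. e \<subseteq> A} + 1"
    unfolding faces_meeting_3 by (rule euler_char_le[OF assms(1,3,4)])
  moreover have "card (V - A) + card (faces_meeting A 0) \<le> card {e \<in> E. e \<subseteq> V - A} + 1"
    unfolding faces_meeting_0[OF assms(1)] by (rule euler_char_le) (use assms in auto)
  \<comment> \<open>The upper bounds are forced to be equalities. Doubling |A| + f3 = e + 1 for the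
    edges e inside A and inserting 2 e = f2 + 3 f3 yields the stated form, free of edges.\<close>
  ultimately show ?thesis
    using euler card_vertices_split[OF assms(1)] card_edges_split[OF assms(1)]
      card_faces_split[of A] card_boundary_edges[of A] card_inner_edges[of A]
    by linarith
qed

text \<open>Otherwise \<open>A \<union> {v}\<close> and \<open>V - A\<close>, which share only \<open>v\<close> and cover all edges and faces, would
  have Euler characteristics adding up to at least 3.\<close>

lemma bond_at_vertex:
  assumes "A \<subseteq> V" "A \<noteq> {}"
    and "cut_connected A {e \<in> E. e \<subseteq> A}" "cut_connected (V - A) {e \<in> E. e \<subseteq> V - A}"
    and v: "v \<in> V - A" "\<And>e. e \<in> boundary_edges E A \<Longrightarrow> v \<in> e"
  shows "V - A = {v}"
proof (rule ccontr)
  assume nv: "V - A \<noteq> {v}"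
  define A' where "A' = insert v A"
  have A': "A' \<subseteq> V" "A' \<noteq> V" using assms nv unfolding A'_def by auto
  have "A \<noteq> V" using v by blast
  then obtain x y where xy: "x \<in> A" "y \<in> V - A" "{x, y} \<in> E"
    using cut_connectedD[OF cut_connected_skeleton, of A] assms by metis
  then have "{x, y} \<in> boundary_edges E A" unfolding boundary_edges_def by blast
  then have y: "y = v" using v xy by blast
  have "cut_connected A' {e \<in> E. e \<subseteq> A'}"
    unfolding cut_connected_def
  proof (intro allI impI)
    fix S assume S: "S \<subseteq> A' \<and> S \<noteq> {} \<and> S \<noteq> A'"
    show "\<exists>x\<in>S. \<exists>y\<in>A' - S. {x, y} \<in> {e \<in> E. e \<subseteq> A'}"
    proof (cases "S \<inter> A = {} \<or> S \<inter> A = A")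
      case True
      then have "S = {v} \<or> S = A" using S v unfolding A'_def by auto
      then show ?thesis
      proof
        assume "S = {v}"
        then show ?thesis using xy y v unfolding A'_def
          by (intro bexI[of _ v] bexI[of _ x]) (auto simp: insert_commute)
      next
        assume "S = A"
        then show ?thesis using xy y v unfolding A'_def
          by (intro bexI[of _ v] bexI[of _ x]) auto
      qed
    next
      case False
      then obtain x y where "x \<in> S \<inter> A" "y \<in> A - S \<inter> A" "{x, y} \<in> {e \<in> E. e \<subseteq> A}"
        using cut_connectedD[OF assms(3), of "S \<inter> A"] by (metis inf.cobounded2)
      then show ?thesis unfolding A'_def by (intro bexI[of _ y] bexI[of _ x]) auto
    qed
  qed
  then have 1: "card A' + card {t \<in> F. t \<subseteq> A'} \<le> card {e \<in> E. e \<subseteq> A'} + 1"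
    by (rule euler_char_le[OF A'])
  have 2: "card (V - A) + card {t \<in> F. t \<subseteq> V - A} \<le> card {e \<in> E. e \<subseteq> V - A} + 1"
    by (rule euler_char_le) (use assms in auto)
  have E: "E = {e \<in> E. e \<subseteq> A'} \<union> {e \<in> E. e \<subseteq> V - A}"
  proof -
    have "e \<subseteq> A'" if e: "e \<in> E" "\<not> e \<subseteq> V - A" for e
    proof (cases "e \<subseteq> A")
      case False
      obtain p q where pq: "e = {p, q}" using skeleton_edges_subset[OF e(1)] by (auto simp: card_2_iff)
      have "e \<in> boundary_edges E A"
        using e False skeleton_edges_subset[OF e(1)] unfolding boundary_edges_def by blast
      then have "v \<in> e" by (rule v)
      then show ?thesis using pq e skeleton_edges_subset[OF e(1)] v unfolding A'_def by auto
    qed (auto simp: A'_def)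
    then show ?thesis by blast
  qed
  have "card {e \<in> E. e \<subseteq> A'} + card {e \<in> E. e \<subseteq> V - A} = card E"
  proof (subst (3) E, rule card_Un_disjoint[symmetric])
    have "\<not> e \<subseteq> {v}" if "e \<in> E" for e
    proof
      assume "e \<subseteq> {v}"
      then have "card e \<le> card {v}" by (intro card_mono) auto
      then show False using skeleton_edges_subset[OF that] by simp
    qed
    then show "{e \<in> E. e \<subseteq> A'} \<inter> {e \<in> E. e \<subseteq> V - A} = {}" unfolding A'_def by blast
  qed (use finite_edges in auto)
  moreover have "card {t \<in> F. t \<subseteq> A'} + card {t \<in> F. t \<subseteq> V - A} = card F"
  proof -
    have "t \<subseteq> A'" if t: "t \<in> F" "\<not> t \<subseteq> V - A" for t
    proof
      fix p assume p: "p \<in> t"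
      obtain a where a: "a \<in> t" "a \<in> A" using t by blast
      show "p \<in> A'"
      proof (cases "p \<in> A")
        case False
        then have "{a, p} \<in> E" using skeleton_edgesI[OF t(1) a(1) p] a by blast
        then have "{a, p} \<in> boundary_edges E A"
          using a False unfolding boundary_edges_def by blast
        then have "v \<in> {a, p}" by (rule v)
        then show ?thesis using a v unfolding A'_def by auto
      qed (simp add: A'_def)
    qed
    then have F: "F = {t \<in> F. t \<subseteq> A'} \<union> {t \<in> F. t \<subseteq> V - A}" by blast
    show ?thesis
    proof (subst (3) F, rule card_Un_disjoint[symmetric])
      have "\<not> t \<subseteq> {v}" if "t \<in> F" for t
      proof
        assume "t \<subseteq> {v}"
        then have "card t \<le> card {v}" by (intro card_mono) auto
        then show False using card_face[OF that] by simp
      qed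
      then show "{t \<in> F. t \<subseteq> A'} \<inter> {t \<in> F. t \<subseteq> V - A} = {}" unfolding A'_def by blast
    qed (use finite_faces in auto)
  qed
  moreover have "card A' = card A + 1"
    using v finite_subset[OF assms(1) finite_vertices] unfolding A'_def by auto
  ultimately show False using 1 2 euler card_vertices_split[OF assms(1)] by linarith
qed

end

section \<open>Simple polygons\<close>

lemma pathstart_polygonal_path: "xs \<noteq> [] \<Longrightarrow> pathstart (polygonal_path xs) = hd xs"
  by (induction xs rule: polygonal_path.induct) simp_all

lemma pathfinish_polygonal_path: "xs \<noteq> [] \<Longrightarrow> pathfinish (polygonal_path xs) = last xs"
  by (induction xs rule: polygonal_path.induct) simp_all

lemma path_image_polygonal_path:
  "2 \<le> length xs \<Longrightarrow> path_image (polygonal_path xs) =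
    (\<Union>i\<in>{i. Suc i < length xs}. closed_segment (xs ! i) (xs ! Suc i))"
proof (induction xs rule: polygonal_path.induct)
  case (4 a b c xs)
  let ?zs = "b # c # xs"
  have "{i. Suc i < length (a # ?zs)} = insert 0 (Suc ` {i. Suc i < length ?zs})"
    by (auto simp: image_iff gr0_conv_Suc less_Suc_eq_0_disj)
  then have "(\<Union>i\<in>{i. Suc i < length (a # ?zs)}. closed_segment ((a # ?zs) ! i) ((a # ?zs) ! Suc i)) =
    closed_segment a b \<union> (\<Union>i\<in>{i. Suc i < length ?zs}. closed_segment (?zs ! i) (?zs ! Suc i))"
    by (simp only: UN_insert image_image UN_simps(10) nth_Cons_0 nth_Cons_Suc)
  moreover have "path_image (polygonal_path (a # ?zs)) = closed_segment a b \<union> path_image (polygonal_path ?zs)"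
    by (simp add: path_image_join pathstart_polygonal_path)
  ultimately show ?case using 4 by simp
qed (auto simp: less_Suc_eq)

lemma set_subset_path_image:
  assumes "2 \<le> length xs"
  shows "set xs \<subseteq> path_image (polygonal_path xs)"
proof
  fix x assume "x \<in> set xs"
  then obtain i where i: "i < length xs" "x = xs ! i" by (metis in_set_conv_nth)
  show "x \<in> path_image (polygonal_path xs)"
  proof (cases "Suc i < length xs")
    case True
    then show ?thesis using i unfolding path_image_polygonal_path[OF assms] by blast
  next
    case False
    then have "Suc (i - 1) < length xs" "Suc (i - 1) = i" using i assms by linarith+
    then show ?thesis using i unfolding path_image_polygonal_path[OF assms]
      by (metis (mono_tags, lifting) UN_I ends_in_segment(2) mem_Collect_eq)
  qed
qed

lemma arc_polygonal_path_distinct: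
  "2 \<le> length xs \<Longrightarrow> arc (polygonal_path xs) \<Longrightarrow> distinct xs"
proof (induction xs rule: polygonal_path.induct)
  case (3 a b)
  then show ?case by (auto dest: arc_distinct_ends)
next
  case (4 a b c xs)
  let ?zs = "b # c # xs"
  have "pathfinish (linepath a b) = pathstart (polygonal_path ?zs)"
    by (simp add: pathstart_polygonal_path)
  then have *: "arc (linepath a b)" "arc (polygonal_path ?zs)"
    "path_image (linepath a b) \<inter> path_image (polygonal_path ?zs) \<subseteq> {b}"
    using "4.prems"(2) by (simp_all add: arc_join_eq pathstart_polygonal_path)
  then have "a \<noteq> b" by (auto dest: arc_distinct_ends)
  then have "a \<notin> set ?zs"
    using *(3) set_subset_path_image[of ?zs] by auto
  then show ?case using "4.IH" *(2) by simp
qed simp_all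

text \<open>Dropping the first edge of the closed path leaves an arc through all the
  vertices.\<close>

lemma simple_polygon_distinct:
  assumes "simple_polygon p"
  shows "distinct p"
proof -
  obtain a b c xs where p: "p = a # b # c # xs"
    using assms unfolding simple_polygon_def
    by (metis One_nat_def Suc_1 length_0_conv length_Cons not_less_eq_eq numeral_3_eq_3 neq_Nil_conv zero_le not_less_eq_eq list.size(3))
  let ?zs = "b # c # xs @ [a]"
  have "simple_path (linepath a b +++ polygonal_path ?zs)"
    using assms unfolding simple_polygon_def p by simp
  then have "arc (polygonal_path ?zs)"
    by (subst (asm) simple_path_join_loop_eq) (simp_all add: pathstart_polygonal_path pathfinish_polygonal_path)
  then have "distinct ?zs" by (intro arc_polygonal_path_distinct) simp_all
  then show ?thesis unfolding p by auto
qed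

lemma polygon_boundary_eq:
  assumes "simple_polygon p"
  shows "polygon_boundary p = (\<Union>e\<in>polygon_edges p. convex hull e)"
proof -
  let ?n = "length p"
  have n: "3 \<le> ?n" using assms unfolding simple_polygon_def by blast
  have nth: "(p @ [hd p]) ! i = p ! i" "(p @ [hd p]) ! Suc i = p ! (Suc i mod ?n)" if "i < ?n" for i
  proof -
    show "(p @ [hd p]) ! i = p ! i" using that by (simp add: nth_append)
    show "(p @ [hd p]) ! Suc i = p ! (Suc i mod ?n)"
    proof (cases "Suc i = ?n")
      case True
      then show ?thesis using n by (cases p) (simp_all add: nth_append)
    next
      case False
      then have "Suc i < ?n" using that by linarith
      then show ?thesis by (simp add: nth_append)
    qed
  qed
  have "polygon_boundary p = (\<Union>i\<in>{i. i < ?n}. closed_segment ((p @ [hd p]) ! i) ((p @ [hd p]) ! Suc i))"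
    unfolding polygon_boundary_def using n by (subst path_image_polygonal_path) auto
  also have "\<dots> = (\<Union>i\<in>{i. i < ?n}. convex hull {p ! i, p ! (Suc i mod ?n)})"
    by (intro SUP_cong refl) (simp add: nth segment_convex_hull)
  finally show ?thesis unfolding polygon_edges_def by auto
qed

lemma finite_polygon_edges: "finite (polygon_edges p)"
  unfolding polygon_edges_def by simp

lemma card_polygon_edge:
  assumes "simple_polygon p" "e \<in> polygon_edges p"
  shows "card e = 2"
proof -
  have n: "3 \<le> length p" using assms unfolding simple_polygon_def by blast
  obtain i where i: "i < length p" "e = {p ! i, p ! (Suc i mod length p)}"
    using assms(2) unfolding polygon_edges_def by blast
  have "Suc i mod length p \<noteq> i"
    using i(1) n by (cases "Suc i = length p") auto
  moreover have "Suc i mod length p < length p" using i by (intro mod_less_divisor) linarith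
  ultimately have "p ! i \<noteq> p ! (Suc i mod length p)"
    using simple_polygon_distinct[OF assms(1)] i(1) by (metis nth_eq_iff_index_eq)
  then show ?thesis unfolding i(2) by simp
qed

lemma Union_polygon_edges:
  assumes "simple_polygon p"
  shows "\<Union>(polygon_edges p) = set p"
proof -
  have "Suc i mod length p < length p" if "i < length p" for i
    using that by (intro mod_less_divisor) linarith
  then show ?thesis unfolding polygon_edges_def set_conv_nth by blast
qed

lemma card_polygon_edges_at_vertex:
  assumes "simple_polygon p" "v \<in> set p"
  shows "card {e \<in> polygon_edges p. v \<in> e} = 2"
proof -
  let ?n = "length p"
  have n: "3 \<le> ?n" using assms unfolding simple_polygon_def by blast
  have inj: "p ! j = p ! k \<longleftrightarrow> j = k" if "j < ?n" "k < ?n" for j k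
    using simple_polygon_distinct[OF assms(1)] that by (rule nth_eq_iff_index_eq)
  obtain i where i: "i < ?n" "v = p ! i" using assms(2) by (metis in_set_conv_nth)
  \<comment> \<open>\<open>k\<close> and \<open>s\<close> are the cyclic predecessor of
    \<open>i\<close> and the cyclic successor map. With at least three vertices the two neighbours
    of \<open>i\<close> differ, hence so do the two edges at it.\<close>
  define k where "k = (if i = 0 then ?n - 1 else i - 1)"
  define s where "s j = (if Suc j = ?n then 0 else Suc j)" for j
  have s: "Suc j mod ?n = s j" if "j < ?n" for j using that unfolding s_def by auto
  have s_less: "s j < ?n" if "j < ?n" for j using that unfolding s_def by auto
  have k: "k < ?n" "s k = i" using i(1) n unfolding k_def s_def by auto
  have s_eq: "s j = i \<longleftrightarrow> j = k" if "j < ?n" for j using that i(1) n unfolding k_def s_def by auto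
  have ne: "k \<noteq> i" "s i \<noteq> i" "s i \<noteq> k" using i(1) n unfolding k_def s_def by (auto split: if_splits)
  have "{e \<in> polygon_edges p. v \<in> e} = {{p ! i, p ! s i}, {p ! k, p ! i}}"
  proof (intro equalityI subsetI)
    fix e assume "e \<in> {e \<in> polygon_edges p. v \<in> e}"
    then obtain j where j: "j < ?n" "e = {p ! j, p ! s j}" "v \<in> e"
      unfolding polygon_edges_def using s by auto
    then have "i = j \<or> s j = i" using i inj s_less by auto
    then have "j = i \<or> j = k" using s_eq j by auto
    then show "e \<in> {{p ! i, p ! s i}, {p ! k, p ! i}}" using j k by auto
  next
    fix e assume "e \<in> {{p ! i, p ! s i}, {p ! k, p ! i}}"
    then have "(e = {p ! i, p ! s i} \<or> e = {p ! k, p ! s k}) \<and> v \<in> e" using i k by auto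
    then show "e \<in> {e \<in> polygon_edges p. v \<in> e}"
      unfolding polygon_edges_def using s i(1) k(1) by auto
  qed
  moreover have "{p ! i, p ! s i} \<noteq> {p ! k, p ! i}"
    using inj i(1) k(1) s_less ne by (auto simp: doubleton_eq_iff)
  ultimately show ?thesis by simp
qed

text \<open>All parts rest on the Jordan curve theorem. The closed region has no interior points on
  the curve because each point of the curve is also a limit of points outside.\<close>

lemma polygon_Jordan:
  assumes "simple_polygon p"
  shows "compact (polygon_boundary p)" "open (polygon_interior p)" "connected (polygon_interior p)"
    "bounded (polygon_interior p)"
    "polygon_interior p \<noteq> {}" "polygon_boundary p \<inter> polygon_interior p = {}"
    "connected (- (polygon_boundary p \<union> polygon_interior p))"
    "interior (polygon_boundary p \<union> polygon_interior p) = polygon_interior p"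
    "compact (polygon_boundary p \<union> polygon_interior p)"
proof -
  let ?g = "polygonal_path (p @ [hd p])"
  have ne: "p \<noteq> []" and simple: "simple_path ?g" using assms unfolding simple_polygon_def by auto
  have closed: "pathfinish ?g = pathstart ?g"
    using ne by (simp add: pathstart_polygonal_path pathfinish_polygonal_path)
  note J = Jordan_inside_outside[OF simple closed, folded polygon_boundary_def, folded polygon_interior_def]
  show comp: "compact (polygon_boundary p)"
    unfolding polygon_boundary_def using simple by (simp add: compact_simple_path_image)
  show "open (polygon_interior p)" "connected (polygon_interior p)"
    "bounded (polygon_interior p)" "polygon_interior p \<noteq> {}" using J by blast+
  show disj: "polygon_boundary p \<inter> polygon_interior p = {}"
    unfolding polygon_interior_def using inside_no_overlap by blast
  have out: "outside (polygon_boundary p) = - (polygon_boundary p \<union> polygon_interior p)"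
    using J by blast
  show "connected (- (polygon_boundary p \<union> polygon_interior p))" using J out by metis
  have "closure (outside (polygon_boundary p)) = outside (polygon_boundary p) \<union> polygon_boundary p"
    using J closure_Un_frontier by metis
  then show "interior (polygon_boundary p \<union> polygon_interior p) = polygon_interior p"
    unfolding interior_closure out[symmetric] using out disj by blast
  have "closure (polygon_interior p) = polygon_boundary p \<union> polygon_interior p"
    using J closure_Un_frontier by (metis sup_commute)
  then show "compact (polygon_boundary p \<union> polygon_interior p)"
    using J compact_closure by metis
qed

section \<open>Planar geometry of triangles\<close>

definition cross :: "complex \<Rightarrow> complex \<Rightarrow> real" where
  "cross x y = Re x * Im y - Im x * Re y"

lemma cross_simps:
  "cross x 0 = 0" "cross 0 y = 0" "cross x x = 0"
  "cross (x + y) z = cross x z + cross y z" "cross z (x + y) = cross z x + cross z y"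
  "cross (x - y) z = cross x z - cross y z" "cross z (x - y) = cross z x - cross z y"
  "cross (r *\<^sub>R x) z = r * cross x z" "cross z (r *\<^sub>R x) = r * cross z x"
  "cross (- x) z = - cross x z" "cross z (- x) = - cross z x"
  by (simp_all add: cross_def algebra_simps)

lemma cross_combination:
  "cross (v *\<^sub>R x + w *\<^sub>R y) y = v * cross x y" "cross x (v *\<^sub>R x + w *\<^sub>R y) = w * cross x y"
  by (simp_all add: cross_simps)

lemma cross_anticommute: "cross x y = - cross y x"
  by (simp add: cross_def)

lemma continuous_on_cross [continuous_intros]:
  "continuous_on S f \<Longrightarrow> continuous_on S g \<Longrightarrow> continuous_on S (\<lambda>x. cross (f x) (g x))"
  unfolding cross_def by (intro continuous_intros)

text \<open>Cramer's rule in the plane, \<open>cross\<close> being the determinant.\<close>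

lemma cross_expansion:
  assumes "cross u v \<noteq> 0"
  shows "w = (cross w v / cross u v) *\<^sub>R u + (cross u w / cross u v) *\<^sub>R v"
proof -
  have "cross u v *\<^sub>R w = cross w v *\<^sub>R u + cross u w *\<^sub>R v"
    by (simp add: complex_eq_iff cross_def algebra_simps)
  then have "(1 / cross u v) *\<^sub>R (cross u v *\<^sub>R w) = (1 / cross u v) *\<^sub>R (cross w v *\<^sub>R u + cross u w *\<^sub>R v)"
    by simp
  then show ?thesis using assms by (simp add: scaleR_add_right)
qed

lemma cross_nonzero_of_affine_independent:
  assumes "\<not> affine_dependent {a, b, c}" "a \<noteq> b" "a \<noteq> c" "b \<noteq> c"
  shows "cross (b - a) (c - a) \<noteq> 0"
proof
  assume 0: "cross (b - a) (c - a) = 0"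
  have "(c - a) / (b - a) \<in> \<real>"
  proof -
    have "Im ((c - a) * cnj (b - a)) = 0" using 0 by (simp add: cross_def algebra_simps)
    then have "(c - a) * cnj (b - a) \<in> \<real>" by (simp add: complex_is_Real_iff)
    then have "(c - a) * cnj (b - a) / of_real ((cmod (b - a))\<^sup>2) \<in> \<real>" by simp
    then show ?thesis by (metis complex_div_cnj)
  qed
  then have "collinear {0, b - a, c - a}" by (simp add: collinear_iff_Reals)
  then have "collinear {b, a, c}" by (subst collinear_3) (simp_all add: NO_MATCH_def)
  then have "collinear {a, b, c}" by (simp add: insert_commute)
  then show False using assms by (simp add: collinear_3_eq_affine_dependent)
qed

text \<open>The quotients are the barycentric coordinates of \<open>x\<close> at \<open>b\<close>
  and \<open>c\<close>. Written as quotients they do not depend on the orientation of the triangle,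
  which is why such quotients are used throughout.\<close>

lemma mem_triangle_iff:
  assumes D: "cross (b - a) (c - a) \<noteq> 0"
  shows "x \<in> convex hull {a, b, c} \<longleftrightarrow>
    0 \<le> cross (x - a) (c - a) / cross (b - a) (c - a) \<and>
    0 \<le> cross (b - a) (x - a) / cross (b - a) (c - a) \<and>
    cross (x - a) (c - a) / cross (b - a) (c - a) + cross (b - a) (x - a) / cross (b - a) (c - a) \<le> 1"
    (is "_ \<longleftrightarrow> 0 \<le> ?\<beta> x \<and> 0 \<le> ?\<gamma> x \<and> ?\<beta> x + ?\<gamma> x \<le> 1")
proof
  assume "x \<in> convex hull {a, b, c}"
  then obtain v w where vw: "x = a + v *\<^sub>R (b - a) + w *\<^sub>R (c - a)" "0 \<le> v" "0 \<le> w" "v + w \<le> 1"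
    unfolding convex_hull_3_alt by blast
  then have xa: "x - a = v *\<^sub>R (b - a) + w *\<^sub>R (c - a)" by simp
  have "cross (x - a) (c - a) = v * cross (b - a) (c - a)"
    "cross (b - a) (x - a) = w * cross (b - a) (c - a)"
    unfolding xa by (rule cross_combination)+
  then have "?\<beta> x = v" "?\<gamma> x = w" using D by simp_all
  then show "0 \<le> ?\<beta> x \<and> 0 \<le> ?\<gamma> x \<and> ?\<beta> x + ?\<gamma> x \<le> 1" using vw by simp
next
  assume *: "0 \<le> ?\<beta> x \<and> 0 \<le> ?\<gamma> x \<and> ?\<beta> x + ?\<gamma> x \<le> 1"
  have "x = a + ?\<beta> x *\<^sub>R (b - a) + ?\<gamma> x *\<^sub>R (c - a)"
    using cross_expansion[OF D, of "x - a"] by (simp only: add.assoc) (metis add.commute diff_add_cancel)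
  then show "x \<in> convex hull {a, b, c}" unfolding convex_hull_3_alt using * by blast
qed

lemma mem_interior_triangle:
  assumes D: "cross (b - a) (c - a) \<noteq> 0"
    and "0 < cross (x - a) (c - a) / cross (b - a) (c - a)"
    and "0 < cross (b - a) (x - a) / cross (b - a) (c - a)"
    and "cross (x - a) (c - a) / cross (b - a) (c - a) + cross (b - a) (x - a) / cross (b - a) (c - a) < 1"
  shows "x \<in> interior (convex hull {a, b, c})"
proof (rule interiorI)
  let ?U = "{x. 0 < cross (x - a) (c - a) / cross (b - a) (c - a)} \<inter>
    {x. 0 < cross (b - a) (x - a) / cross (b - a) (c - a)} \<inter>
    {x. cross (x - a) (c - a) / cross (b - a) (c - a) + cross (b - a) (x - a) / cross (b - a) (c - a) < 1}"
  show "open ?U"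
    by (intro open_Int open_Collect_less continuous_intros) (use D in auto)
  show "x \<in> ?U" using assms by simp
  show "?U \<subseteq> convex hull {a, b, c}"
    unfolding mem_triangle_iff[OF D] subset_iff Int_iff mem_Collect_eq using less_imp_le by blast
qed

text \<open>Near an inner point of a side, a triangle is a half disc.\<close>

lemma triangle_half_disc:
  assumes D: "cross (b - a) (c - a) \<noteq> 0" and x: "x \<in> open_segment a b"
  shows "\<forall>\<^sub>F y in nhds x. 0 \<le> cross (b - a) (y - a) / cross (b - a) (c - a)
    \<longrightarrow> y \<in> convex hull {a, b, c}"
proof -
  obtain u where u: "0 < u" "u < 1" "x = (1 - u) *\<^sub>R a + u *\<^sub>R b"
    using x by (auto simp: in_segment)
  have "x - a = u *\<^sub>R (b - a)" using u by (simp add: algebra_simps)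
  then have bx: "cross (x - a) (c - a) / cross (b - a) (c - a) = u"
    and gx: "cross (b - a) (x - a) / cross (b - a) (c - a) = 0"
    using D by (simp_all add: cross_simps(3,8,9))
  let ?U = "{x. 0 < cross (x - a) (c - a) / cross (b - a) (c - a)} \<inter>
    {x. cross (x - a) (c - a) / cross (b - a) (c - a) + cross (b - a) (x - a) / cross (b - a) (c - a) < 1}"
  have "open ?U"
    by (intro open_Int open_Collect_less continuous_intros) (use D in auto)
  moreover have "x \<in> ?U" unfolding Int_iff mem_Collect_eq bx gx using u by simp
  ultimately have "\<forall>\<^sub>F y in nhds x. y \<in> ?U" by (rule eventually_nhds_in_open)
  then show ?thesis
    unfolding mem_triangle_iff[OF D] Int_iff mem_Collect_eq
    by (rule eventually_mono) (use less_imp_le in blast)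
qed

lemma linear_interpolation:
  fixes P R :: real
  assumes D: "cross u v \<noteq> 0"
  obtains L where "linear L" "L u = P" "L v = R"
proof
  let ?L = "\<lambda>w. (cross w v * P + cross u w * R) / cross u v"
  show "linear ?L"
    by (rule linearI) (simp_all add: cross_simps field_simps add_divide_distrib)
  show "?L u = P" "?L v = R" using D by (simp_all add: cross_simps)
qed

lemma cis_eq_iff: "cis x = cis y \<longleftrightarrow> (\<exists>n::int. x = y + 2 * pi * n)"
  using sin_cos_eq_iff[of x y] by (auto simp: complex_eq_iff)

lemma open_segment_midpoint: "a \<noteq> b \<Longrightarrow> midpoint a b \<in> open_segment a b"
  by simp

lemma midpoint_offset: "midpoint a b + w - a = (1/2) *\<^sub>R (b - a) + (w :: complex)"
  by (simp add: midpoint_def complex_eq_iff field_simps)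

text \<open>Extracts from a local property one point displaced from \<open>x\<close> in a prescribed
  direction; this is how an edge is left towards one of its sides.\<close>

lemma eventually_nhds_ray:
  fixes x w :: complex
  assumes "\<forall>\<^sub>F y in nhds x. P y"
  obtains r :: real where "0 < r" "P (x + r *\<^sub>R w)"
proof -
  have "((\<lambda>r. x + r *\<^sub>R w) \<longlongrightarrow> x + 0 *\<^sub>R w) (at_right 0)" by (intro tendsto_intros)
  then have "filterlim (\<lambda>r. x + r *\<^sub>R w) (nhds x) (at_right 0)" by simp
  then have "\<forall>\<^sub>F r in at_right 0. P (x + r *\<^sub>R w)"
    using eventually_compose_filterlim[OF assms] by blast
  moreover have "\<forall>\<^sub>F r::real in at_right 0. 0 < r" by (rule eventually_at_right_less)
  ultimately have "\<forall>\<^sub>F r in at_right 0. 0 < r \<and> P (x + r *\<^sub>R w)" by eventually_elim simp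
  then have "\<exists>r. 0 < r \<and> P (x + r *\<^sub>R w)"
    by (intro eventually_happens'[OF trivial_limit_at_right_real])
  then show ?thesis using that by blast
qed

section \<open>Angles and sectors\<close>

lemma cis_inj:
  assumes "cis x = cis y" "\<bar>x - y\<bar> < 2 * pi"
  shows "x = y"
proof -
  obtain n :: int where n: "x = y + 2 * pi * n" using assms(1) unfolding cis_eq_iff by blast
  then have "2 * pi * \<bar>real_of_int n\<bar> < 2 * pi * 1" using assms(2) by (simp add: abs_mult)
  then have "\<bar>real_of_int n\<bar> < 1" by (subst (asm) mult_less_cancel_left_pos) simp_all
  then have "n = 0" by linarith
  then show ?thesis using n by simp
qed

lemma cross_eq_Im: "cross x y = Im (cnj x * y)" and inner_eq_Re: "x \<bullet> y = Re (cnj x * y)"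
  by (simp_all add: cross_def inner_complex_def)

text \<open>A positive determinant means that \<open>y / x\<close> has positive imaginary part, so
  its argument lies strictly between 0 and \<pi>.\<close>

lemma cis_multiple:
  fixes x y :: complex
  assumes "0 < cross x y"
  obtains k \<phi> where "0 < k" "0 < \<phi>" "\<phi> < pi" "y = of_real k * cis \<phi> * x"
proof -
  have x: "x \<noteq> 0" using assms by (auto simp: cross_def)
  have "Im (y / x) = cross x y / (cmod x)\<^sup>2"
    by (simp add: cross_def Im_divide cmod_power2)
  then have "0 < Im (y / x)" using assms x by simp
  then have "0 < Arg (y / x)" "Arg (y / x) < pi" using Arg_lt_pi by blast+
  moreover have "0 < cmod (y / x)" using \<open>0 < Im (y / x)\<close> by (subst zero_less_norm_iff) auto
  moreover have "y = of_real (cmod (y / x)) * cis (Arg (y / x)) * x"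
  proof -
    have "y / x = of_real (cmod (y / x)) * cis (Arg (y / x))"
      using rcis_cmod_Arg[of "y / x"] by (simp add: rcis_def)
    then show ?thesis using x by (metis nonzero_divide_eq_eq)
  qed
  ultimately show ?thesis using that by blast
qed

lemma euclidean_angle_commute: "euclidean_angle A C B = euclidean_angle B C A"
  by (simp add: euclidean_angle_def inner_commute mult.commute)

lemma euclidean_angle_rotation:
  assumes "A \<noteq> C" "0 < k" "0 < \<phi>" "\<phi> < pi" and B: "B - C = of_real k * cis \<phi> * (A - C)"
  shows "euclidean_angle A C B = \<phi>"
proof -
  let ?x = "A - C"
  have "?x \<bullet> (B - C) = k * cos \<phi> * (cmod ?x)\<^sup>2"
    unfolding B inner_eq_Re cmod_power2 by (simp add: algebra_simps power2_eq_square)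
  moreover have "norm (B - C) = k * cmod ?x" unfolding B using assms(2) by (simp add: norm_mult)
  ultimately have "(?x \<bullet> (B - C)) / (norm ?x * norm (B - C)) = cos \<phi>"
    using assms(1,2) by (simp add: power2_eq_square)
  then show ?thesis unfolding euclidean_angle_def using assms(3,4) arccos_cos by simp
qed

lemma euclidean_angle_pos_less_pi:
  assumes "cross (A - C) (B - C) \<noteq> 0"
  shows "0 < euclidean_angle A C B" "euclidean_angle A C B < pi"
proof -
  have *: "0 < euclidean_angle A C B \<and> euclidean_angle A C B < pi" if pos: "0 < cross (A - C) (B - C)" for A B
  proof -
    obtain k \<phi> where "0 < k" "0 < \<phi>" "\<phi> < pi" "B - C = of_real k * cis \<phi> * (A - C)"
      using pos by (rule cis_multiple)
    moreover have "A \<noteq> C" using pos by (auto simp: cross_simps)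
    ultimately show ?thesis using euclidean_angle_rotation by metis
  qed
  have "0 < cross (A - C) (B - C) \<or> 0 < cross (B - C) (A - C)"
    using assms cross_anticommute[of "A - C" "B - C"] by linarith
  then show "0 < euclidean_angle A C B" "euclidean_angle A C B < pi"
    using *[of A B] *[of B A] euclidean_angle_commute[of A C B] by auto
qed

text \<open>At each corner one side is a rotated multiple of the other. Multiplying the three
  relations, every side vector occurs once with reversed sign, so the product of the factors is -1.
  The angles thus add up to \<pi> modulo 2 \<pi>, and as each lies between 0 and \<pi> the sum is
  \<pi>.\<close>

lemma euclidean_angle_sum_positive:
  assumes "0 < cross (b - a) (c - a)"
  shows "euclidean_angle b a c + euclidean_angle c b a + euclidean_angle a c b = pi"
proof -
  have pos: "0 < cross (c - b) (a - b)" "0 < cross (a - c) (b - c)"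
    using assms by (simp_all add: cross_def algebra_simps)
  obtain k1 \<alpha> where 1: "0 < k1" "0 < \<alpha>" "\<alpha> < pi" "c - a = of_real k1 * cis \<alpha> * (b - a)"
    using assms by (rule cis_multiple)
  obtain k2 \<beta> where 2: "0 < k2" "0 < \<beta>" "\<beta> < pi" "a - b = of_real k2 * cis \<beta> * (c - b)"
    using pos(1) by (rule cis_multiple)
  obtain k3 \<gamma> where 3: "0 < k3" "0 < \<gamma>" "\<gamma> < pi" "b - c = of_real k3 * cis \<gamma> * (a - c)"
    using pos(2) by (rule cis_multiple)
  have ne: "b \<noteq> a" "c \<noteq> b" "a \<noteq> c" using assms pos by (auto simp: cross_simps(1-3))
  have "- ((b - a) * (c - b) * (a - c)) = (c - a) * (a - b) * (b - c)" by (simp add: algebra_simps)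
  also have "\<dots> = of_real (k1 * k2 * k3) * cis (\<alpha> + \<beta> + \<gamma>) * ((b - a) * (c - b) * (a - c))"
    by (subst 1(4), subst 2(4), subst 3(4)) (simp add: cis_mult[symmetric] mult_ac)
  finally have "(of_real (k1 * k2 * k3) * cis (\<alpha> + \<beta> + \<gamma>) + 1) * ((b - a) * (c - b) * (a - c)) = 0"
    by (simp add: algebra_simps)
  then have prod: "of_real (k1 * k2 * k3) * cis (\<alpha> + \<beta> + \<gamma>) = -1"
    using ne by (simp add: eq_neg_iff_add_eq_0)
  then have "cmod (of_real (k1 * k2 * k3) * cis (\<alpha> + \<beta> + \<gamma>)) = 1" by simp
  then have "k1 * k2 * k3 = 1" using 1(1) 2(1) 3(1) by (simp add: norm_mult abs_mult)
  then have "cis (\<alpha> + \<beta> + \<gamma>) = cis pi" using prod by simp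
  then have "\<alpha> + \<beta> + \<gamma> = pi" using 1 2 3 by (intro cis_inj) auto
  then show ?thesis
    using euclidean_angle_rotation[of b a k1 \<alpha> c] euclidean_angle_rotation[of c b k2 \<beta> a]
      euclidean_angle_rotation[of a c k3 \<gamma> b] 1 2 3 ne by simp
qed

lemma euclidean_angle_sum:
  assumes "cross (b - a) (c - a) \<noteq> 0"
  shows "euclidean_angle b a c + euclidean_angle a b c + euclidean_angle a c b = pi"
proof (cases "0 < cross (b - a) (c - a)")
  case True
  then show ?thesis using euclidean_angle_sum_positive euclidean_angle_commute by metis
next
  case False
  then have "0 < cross (c - a) (b - a)" using assms cross_anticommute[of "b - a" "c - a"] by linarith
  from euclidean_angle_sum_positive[OF this] show ?thesis
    using euclidean_angle_commute[of c a b] euclidean_angle_commute[of b c a] by linarith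
qed

text \<open>The directions with both coordinates positive in the basis \<open>x\<close>,
  \<open>y\<close>, that is, the open angle between \<open>x\<close> and \<open>y\<close>; dividing
  by the determinant makes it symmetric in them.\<close>

definition sector :: "complex \<Rightarrow> complex \<Rightarrow> real set" where
  "sector x y = {\<theta> \<in> {0..<2 * pi}. 0 < cross x (cis \<theta>) / cross x y \<and> 0 < cross (cis \<theta>) y / cross x y}"

lemma sector_commute: "sector x y = sector y x"
  unfolding sector_def using cross_anticommute[of x] cross_anticommute[of y x] cross_anticommute[of _ y]
  by auto

lemma sin_wedge:
  assumes "0 < \<phi>" "\<phi> < pi" "0 \<le> x" "x < 2 * pi"
  shows "0 < sin x \<and> 0 < sin (\<phi> - x) \<longleftrightarrow> 0 < x \<and> x < \<phi>"
proof (cases "x < pi")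
  case True
  show ?thesis
  proof (cases "x < \<phi>")
    case True
    then show ?thesis using assms sin_gt_zero[of x] sin_gt_zero[of "\<phi> - x"] by (cases "x = 0") auto
  next
    case False
    then have "0 \<le> sin (x - \<phi>)" using True assms by (intro sin_ge_zero) auto
    then show ?thesis using False sin_minus[of "x - \<phi>"] by simp
  qed
next
  case False
  then have "sin x \<le> 0" using assms sin_ge_zero[of "x - pi"] by simp
  then show ?thesis using False assms by auto
qed

text \<open>The sector starts at angle \<alpha> and has width \<phi>. If it runs past 2 \<pi>, it
  splits into an interval at each end of the fundamental range, of the same total length.\<close>

lemma measure_sector_aux:
  assumes \<alpha>: "0 \<le> \<alpha>" "\<alpha> < 2 * pi" and \<phi>: "0 < \<phi>" "\<phi> < pi"
    and S: "S = {\<theta> \<in> {0..<2 * pi}. 0 < sin (\<theta> - \<alpha>) \<and> 0 < sin (\<phi> - (\<theta> - \<alpha>))}"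
  shows "S \<in> lmeasurable" "measure lebesgue S = \<phi>"
proof -
  have mem: "\<theta> \<in> S \<longleftrightarrow> \<alpha> < \<theta> \<and> \<theta> < \<alpha> + \<phi> \<or> \<theta> < \<alpha> + \<phi> - 2 * pi" if \<theta>: "0 \<le> \<theta>" "\<theta> < 2 * pi" for \<theta>
  proof (cases "\<alpha> \<le> \<theta>")
    case True
    then show ?thesis using sin_wedge[OF \<phi>, of "\<theta> - \<alpha>"] \<theta> \<alpha> \<phi> unfolding S by auto
  next
    case False
    have "sin (\<theta> - \<alpha> + 2 * pi) = sin (\<theta> - \<alpha>)" "sin (\<phi> - (\<theta> - \<alpha> + 2 * pi)) = sin (\<phi> - (\<theta> - \<alpha>))"
      using sin_periodic[of "\<theta> - \<alpha>"] sin_periodic[of "\<phi> - (\<theta> - \<alpha>) - 2 * pi"] by (simp_all add: algebra_simps)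
    then show ?thesis using sin_wedge[OF \<phi>, of "\<theta> - \<alpha> + 2 * pi"] False \<theta> \<alpha> \<phi> unfolding S by auto
  qed
  have sub: "S \<subseteq> {0..<2 * pi}" unfolding S by blast
  have lm: "{a<..<b} \<in> lmeasurable" "{c..<d} \<in> lmeasurable" for a b c d :: real
    by (intro bounded_set_imp_lmeasurable; simp)+
  have "S \<in> lmeasurable \<and> measure lebesgue S = \<phi>"
  proof (cases "\<alpha> + \<phi> \<le> 2 * pi")
    case True
    have "S = {\<alpha><..<\<alpha> + \<phi>}"
    proof (rule set_eqI)
      fix \<theta> show "\<theta> \<in> S \<longleftrightarrow> \<theta> \<in> {\<alpha><..<\<alpha> + \<phi>}"
        using mem[of \<theta>] sub True \<alpha> by (cases "0 \<le> \<theta> \<and> \<theta> < 2 * pi") auto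
    qed
    then show ?thesis using \<phi> lm(1) by simp
  next
    case False
    have eq: "S = {\<alpha><..<2 * pi} \<union> {0..<\<alpha> + \<phi> - 2 * pi}"
    proof (rule set_eqI)
      fix \<theta> show "\<theta> \<in> S \<longleftrightarrow> \<theta> \<in> {\<alpha><..<2 * pi} \<union> {0..<\<alpha> + \<phi> - 2 * pi}"
        using mem[of \<theta>] sub False \<alpha> \<phi> by (cases "0 \<le> \<theta> \<and> \<theta> < 2 * pi") auto
    qed
    have "{\<alpha><..<2 * pi} \<inter> {0..<\<alpha> + \<phi> - 2 * pi} = {}" using \<phi> by auto
    then show ?thesis
      unfolding eq using measure_Un3[OF lm, of \<alpha> "2 * pi" 0 "\<alpha> + \<phi> - 2 * pi"] fmeasurable.Un[OF lm, of \<alpha> "2 * pi" 0 "\<alpha> + \<phi> - 2 * pi"] False \<alpha> by simp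
  qed
  then show "S \<in> lmeasurable" "measure lebesgue S = \<phi>" by blast+
qed

lemma sector_measure:
  assumes "cross (a - v) (b - v) \<noteq> 0"
  shows "sector (a - v) (b - v) \<in> lmeasurable"
    "measure lebesgue (sector (a - v) (b - v)) = euclidean_angle a v b"
proof -
  have *: "sector (a - v) (b - v) \<in> lmeasurable \<and>
      measure lebesgue (sector (a - v) (b - v)) = euclidean_angle a v b"
    if pos: "0 < cross (a - v) (b - v)" for a b
  proof -
    let ?x = "a - v"
    obtain k \<phi> where \<phi>: "0 < k" "0 < \<phi>" "\<phi> < pi" "b - v = of_real k * cis \<phi> * ?x"
      using pos by (rule cis_multiple)
    have x: "?x \<noteq> 0" using pos by (auto simp: cross_simps)
    define \<alpha> where "\<alpha> = Arg2pi ?x"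
    have \<alpha>: "0 \<le> \<alpha>" "\<alpha> < 2 * pi" "?x = of_real (cmod ?x) * cis \<alpha>"
      using Arg2pi[of ?x] unfolding \<alpha>_def is_Arg_def cis_conv_exp by blast+
    have 1: "cross ?x (cis \<theta>) = cmod ?x * sin (\<theta> - \<alpha>)" for \<theta>
      by (subst \<alpha>(3)) (simp add: cross_def sin_diff algebra_simps)
    have 2: "cross (cis \<theta>) (b - v) = k * cmod ?x * sin (\<phi> - (\<theta> - \<alpha>))" for \<theta>
    proof -
      have "b - v = of_real (k * cmod ?x) * cis (\<phi> + \<alpha>)"
        unfolding \<phi>(4) by (subst \<alpha>(3)) (simp add: cis_mult[symmetric])
      moreover have "\<phi> - (\<theta> - \<alpha>) = (\<phi> + \<alpha>) - \<theta>" by simp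
      ultimately show ?thesis by (simp add: cross_def sin_diff algebra_simps del: of_real_mult)
    qed
    have iff: "0 < c * s / cross ?x (b - v) \<longleftrightarrow> 0 < s" if "0 < c" for c s
      using that pos by (simp add: zero_less_divide_iff zero_less_mult_iff)
    have "0 < cmod ?x" "0 < k * cmod ?x" using x \<phi>(1) by simp_all
    note iffs = this[THEN iff]
    have "sector ?x (b - v) = {\<theta> \<in> {0..<2 * pi}. 0 < sin (\<theta> - \<alpha>) \<and> 0 < sin (\<phi> - (\<theta> - \<alpha>))}"
      unfolding sector_def 1 2 iffs ..
    then have "sector ?x (b - v) \<in> lmeasurable \<and> measure lebesgue (sector ?x (b - v)) = \<phi>"
      using measure_sector_aux[OF \<alpha>(1,2) \<phi>(2,3)] by blast
    moreover have "euclidean_angle a v b = \<phi>"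
      using euclidean_angle_rotation[OF _ \<phi>(1-3) \<phi>(4)] x by simp
    ultimately show ?thesis by simp
  qed
  have "0 < cross (a - v) (b - v) \<or> 0 < cross (b - v) (a - v)"
    using assms cross_anticommute[of "a - v" "b - v"] by linarith
  then show "sector (a - v) (b - v) \<in> lmeasurable"
    "measure lebesgue (sector (a - v) (b - v)) = euclidean_angle a v b"
    using *[of a b] *[of b a] euclidean_angle_commute[of a v b] sector_commute[of "a - v" "b - v"] by auto
qed

lemma sector_interior_triangle:
  assumes D: "cross (a - v) (b - v) \<noteq> 0" and \<theta>: "\<theta> \<in> sector (a - v) (b - v)"
  shows "\<forall>\<^sub>F r in at_right 0. v + of_real r * cis \<theta> \<in> interior (convex hull {v, a, b})"
proof -
  define \<beta> where "\<beta> = cross (cis \<theta>) (b - v) / cross (a - v) (b - v)"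
  define \<gamma> where "\<gamma> = cross (a - v) (cis \<theta>) / cross (a - v) (b - v)"
  have pos: "0 < \<beta>" "0 < \<gamma>" using \<theta> unfolding sector_def \<beta>_def \<gamma>_def by auto
  \<comment> \<open>\<beta> and \<gamma> are the speeds of the two barycentric coordinates along the
    ray, so it stays on the near side of the opposite edge until \<open>r\<close> reaches 1 /
    (\<beta> + \<gamma>).\<close>
  have "v + of_real r * cis \<theta> \<in> interior (convex hull {v, a, b})" if r: "0 < r" "r < 1 / (\<beta> + \<gamma>)" for r
  proof (rule mem_interior_triangle[OF D])
    have diff: "v + of_real r * cis \<theta> - v = r *\<^sub>R cis \<theta>" by (simp add: scaleR_conv_of_real)
    have eqs: "cross (v + of_real r * cis \<theta> - v) (b - v) / cross (a - v) (b - v) = r * \<beta>"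
      "cross (a - v) (v + of_real r * cis \<theta> - v) / cross (a - v) (b - v) = r * \<gamma>"
      unfolding diff \<beta>_def \<gamma>_def by (simp_all add: cross_simps(8,9))
    show "0 < cross (v + of_real r * cis \<theta> - v) (b - v) / cross (a - v) (b - v)"
      "0 < cross (a - v) (v + of_real r * cis \<theta> - v) / cross (a - v) (b - v)"
      unfolding eqs using r pos by simp_all
    have "r * (\<beta> + \<gamma>) < 1" using r pos by (simp add: pos_less_divide_eq)
    then show "cross (v + of_real r * cis \<theta> - v) (b - v) / cross (a - v) (b - v) +
      cross (a - v) (v + of_real r * cis \<theta> - v) / cross (a - v) (b - v) < 1"
      unfolding eqs by (simp add: algebra_simps)
  qed
  moreover have "0 < 1 / (\<beta> + \<gamma>)" using pos by simp
  ultimately show ?thesis unfolding eventually_at_right_field by blast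
qed

text \<open>The converse of \<open>sector_interior_triangle\<close>, up to directions along the two
  sides at \<open>v\<close>, where a coordinate may vanish.\<close>

lemma triangle_direction_sector:
  assumes D: "cross (a - v) (b - v) \<noteq> 0" and \<theta>: "\<theta> \<in> {0..<2 * pi}" and r: "0 < r"
    and mem: "v + of_real r * cis \<theta> \<in> convex hull {v, a, b}"
  shows "\<theta> \<in> sector (a - v) (b - v) \<or> cross (a - v) (cis \<theta>) = 0 \<or> cross (b - v) (cis \<theta>) = 0"
proof -
  have diff: "v + of_real r * cis \<theta> - v = r *\<^sub>R cis \<theta>" by (simp add: scaleR_conv_of_real)
  have "0 \<le> r * (cross (cis \<theta>) (b - v) / cross (a - v) (b - v))"
    "0 \<le> r * (cross (a - v) (cis \<theta>) / cross (a - v) (b - v))"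
    using mem unfolding mem_triangle_iff[OF D] diff cross_simps(8,9) by simp_all
  then have "0 \<le> cross (cis \<theta>) (b - v) / cross (a - v) (b - v)"
    "0 \<le> cross (a - v) (cis \<theta>) / cross (a - v) (b - v)"
    using r by (simp_all only: zero_le_mult_iff) auto
  then show ?thesis
    using \<theta> D cross_anticommute[of "cis \<theta>" "b - v"] unfolding sector_def by (auto simp: less_le)
qed

text \<open>For a parallel direction, \<open>cnj w * cis \<theta>\<close> is real of modulus |w|,
  which leaves only \<open>sgn w\<close> and its negative. Hence the directions along edges are
  negligible in the angular measure.\<close>

lemma finite_parallel_directions:
  assumes "w \<noteq> 0"
  shows "finite {\<theta> \<in> {0..<2 * pi}. cross w (cis \<theta>) = 0}"
proof (rule finite_imageD)
  have "cis \<theta> \<in> {sgn w, - sgn w}" if 0: "cross w (cis \<theta>) = 0" for \<theta>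
  proof -
    have "Im (cnj w * cis \<theta>) = 0" using 0 unfolding cross_eq_Im .
    then have re: "cnj w * cis \<theta> = of_real (Re (cnj w * cis \<theta>))" by (simp add: complex_eq_iff)
    then have "\<bar>Re (cnj w * cis \<theta>)\<bar> = cmod w"
      by (metis complex_mod_cnj norm_cis norm_mult mult.right_neutral norm_of_real)
    then have "cnj w * cis \<theta> = of_real (cmod w) \<or> cnj w * cis \<theta> = - of_real (cmod w)"
      using re by (metis abs_eq_iff' abs_of_nonneg norm_ge_zero of_real_minus abs_real_def minus_minus)
    moreover define N where "N = complex_of_real (cmod w)"
    moreover have "w * (cnj w * cis \<theta>) = N * (N * cis \<theta>)"
    proof -
      have "w * cnj w = N * N"
        unfolding N_def using complex_norm_square[of w] by (simp add: power2_eq_square)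
      then show ?thesis by (metis mult.assoc)
    qed
    ultimately have "N * (N * cis \<theta>) = N * w \<or> N * (N * cis \<theta>) = N * (- w)"
      by (metis mult.commute mult_minus_right)
    moreover have N: "N \<noteq> 0" using assms unfolding N_def by simp
    ultimately have "N * cis \<theta> = w \<or> N * cis \<theta> = - w" using mult_left_cancel[OF N] by metis
    then have "cis \<theta> = w / N \<or> cis \<theta> = - w / N" using N by (metis nonzero_mult_div_cancel_left)
    then show ?thesis unfolding N_def by (simp add: sgn_eq)
  qed
  then have "cis ` {\<theta> \<in> {0..<2 * pi}. cross w (cis \<theta>) = 0} \<subseteq> {sgn w, - sgn w}" by blast
  then show "finite (cis ` {\<theta> \<in> {0..<2 * pi}. cross w (cis \<theta>) = 0})" by (rule finite_subset) simp
  show "inj_on cis {\<theta> \<in> {0..<2 * pi}. cross w (cis \<theta>) = 0}"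
  proof (rule inj_onI)
    fix x y assume xy: "x \<in> {\<theta> \<in> {0..<2 * pi}. cross w (cis \<theta>) = 0}"
      "y \<in> {\<theta> \<in> {0..<2 * pi}. cross w (cis \<theta>) = 0}" "cis x = cis y"
    then show "x = y" by (intro cis_inj) auto
  qed
qed

text \<open>The description is unique because the only freedom, exchanging \<open>a\<close> and
  \<open>b\<close>, preserves the Euclidean angle.\<close>

definition triangle_angle :: "complex set \<Rightarrow> complex \<Rightarrow> real" where
  "triangle_angle t v = (THE \<alpha>. \<exists>a b. triangle_vertices t = {v, a, b} \<and> a \<noteq> v \<and> b \<noteq> v \<and> a \<noteq> b \<and>
     \<alpha> = euclidean_angle a v b)"

lemma triangle_angle_eq:
  assumes "triangle_vertices t = {v, a, b}" "a \<noteq> v" "b \<noteq> v" "a \<noteq> b"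
  shows "triangle_angle t v = euclidean_angle a v b"
  unfolding triangle_angle_def
proof (rule the_equality)
  show "\<exists>c d. triangle_vertices t = {v, c, d} \<and> c \<noteq> v \<and> d \<noteq> v \<and> c \<noteq> d \<and>
     euclidean_angle a v b = euclidean_angle c v d"
    using assms by blast
  fix \<alpha> assume "\<exists>c d. triangle_vertices t = {v, c, d} \<and> c \<noteq> v \<and> d \<noteq> v \<and> c \<noteq> d \<and> \<alpha> = euclidean_angle c v d"
  then obtain c d where cd: "triangle_vertices t = {v, c, d}" "c \<noteq> v" "d \<noteq> v" "c \<noteq> d" "\<alpha> = euclidean_angle c v d"
    by blast
  have "{c, d} = {v, c, d} - {v}" "{a, b} = {v, a, b} - {v}" using cd(2,3) assms(2,3) by auto
  then have "{c, d} = {a, b}" using assms(1) cd(1) by metis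
  then have "c = a \<and> d = b \<or> c = b \<and> d = a" by (auto simp: doubleton_eq_iff)
  then show "\<alpha> = euclidean_angle a v b" using cd(5) euclidean_angle_commute by metis
qed

section \<open>Triangulated polygons\<close>

lemma triangle_simplex:
  assumes "2 simplex t"
  shows "\<not> affine_dependent (triangle_vertices t)" "card (triangle_vertices t) = 3"
    "convex hull triangle_vertices t = t"
proof -
  obtain C where C: "\<not> affine_dependent C" "int (card C) = 2 + 1" "t = convex hull C"
    using assms unfolding simplex_def by blast
  have "triangle_vertices t = C"
    unfolding triangle_vertices_def C(3) using extreme_point_of_convex_hull_affine_independent[OF C(1)] by blast
  then show "\<not> affine_dependent (triangle_vertices t)" "card (triangle_vertices t) = 3"
    "convex hull triangle_vertices t = t" using C by simp_all
qed

locale triangulated_polygon =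
  fixes p :: "complex list" and T :: "complex set set"
  assumes simple: "simple_polygon p" and triangulates: "triangulates_polygon T p"
begin

abbreviation "Q \<equiv> polygon_boundary p \<union> polygon_interior p"
abbreviation "vt \<equiv> triangle_vertices"
abbreviation "W \<equiv> \<Union>t\<in>T. vt t"
abbreviation "PE \<equiv> polygon_edges p"

lemmas Jordan = polygon_Jordan[OF simple]

lemma finite_T: "finite T" and Union_T: "\<Union>T = Q"
  and polygon_edges_subset: "PE \<subseteq> triangulation_edges T"
  using triangulates unfolding triangulates_polygon_def triangulation_def by blast+

lemma vt:
  assumes "t \<in> T"
  shows "\<not> affine_dependent (vt t)" "card (vt t) = 3" "convex hull (vt t) = t"
  using triangle_simplex[of t] assms triangulates unfolding triangulates_polygon_def by blast+

lemma finite_vt: "t \<in> T \<Longrightarrow> finite (vt t)"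
  using vt(2)[of t] card.infinite by fastforce

lemma vt_subset: "t \<in> T \<Longrightarrow> vt t \<subseteq> t"
  using vt(3) hull_subset by metis

lemma vt_inj: "t \<in> T \<Longrightarrow> s \<in> T \<Longrightarrow> vt t = vt s \<longleftrightarrow> t = s"
  using vt(3) by metis

lemma finite_W: "finite W"
  using finite_T finite_vt by blast

lemma compact_triangle: "t \<in> T \<Longrightarrow> compact t"
  using vt(3) finite_vt finite_imp_compact_convex_hull by metis

lemma hull_face: "t \<in> T \<Longrightarrow> c \<subseteq> vt t \<Longrightarrow> (convex hull c) face_of t"
  using face_of_convex_hull_affine_independent[OF vt(1), of t "convex hull c"] vt(3) by auto

lemma hull_subset_triangle: "t \<in> T \<Longrightarrow> c \<subseteq> vt t \<Longrightarrow> convex hull c \<subseteq> t"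
  using hull_face face_of_imp_subset by blast

lemma hull_Int_vertices:
  assumes "t \<in> T" "c \<subseteq> vt t"
  shows "convex hull c \<inter> vt t = c"
proof
  show "c \<subseteq> convex hull c \<inter> vt t" using assms(2) hull_subset[of c convex] by blast
  have "\<not> affine_dependent c" using assms affine_dependent_subset vt(1) by blast
  moreover have "x extreme_point_of convex hull c" if "x \<in> convex hull c \<inter> vt t" for x
    using that extreme_point_of_face[OF hull_face[OF assms]] unfolding triangle_vertices_def by simp
  ultimately show "convex hull c \<inter> vt t \<subseteq> c"
    using extreme_point_of_convex_hull_affine_independent[of c] by blast
qed

text \<open>The intersection is a face of both triangles, hence the hull of some vertices of each.
  Both vertex sets are its set of extreme points, so they coincide.\<close>

lemma Int_triangles:
  assumes t: "t \<in> T" and s: "s \<in> T"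
  shows "t \<inter> s = convex hull (vt t \<inter> vt s)"
proof -
  have "t \<inter> s face_of t" "s \<inter> t face_of s"
    using t s triangulates unfolding triangulates_polygon_def triangulation_def by blast+
  then obtain c where c: "c \<subseteq> vt t" "t \<inter> s = convex hull c"
    and "\<exists>d\<subseteq>vt s. t \<inter> s = convex hull d"
    using face_of_convex_hull_affine_independent[OF vt(1)[OF t]]
      face_of_convex_hull_affine_independent[OF vt(1)[OF s]]
    by (metis Int_commute s t vt(3))
  then obtain d where d: "d \<subseteq> vt s" "t \<inter> s = convex hull d" by blast
  have "c = vt t \<inter> vt s"
  proof
    have "\<not> affine_dependent c" "\<not> affine_dependent d"
      using affine_dependent_subset vt(1) t s c d by blast+
    note ext = this[THEN extreme_point_of_convex_hull_affine_independent]
    have "c = {x. x extreme_point_of convex hull c}" using ext by simp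
    also have "\<dots> = {x. x extreme_point_of convex hull d}" using c d by metis
    also have "\<dots> = d" using ext by simp
    finally show "c \<subseteq> vt t \<inter> vt s" using c d by blast
    show "vt t \<inter> vt s \<subseteq> c"
      using vt_subset[OF t] vt_subset[OF s] hull_Int_vertices[OF t c(1)] c(2) by blast
  qed
  with c show ?thesis by simp
qed

lemma vertex_in_triangle:
  assumes "t \<in> T" "s \<in> T" "v \<in> vt t" "v \<in> s"
  shows "v \<in> vt s"
proof -
  have "v \<in> convex hull (vt t \<inter> vt s) \<inter> vt t"
    using assms Int_triangles[OF assms(1,2)] vt_subset[OF assms(1)] by blast
  then show ?thesis using hull_Int_vertices[OF assms(1), of "vt t \<inter> vt s"] by blast
qed

text \<open>A face containing an inner point of a segment of the convex set contains the ends of the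
  segment. This is applied in \<open>t\<close> to the common face of the triangles, then in
  \<open>s\<close> to the hull of \<open>c\<close>.\<close>

lemma edge_through_point:
  assumes "t \<in> T" "s \<in> T" "{a, b} \<subseteq> vt t" "x \<in> open_segment a b" "c \<subseteq> vt s" "x \<in> convex hull c"
  shows "{a, b} \<subseteq> c"
proof -
  have "x \<in> t"
    using open_closed_segment[OF assms(4)] hull_subset_triangle[OF assms(1,3)]
    unfolding segment_convex_hull by blast
  moreover have "convex hull c \<subseteq> s" by (rule hull_subset_triangle[OF assms(2,5)])
  ultimately have x: "x \<in> convex hull (vt t \<inter> vt s)" using Int_triangles[OF assms(1,2)] assms(6) by blast
  have ab: "a \<in> t" "b \<in> t" using assms(3) vt_subset[OF assms(1)] by blast+
  have "convex hull (vt t \<inter> vt s) face_of t" by (rule hull_face[OF assms(1)]) blast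
  then have "{a, b} \<subseteq> convex hull (vt t \<inter> vt s)"
    using x ab assms(4) unfolding face_of_def by blast
  then have "{a, b} \<subseteq> vt s" using hull_Int_vertices[OF assms(1), of "vt t \<inter> vt s"] assms(3) by blast
  moreover have "(convex hull c) face_of s" by (rule hull_face[OF assms(2,5)])
  ultimately have "{a, b} \<subseteq> convex hull c"
    using assms(4,6) vt_subset[OF assms(2)] unfolding face_of_def by blast
  then show ?thesis using \<open>{a, b} \<subseteq> vt s\<close> hull_Int_vertices[OF assms(2,5)] by blast
qed

text \<open>The triangles that miss \<open>x\<close> are finitely many closed sets, so a
  neighbourhood of \<open>x\<close> avoids them all.\<close>

lemma eventually_triangles_near: "\<forall>\<^sub>F y in nhds x. \<forall>t\<in>T. y \<in> t \<longrightarrow> x \<in> t"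
proof (rule eventually_ball_finite[OF finite_T], rule ballI)
  fix t assume t: "t \<in> T"
  show "\<forall>\<^sub>F y in nhds x. y \<in> t \<longrightarrow> x \<in> t"
  proof (cases "x \<in> t")
    case False
    moreover have "open (- t)" using compact_imp_closed[OF compact_triangle[OF t]] by blast
    ultimately have "\<forall>\<^sub>F y in nhds x. y \<in> - t" by (intro eventually_nhds_in_open) auto
    then show ?thesis by (rule eventually_mono) simp
  qed simp
qed

section \<open>Triangles along a common edge\<close>

lemma triangle_third:
  assumes "t \<in> T" "{a, b} \<subseteq> vt t" "a \<noteq> b"
  obtains c where "vt t = {a, b, c}" "t = convex hull {a, b, c}" "cross (b - a) (c - a) \<noteq> 0" "c \<noteq> a" "c \<noteq> b"
proof -
  have "card (vt t - {a, b}) = 1" using assms vt(2)[OF assms(1)] by (subst card_Diff_subset) auto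
  then obtain c where c: "vt t - {a, b} = {c}" by (auto simp: card_1_singleton_iff)
  then have abc: "vt t = {a, b, c}" "c \<noteq> a" "c \<noteq> b" using assms(2) by auto
  then have "cross (b - a) (c - a) \<noteq> 0"
    using cross_nonzero_of_affine_independent[of a b c] vt(1)[OF assms(1)] assms(3) by metis
  then show ?thesis using that abc vt(3)[OF assms(1)] by metis
qed

text \<open>Two half discs at the midpoint on the same side share points off the line through
  \<open>a\<close> and \<open>b\<close>, whereas two distinct triangles with this common edge meet
  only in it.\<close>

lemma same_side:
  assumes t: "t \<in> T" "vt t = {a, b, c}" and s: "s \<in> T" "vt s = {a, b, d}" and ab: "a \<noteq> b"
    and side: "0 < cross (b - a) (c - a) / cross (b - a) (d - a)"
  shows "t = s"
proof (rule ccontr)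
  assume ne: "t \<noteq> s"
  have D: "cross (b - a) (c - a) \<noteq> 0" "cross (b - a) (d - a) \<noteq> 0" using side by auto
  have "c \<noteq> d" using ne vt_inj[OF t(1) s(1)] t s by auto
  moreover have "c \<noteq> a" "c \<noteq> b" "d \<noteq> a" "d \<noteq> b" using D by (auto simp: cross_simps(1,3))
  ultimately have "vt t \<inter> vt s = {a, b}" using t s by auto
  then have seg: "t \<inter> s = convex hull {a, b}" using Int_triangles[OF t(1) s(1)] by simp
  let ?x = "midpoint a b"
  have x: "?x \<in> open_segment a b" using ab by (rule open_segment_midpoint)
  have ts: "t = convex hull {a, b, c}" "s = convex hull {a, b, d}" using t s vt(3) by metis+
  have "\<forall>\<^sub>F y in nhds ?x. (0 \<le> cross (b - a) (y - a) / cross (b - a) (c - a) \<longrightarrow> y \<in> t) \<and>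
     (0 \<le> cross (b - a) (y - a) / cross (b - a) (d - a) \<longrightarrow> y \<in> s)"
    unfolding ts by (intro eventually_conj triangle_half_disc D x)
  then obtain r where r: "0 < r" and y:
    "0 \<le> cross (b - a) (?x + r *\<^sub>R (c - a) - a) / cross (b - a) (c - a) \<longrightarrow> ?x + r *\<^sub>R (c - a) \<in> t"
    "0 \<le> cross (b - a) (?x + r *\<^sub>R (c - a) - a) / cross (b - a) (d - a) \<longrightarrow> ?x + r *\<^sub>R (c - a) \<in> s"
    by (rule eventually_nhds_ray[where w = "c - a"]) blast
  have xa: "?x + r *\<^sub>R (c - a) - a = (1/2) *\<^sub>R (b - a) + r *\<^sub>R (c - a)"
    by (rule midpoint_offset)
  have cr: "cross (b - a) (?x + r *\<^sub>R (c - a) - a) = r * cross (b - a) (c - a)"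
    unfolding xa cross_simps(5,9) cross_simps(3) by simp
  have "?x + r *\<^sub>R (c - a) \<in> t \<inter> s"
  proof -
    have "0 \<le> r * cross (b - a) (c - a) / cross (b - a) (d - a)"
      using r side by (metis less_imp_le mult_nonneg_nonneg times_divide_eq_right)
    then show ?thesis using y r D unfolding cr by auto
  qed
  then obtain u where "?x + r *\<^sub>R (c - a) = (1 - u) *\<^sub>R a + u *\<^sub>R b"
    unfolding seg segment_convex_hull[symmetric] by (auto simp: in_segment)
  then have "?x + r *\<^sub>R (c - a) - a = u *\<^sub>R (b - a)" by (simp add: algebra_simps)
  then have "r * cross (b - a) (c - a) = 0" using cr by (simp add: cross_simps(3,9))
  then show False using r D by simp
qed

text \<open>The half discs on the two sides together fill a neighbourhood of the point.\<close>

lemma opposite_sides_interior: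
  assumes t: "t \<in> T" "vt t = {a, b, c}" and s: "s \<in> T" "vt s = {a, b, d}"
    and x: "x \<in> open_segment a b"
    and side: "cross (b - a) (c - a) / cross (b - a) (d - a) < 0"
  shows "x \<in> interior (t \<union> s)"
proof -
  have D: "cross (b - a) (c - a) \<noteq> 0" "cross (b - a) (d - a) \<noteq> 0" using side by auto
  have ts: "t = convex hull {a, b, c}" "s = convex hull {a, b, d}" using t s vt(3) by metis+
  have "\<forall>\<^sub>F y in nhds x. (0 \<le> cross (b - a) (y - a) / cross (b - a) (c - a) \<longrightarrow> y \<in> t) \<and>
     (0 \<le> cross (b - a) (y - a) / cross (b - a) (d - a) \<longrightarrow> y \<in> s)"
    unfolding ts by (intro eventually_conj triangle_half_disc D x)
  then have "\<forall>\<^sub>F y in nhds x. y \<in> t \<union> s"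
  proof (rule eventually_mono)
    fix y
    have "0 \<le> cross (b - a) (y - a) / cross (b - a) (c - a) \<or>
       0 \<le> cross (b - a) (y - a) / cross (b - a) (d - a)"
      using side by (auto simp: divide_less_0_iff zero_le_divide_iff)
    then show "(0 \<le> cross (b - a) (y - a) / cross (b - a) (c - a) \<longrightarrow> y \<in> t) \<and>
     (0 \<le> cross (b - a) (y - a) / cross (b - a) (d - a) \<longrightarrow> y \<in> s) \<Longrightarrow> y \<in> t \<union> s" by blast
  qed
  then show ?thesis by (simp add: eventually_nhds interior_def) blast
qed

lemma sides_dichotomy:
  assumes "t \<in> T" "s \<in> T" "{a, b} \<subseteq> vt t" "{a, b} \<subseteq> vt s" "a \<noteq> b" "t \<noteq> s"
    "vt t = {a, b, c}" "vt s = {a, b, d}" "cross (b - a) (c - a) \<noteq> 0" "cross (b - a) (d - a) \<noteq> 0"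
  shows "cross (b - a) (c - a) / cross (b - a) (d - a) < 0"
  using same_side[OF assms(1,7,2,8,5)] assms by (metis divide_eq_0_iff linorder_neqE_linordered_idom)

lemma triangulation_edgeE:
  assumes "e \<in> triangulation_edges T"
  obtains a b t where "e = {a, b}" "a \<noteq> b" "t \<in> T" "{a, b} \<subseteq> vt t"
  using assms unfolding triangulation_edges_def by (auto simp: card_2_iff)

lemma interior_Q: "interior Q = polygon_interior p"
  using Jordan by blast

text \<open>A second triangle would have to lie on the other side of the edge. The midpoint would
  then be interior to the region, but it is on the polygon.\<close>

lemma card_triangles_polygon_edge:
  assumes e: "e \<in> PE"
  shows "card {t \<in> T. e \<subseteq> vt t} = 1"
proof -
  obtain a b t where ab: "e = {a, b}" "a \<noteq> b" and t: "t \<in> T" "{a, b} \<subseteq> vt t"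
    using e polygon_edges_subset by (blast elim: triangulation_edgeE)
  have x: "midpoint a b \<in> open_segment a b" using ab by simp
  have "midpoint a b \<in> polygon_boundary p"
    using e ab open_closed_segment[OF x]
    unfolding polygon_boundary_eq[OF simple] segment_convex_hull by blast
  then have nx: "midpoint a b \<notin> interior Q" using Jordan interior_Q by blast
  have "s = t" if s: "s \<in> T" "{a, b} \<subseteq> vt s" for s
  proof (rule ccontr)
    assume "s \<noteq> t"
    obtain c where c: "vt t = {a, b, c}" "cross (b - a) (c - a) \<noteq> 0"
      using triangle_third[OF t ab(2)] by metis
    obtain d where d: "vt s = {a, b, d}" "cross (b - a) (d - a) \<noteq> 0"
      using triangle_third[OF s ab(2)] by metis
    have "midpoint a b \<in> interior (s \<union> t)"
      using opposite_sides_interior[OF s(1) d(1) t(1) c(1) x]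
        sides_dichotomy[OF s(1) t(1) s(2) t(2) ab(2) \<open>s \<noteq> t\<close> d(1) c(1) d(2) c(2)] by blast
    moreover have "interior (s \<union> t) \<subseteq> interior Q"
      using s t Union_T by (intro interior_mono) blast
    ultimately show False using nx by blast
  qed
  then have "{t \<in> T. e \<subseteq> vt t} = {t}" using t ab(1) by blast
  then show ?thesis by simp
qed

text \<open>A polygon edge through an inner point of \<open>{a, b}\<close> would contain both
  \<open>a\<close> and \<open>b\<close> among its ends, and so would be
  \<open>{a, b}\<close>.\<close>

lemma inner_edge_interior:
  assumes e: "e \<in> triangulation_edges T" "e \<notin> PE" "e = {a, b}" and x: "x \<in> open_segment a b"
  shows "x \<in> polygon_interior p"
proof -
  obtain t where t: "t \<in> T" "{a, b} \<subseteq> vt t" using e unfolding triangulation_edges_def by blast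
  have "x \<notin> polygon_boundary p"
  proof
    assume "x \<in> polygon_boundary p"
    then obtain e' where e': "e' \<in> PE" "x \<in> convex hull e'" unfolding polygon_boundary_eq[OF simple] by blast
    then obtain s where s: "s \<in> T" "e' \<subseteq> vt s" "card e' = 2"
      using polygon_edges_subset unfolding triangulation_edges_def by blast
    have "{a, b} \<subseteq> e'" by (rule edge_through_point[OF t(1) s(1) t(2) x s(2) e'(2)])
    moreover have "card {a, b} = card e'" using e s unfolding triangulation_edges_def by auto
    ultimately have "{a, b} = e'" using s(3) card_subset_eq by (metis card.infinite zero_neq_numeral)
    then show False using e e' by blast
  qed
  moreover have "x \<in> Q"
    using t hull_subset_triangle[OF t] open_closed_segment[OF x] Union_T
    unfolding segment_convex_hull by blast
  ultimately show ?thesis by blast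
qed

text \<open>The midpoint is interior to the polygon, so a small step from it away from the known
  triangle lands in another one, which must contain the whole edge. A third triangle is impossible,
  since three cannot be pairwise on opposite sides.\<close>

lemma card_triangles_inner_edge:
  assumes e: "e \<in> triangulation_edges T" "e \<notin> PE"
  shows "card {t \<in> T. e \<subseteq> vt t} = 2"
proof -
  obtain a b t where ab: "e = {a, b}" "a \<noteq> b" and t: "t \<in> T" "{a, b} \<subseteq> vt t"
    using e by (blast elim: triangulation_edgeE)
  let ?x = "midpoint a b"
  have x: "?x \<in> open_segment a b" using ab by simp
  have xI: "?x \<in> polygon_interior p" by (rule inner_edge_interior[OF e ab(1) x])
  obtain c where c: "vt t = {a, b, c}" "cross (b - a) (c - a) \<noteq> 0" "c \<noteq> a" "c \<noteq> b"
    using triangle_third[OF t ab(2)] by metis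
  have "\<forall>\<^sub>F y in nhds ?x. y \<in> polygon_interior p \<and> (\<forall>t\<in>T. y \<in> t \<longrightarrow> ?x \<in> t)"
    using xI Jordan(2) by (intro eventually_conj eventually_triangles_near eventually_nhds_in_open)
  \<comment> \<open>As \<open>c - a\<close> points into \<open>t\<close>, the direction
    \<open>a - c\<close> leads to the opposite side. The step is so small that every triangle it
    reaches still contains the midpoint.\<close>
  then obtain r where r: "0 < r" and y: "?x + r *\<^sub>R (a - c) \<in> polygon_interior p"
    "\<forall>t\<in>T. ?x + r *\<^sub>R (a - c) \<in> t \<longrightarrow> ?x \<in> t"
    by (rule eventually_nhds_ray[where w = "a - c"]) blast
  obtain s where s: "s \<in> T" "?x + r *\<^sub>R (a - c) \<in> s" using y(1) Union_T by blast
  have xs: "?x \<in> convex hull (vt s)" using y s vt(3) by blast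
  have es: "{a, b} \<subseteq> vt s" using edge_through_point[OF t(1) s(1) t(2) x subset_refl xs] .
  obtain d where d: "vt s = {a, b, d}" "cross (b - a) (d - a) \<noteq> 0" "s = convex hull {a, b, d}"
    using triangle_third[OF s(1) es ab(2)] by metis
  have xa: "?x + r *\<^sub>R (a - c) - a = (1/2) *\<^sub>R (b - a) + (- r) *\<^sub>R (c - a)"
    unfolding midpoint_offset by (simp add: complex_eq_iff algebra_simps)
  have cr: "cross (b - a) (?x + r *\<^sub>R (a - c) - a) = - r * cross (b - a) (c - a)"
    unfolding xa cross_simps(5,9) cross_simps(3) by simp
  have side: "0 \<le> - r * cross (b - a) (c - a) / cross (b - a) (d - a)"
  proof -
    have "?x + r *\<^sub>R (a - c) \<in> convex hull {a, b, d}" using s(2) d(3) by simp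
    then show ?thesis unfolding mem_triangle_iff[OF d(2)] cr by blast
  qed
  have side': "cross (b - a) (c - a) / cross (b - a) (d - a) < 0"
  proof -
    have "r * (cross (b - a) (c - a) / cross (b - a) (d - a)) \<le> 0" using side by simp
    then have "cross (b - a) (c - a) / cross (b - a) (d - a) \<le> 0" using r by (simp only: mult_le_0_iff) auto
    moreover have "cross (b - a) (c - a) / cross (b - a) (d - a) \<noteq> 0" using c(2) d(2) by simp
    ultimately show ?thesis by linarith
  qed
  have opp: "t \<noteq> s" using c d side' by auto
  have "u = t \<or> u = s" if u: "u \<in> T" "{a, b} \<subseteq> vt u" for u
  proof (rule ccontr)
    assume ne: "\<not> (u = t \<or> u = s)"
    obtain f where f: "vt u = {a, b, f}" "cross (b - a) (f - a) \<noteq> 0"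
      using triangle_third[OF u ab(2)] by metis
    have "cross (b - a) (f - a) / cross (b - a) (c - a) < 0"
      by (rule sides_dichotomy[of u t]) (use u t ab ne f c in auto)
    moreover have "cross (b - a) (f - a) / cross (b - a) (d - a) < 0"
      by (rule sides_dichotomy[of u s]) (use u s es ab ne f d in auto)
    ultimately show False using side' by (auto simp: divide_less_0_iff)
  qed
  then have "{t \<in> T. e \<subseteq> vt t} = {t, s}" using t s es ab(1) by blast
  then show ?thesis using opp by simp
qed


section \<open>Connectedness through edges and vertices on the boundary\<close>

lemma interior_triangle_nonempty:
  assumes "t \<in> T"
  shows "interior t \<noteq> {}"
proof -
  obtain a b where ab: "{a, b} \<subseteq> vt t" "a \<noteq> b"
    using vt(2)[OF assms] by (auto simp: card_3_iff)
  obtain d where d: "t = convex hull {a, b, d}" "cross (b - a) (d - a) \<noteq> 0"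
    using triangle_third[OF assms ab] by metis
  let ?x = "a + ((1/3) *\<^sub>R (b - a) + (1/3) *\<^sub>R (d - a))"
  have "?x \<in> interior t"
    unfolding d(1) by (rule mem_interior_triangle[OF d(2)])
      (simp_all only: add_diff_cancel_left' cross_combination, use d(2) in simp_all)
  then show ?thesis by blast
qed

text \<open>Removing the finitely many vertices keeps the open polygon connected. Triangles without
  a common edge meet at most in a vertex, so the unions of \<open>X\<close> and of its complement
  would be closed sets splitting the punctured polygon.\<close>

lemma triangles_connected:
  assumes X: "X \<subseteq> T" "X \<noteq> {}"
    and closed: "\<And>t s. t \<in> X \<Longrightarrow> s \<in> T \<Longrightarrow> card (vt t \<inter> vt s) = 2 \<Longrightarrow> s \<in> X"
  shows "X = T"
proof (rule ccontr)
  assume "X \<noteq> T"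
  let ?U = "polygon_interior p - W"
  have conn: "connected ?U"
    by (intro connected_open_diff_countable) (use Jordan finite_W in \<open>simp_all add: countable_finite\<close>)
  have meets: "\<Union>Y \<inter> ?U \<noteq> {}" if Y: "Y \<subseteq> T" "Y \<noteq> {}" for Y
  proof -
    obtain t where t: "t \<in> Y" "t \<in> T" using Y by blast
    have "interior t - W \<noteq> {}"
    proof
      assume "interior t - W = {}"
      then have "finite (interior t)" using finite_W by (metis Diff_eq_empty_iff finite_subset)
      then show False using interior_triangle_nonempty[OF t(2)] open_interior[of t] finite_imp_not_open by blast
    qed
    moreover have "interior t \<subseteq> interior Q"
      using t Union_T by (intro interior_mono) blast
    then have "interior t \<subseteq> polygon_interior p" using interior_Q by simp
    ultimately show ?thesis using t interior_subset[of t] by blast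
  qed
  have cl: "closed (\<Union>Y)" if "Y \<subseteq> T" for Y
    using that finite_T compact_triangle by (intro closed_Union) (auto intro: finite_subset compact_imp_closed)
  have cover: "?U \<subseteq> \<Union>X \<union> \<Union>(T - X)"
  proof -
    have "\<Union>X \<union> \<Union>(T - X) = \<Union>T" using X(1) by blast
    then show ?thesis unfolding Union_T by blast
  qed
  have "\<Union>X \<inter> \<Union>(T - X) \<inter> ?U = {}"
  proof (rule ccontr)
    assume "\<Union>X \<inter> \<Union>(T - X) \<inter> ?U \<noteq> {}"
    then obtain x t s where x: "x \<in> t" "x \<in> s" "x \<notin> W" and ts: "t \<in> X" "s \<in> T" "s \<notin> X" by blast
    have t: "t \<in> T" using ts X by blast
    have xh: "x \<in> convex hull (vt t \<inter> vt s)" using Int_triangles[OF t ts(2)] x by blast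
    have fin: "finite (vt t)" "finite (vt s)" using finite_vt t ts by blast+
    have "card (vt t \<inter> vt s) \<noteq> 2" using closed ts by blast
    moreover have "card (vt t \<inter> vt s) \<noteq> 3"
    proof
      assume 3: "card (vt t \<inter> vt s) = 3"
      have "vt t \<inter> vt s = vt t" by (rule card_subset_eq) (use fin 3 vt(2)[OF t] in auto)
      moreover have "vt t \<inter> vt s = vt s" by (rule card_subset_eq) (use fin 3 vt(2)[OF ts(2)] in auto)
      ultimately show False using vt_inj[OF t ts(2)] ts by auto
    qed
    moreover have "card (vt t \<inter> vt s) \<le> 3" using card_mono[OF fin(1), of "vt t \<inter> vt s"] vt(2)[OF t] by simp
    ultimately have "card (vt t \<inter> vt s) = 0 \<or> card (vt t \<inter> vt s) = 1" by linarith
    then show False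
    proof
      assume "card (vt t \<inter> vt s) = 0"
      then have "vt t \<inter> vt s = {}" using fin by simp
      then show False using xh by simp
    next
      assume "card (vt t \<inter> vt s) = 1"
      then obtain w where w: "vt t \<inter> vt s = {w}" by (auto simp: card_1_singleton_iff)
      then have "x = w" using xh by simp
      then show False using w x t by blast
    qed
  qed
  then have "\<Union>X \<inter> ?U = {} \<or> \<Union>(T - X) \<inter> ?U = {}"
    using cover X(1) by (intro connected_closedD[OF conn] cl) auto
  then show False using meets[OF X] meets[of "T - X"] X(1) \<open>X \<noteq> T\<close> by blast
qed

text \<open>A polygon edge is an edge of a triangle of \<open>T\<close>, so a vertex of
  \<open>T\<close> lying on it is one of its ends.\<close>

lemma boundary_vertex_iff: "v \<in> W \<Longrightarrow> v \<in> polygon_boundary p \<longleftrightarrow> v \<in> set p"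
proof
  assume v: "v \<in> W" "v \<in> polygon_boundary p"
  obtain t where t: "t \<in> T" "v \<in> vt t" using v by blast
  obtain e s where e: "e \<in> PE" "v \<in> convex hull e" and s: "s \<in> T" "e \<subseteq> vt s"
    using v(2) polygon_edges_subset unfolding polygon_boundary_eq[OF simple] triangulation_edges_def by blast
  have "v \<in> s" using e(2) hull_subset_triangle[OF s] by blast
  then have "v \<in> vt s" using vertex_in_triangle[OF t(1) s(1) t(2)] by blast
  then have "v \<in> e" using hull_Int_vertices[OF s] e(2) by blast
  then show "v \<in> set p" using e Union_polygon_edges[OF simple] by blast
next
  assume "v \<in> W" "v \<in> set p"
  then obtain e where "e \<in> PE" "v \<in> e" using Union_polygon_edges[OF simple] by blast
  then show "v \<in> polygon_boundary p"
    unfolding polygon_boundary_eq[OF simple] using hull_subset[of e convex] by blast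
qed

lemma set_p_subset_W: "set p \<subseteq> W"
  unfolding Union_polygon_edges[OF simple, symmetric]
  using polygon_edges_subset unfolding triangulation_edges_def by blast

text \<open>The cocycle determines a circle-valued map on the closed region, affine of the prescribed
  increments on each triangle. Its complement being connected, the compact region is Borsukian,
  so the map has a continuous logarithm, which yields the potential.\<close>

lemma cocycle_coboundary:
  assumes c: "cocycle (vt ` T) c"
  obtains g where "\<And>t x y. t \<in> T \<Longrightarrow> x \<in> vt t \<Longrightarrow> y \<in> vt t \<Longrightarrow> c x y = g y - g x"
proof -
  have c_add: "c x y + c y z = c x z" if "t \<in> T" "x \<in> vt t" "y \<in> vt t" "z \<in> vt t" for t x y z
    using c that unfolding cocycle_def by blast
  have "\<exists>a L k. a \<in> vt t \<and> linear L \<and> (\<forall>v\<in>vt t. L v + k = real_of_int (c a v))" if t: "t \<in> T" for t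
  proof -
    obtain a b where ab: "a \<in> vt t" "b \<in> vt t" "a \<noteq> b"
      using vt(2)[OF t] by (auto simp: card_3_iff)
    then obtain d where d: "vt t = {a, b, d}" "cross (b - a) (d - a) \<noteq> 0"
      using triangle_third[of t a b] t by auto
    obtain L where L: "linear L" "L (b - a) = real_of_int (c a b)" "L (d - a) = real_of_int (c a d)"
      using linear_interpolation[OF d(2)] by metis
    have "c a a = 0" using c_add[OF t ab(1) ab(1) ab(1)] by simp
    then have "\<forall>v\<in>vt t. L v + - L a = real_of_int (c a v)"
      using L linear_diff[OF L(1)] unfolding d(1) by auto
    then show ?thesis using ab L by blast
  qed
  then obtain a L k where a: "\<And>t. t \<in> T \<Longrightarrow> a t \<in> vt t" and L: "\<And>t. t \<in> T \<Longrightarrow> linear (L t)"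
    and Lk: "\<And>t v. t \<in> T \<Longrightarrow> v \<in> vt t \<Longrightarrow> L t v + k t = real_of_int (c (a t) v)" by metis
  \<comment> \<open>Affine on \<open>t\<close> with integer values \<open>c (a t) v\<close> at the
    vertices. The base point \<open>a t\<close> is arbitrary, so neighbouring functions agree only
    up to an integer.\<close>
  define h where "h t z = L t z + k t" for t z
  have cont_h: "continuous_on S (h t)" if "t \<in> T" for t S
    unfolding h_def using L[OF that] by (intro continuous_intros linear_continuous_on) (simp add: linear_linear)
  have agree: "cis (2 * pi * h t z) = cis (2 * pi * h s z)" if ts: "t \<in> T" "s \<in> T" and z: "z \<in> t" "z \<in> s" for t s z
  proof -
    let ?K = "vt t \<inter> vt s"
    have zK: "z \<in> convex hull ?K" using Int_triangles[OF ts] z by blast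
    then obtain w where w: "w \<in> ?K" by (metis convex_hull_empty empty_iff ex_in_conv)
    \<comment> \<open>At the common vertices, and by affinity on their whole hull, the two functions
      differ by the single integer \<open>n\<close>, which \<open>cis\<close> does not see.\<close>
    define n where "n = c (a t) w - c (a s) w"
    have "c (a t) v - c (a s) v = n" if "v \<in> ?K" for v
      using c_add[of t "a t" w v] c_add[of s "a s" w v] a w that ts unfolding n_def by simp
    then have K: "?K \<subseteq> {v. h t v - h s v = n}"
      using Lk[OF ts(1)] Lk[OF ts(2)] unfolding h_def by (force simp flip: of_int_diff)
    have "convex {v. h t v - h s v = n}"
    proof -
      have lin: "linear (\<lambda>v. L t v - L s v)" using L ts by (intro linear_compose_sub)
      have "{v. h t v - h s v = n} = (\<lambda>v. L t v - L s v) -` {n - k t + k s}"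
        unfolding h_def by auto
      then show ?thesis using convex_linear_vimage[OF lin, of "{n - k t + k s}"] by simp
    qed
    then have "h t z - h s z = n" using hull_minimal[of ?K _ convex, OF K] zK by blast
    then have "2 * pi * h t z = 2 * pi * h s z + 2 * pi * n" by (simp add: algebra_simps)
    then show ?thesis unfolding cis_eq_iff by blast
  qed
  define f where "f z = cis (2 * pi * h (SOME t. t \<in> T \<and> z \<in> t) z)" for z
  have f: "f z = cis (2 * pi * h t z)" if "t \<in> T" "z \<in> t" for t z
  proof -
    have "(SOME t. t \<in> T \<and> z \<in> t) \<in> T \<and> z \<in> (SOME t. t \<in> T \<and> z \<in> t)"
      by (rule someI[of "\<lambda>t. t \<in> T \<and> z \<in> t" t]) (use that in blast)
    then show ?thesis unfolding f_def using agree that by blast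
  qed
  have "continuous_on (\<Union>t\<in>T. t) f"
  proof (rule continuous_on_closed_Union)
    fix t assume t: "t \<in> T"
    show "closed t" using compact_triangle[OF t] by (rule compact_imp_closed)
    have "continuous_on t (\<lambda>z. cis (2 * pi * h t z))"
      using cont_h[OF t] by (intro continuous_intros)
    then show "continuous_on t f" using f[OF t] by (simp cong: continuous_on_cong)
  qed (fact finite_T)
  then have "continuous_on Q f" using Union_T by simp
  moreover have "f \<in> Q \<rightarrow> sphere 0 1" unfolding f_def by simp
  moreover have "Borsukian Q"
    using Borsukian_separation_compact[OF Jordan(9)] Jordan(7) by blast
  ultimately obtain g where g: "continuous_on Q (complex_of_real \<circ> g)"
    "\<And>x. x \<in> Q \<Longrightarrow> f x = exp (\<i> * of_real (g x))"
    unfolding Borsukian_continuous_logarithm_circle_real by blast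
  have cont_g: "continuous_on Q g"
    using continuous_on_Re[OF g(1)] by (simp add: o_def)
  have "c x y = \<lfloor>g y / (2 * pi)\<rfloor> - \<lfloor>g x / (2 * pi)\<rfloor>" if t: "t \<in> T" and xy: "x \<in> vt t" "y \<in> vt t" for t x y
  proof -
    have tQ: "t \<subseteq> Q" using t Union_T by blast
    \<comment> \<open>\<open>m\<close> is continuous and integer-valued on the connected triangle,
      hence constant. So \<open>g / (2 * pi)\<close> has the same integer increments between
      vertices of \<open>t\<close> as \<open>h t\<close>, and they survive rounding down.\<close>
    define m where "m z = g z / (2 * pi) - h t z" for z
    have m: "m z \<in> \<int>" if z: "z \<in> t" for z
    proof -
      have "cis (g z) = cis (2 * pi * h t z)"
        using g(2)[of z] f[OF t z] z tQ by (auto simp: cis_conv_exp)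
      then obtain n :: int where "g z = 2 * pi * h t z + 2 * pi * n" unfolding cis_eq_iff by blast
      then have "m z = n" unfolding m_def by (simp add: field_simps)
      then show ?thesis by simp
    qed
    have "m constant_on t"
    proof (rule continuous_discrete_range_constant)
      show "connected t" using vt(3)[OF t] by (metis convex_connected convex_convex_hull)
      show "continuous_on t m"
        unfolding m_def using cont_h[OF t] continuous_on_subset[OF cont_g tQ]
        by (intro continuous_intros) auto
      fix z assume z: "z \<in> t"
      have "1 \<le> norm (m w - m z)" if "w \<in> t" "m w \<noteq> m z" for w
        using m[OF z] m[OF that(1)] that(2) by (auto elim!: Ints_cases simp flip: of_int_diff)
      then show "\<exists>e>0. \<forall>w. w \<in> t \<and> m w \<noteq> m z \<longrightarrow> e \<le> norm (m w - m z)"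
        by (intro exI[of _ 1]) auto
    qed
    then obtain k where "\<forall>z\<in>t. m z = k" unfolding constant_on_def by blast
    then have "m x = m y" using xy subsetD[OF vt_subset[OF t]] by simp
    then have "g y / (2 * pi) = g x / (2 * pi) + (h t y - h t x)" unfolding m_def by simp
    also have "h t y - h t x = real_of_int (c x y)"
      using Lk[OF t xy(1)] Lk[OF t xy(2)] c_add[OF t a[OF t] xy] unfolding h_def by simp
    finally show ?thesis by simp
  qed
  then show ?thesis by (rule that[of "\<lambda>z. \<lfloor>g z / (2 * pi)\<rfloor>"])
qed


section \<open>Angles at vertices and edges of the triangulation\<close>

lemma triangle_at_vertex:
  assumes "t \<in> T" "v \<in> vt t"
  obtains a b where "vt t = {v, a, b}" "a \<noteq> v" "b \<noteq> v" "a \<noteq> b" "cross (a - v) (b - v) \<noteq> 0"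
    "t = convex hull {v, a, b}"
proof -
  have "\<exists>a. a \<in> vt t \<and> a \<noteq> v"
  proof (rule ccontr)
    assume "\<nexists>a. a \<in> vt t \<and> a \<noteq> v"
    then have "vt t \<subseteq> {v}" by blast
    then have "card (vt t) \<le> card {v}" by (intro card_mono) simp_all
    then show False using vt(2)[OF assms(1)] by simp
  qed
  then obtain a where a: "{v, a} \<subseteq> vt t" "v \<noteq> a" using assms by blast
  obtain b where "vt t = {v, a, b}" "t = convex hull {v, a, b}" "cross (a - v) (b - v) \<noteq> 0" "b \<noteq> v" "b \<noteq> a"
    using triangle_third[OF assms(1) a] by metis
  then show ?thesis using that a by metis
qed

lemma triangle_angle_pos:
  assumes "t \<in> T" "v \<in> vt t"
  shows "0 < triangle_angle t v"
proof -
  obtain a b where ab: "vt t = {v, a, b}" "a \<noteq> v" "b \<noteq> v" "a \<noteq> b" "cross (a - v) (b - v) \<noteq> 0"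
    using triangle_at_vertex[OF assms] by metis
  show ?thesis unfolding triangle_angle_eq[OF ab(1-4)] by (rule euclidean_angle_pos_less_pi(1)[OF ab(5)])
qed

lemma triangle_angle_sum:
  assumes t: "t \<in> T" and abc: "vt t = {a, b, c}" "a \<noteq> b" "a \<noteq> c" "b \<noteq> c"
  shows "triangle_angle t a + triangle_angle t b + triangle_angle t c = pi"
proof -
  have "cross (b - a) (c - a) \<noteq> 0"
    using cross_nonzero_of_affine_independent[of a b c] vt(1)[OF t] abc by simp
  moreover have "triangle_angle t a = euclidean_angle b a c"
    by (rule triangle_angle_eq) (use abc in auto)
  moreover have "triangle_angle t b = euclidean_angle a b c"
    by (rule triangle_angle_eq) (use abc in auto)
  moreover have "triangle_angle t c = euclidean_angle a c b"
    by (rule triangle_angle_eq) (use abc in auto)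
  ultimately show ?thesis using euclidean_angle_sum by simp
qed

lemma interior_triangle_subset: "t \<in> T \<Longrightarrow> interior t \<subseteq> polygon_interior p"
  using interior_mono[of t Q] Union_T interior_Q by blast

text \<open>Distinct triangles share at most two vertices, and the hull of so few points has no
  interior in the plane.\<close>

lemma interiors_disjoint:
  assumes "t \<in> T" "s \<in> T" "t \<noteq> s"
  shows "interior t \<inter> interior s = {}"
proof -
  let ?K = "vt t \<inter> vt s"
  have "?K \<subset> vt t \<or> ?K \<subset> vt s" using vt_inj[OF assms(1,2)] assms(3) by blast
  then have "card ?K < 3"
    using psubset_card_mono finite_vt vt(2) assms by metis
  then have "interior (convex hull ?K) = {}"
    by (intro empty_interior_convex_hull) (use finite_vt[OF assms(1)] in auto)
  then show ?thesis using Int_triangles[OF assms(1,2)] interior_Int by metis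
qed

text \<open>Up to finitely many directions along edges, the directions from \<open>v\<close> into the polygon are
  partitioned by the open sectors of the triangles at \<open>v\<close>.\<close>

lemma interior_angle_eq_sum:
  assumes v: "v \<in> W"
  shows "interior_angle (polygon_interior p) v = (\<Sum>t\<in>{t \<in> T. v \<in> vt t}. triangle_angle t v)"
proof -
  let ?Tv = "{t \<in> T. v \<in> vt t}"
  define A where "A = {\<theta> \<in> {0..<2 * pi}. \<forall>\<^sub>F r in at_right 0. v + of_real r * cis \<theta> \<in> polygon_interior p}"
  have "\<forall>t\<in>?Tv. \<exists>q. vt t = {v, fst q, snd q} \<and> fst q \<noteq> v \<and> snd q \<noteq> v \<and> fst q \<noteq> snd q
    \<and> cross (fst q - v) (snd q - v) \<noteq> 0 \<and> t = convex hull {v, fst q, snd q}"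
  proof
    fix t assume t: "t \<in> ?Tv"
    then obtain a b where "vt t = {v, a, b}" "a \<noteq> v" "b \<noteq> v" "a \<noteq> b" "cross (a - v) (b - v) \<noteq> 0"
      "t = convex hull {v, a, b}"
      using triangle_at_vertex[of t v] by blast
    then show "\<exists>q. vt t = {v, fst q, snd q} \<and> fst q \<noteq> v \<and> snd q \<noteq> v \<and> fst q \<noteq> snd q
      \<and> cross (fst q - v) (snd q - v) \<noteq> 0 \<and> t = convex hull {v, fst q, snd q}"
      by (intro exI[of _ "(a, b)"]) simp
  qed
  then obtain q where q: "\<forall>t\<in>?Tv. vt t = {v, fst (q t), snd (q t)} \<and> fst (q t) \<noteq> v \<and> snd (q t) \<noteq> v
    \<and> fst (q t) \<noteq> snd (q t) \<and> cross (fst (q t) - v) (snd (q t) - v) \<noteq> 0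
    \<and> t = convex hull {v, fst (q t), snd (q t)}"
    by (rule bchoice[THEN exE])
  define a b where "a t = fst (q t)" and "b t = snd (q t)" for t
  have ab: "\<And>t. t \<in> ?Tv \<Longrightarrow> vt t = {v, a t, b t}"
    and ne: "\<And>t. t \<in> ?Tv \<Longrightarrow> a t \<noteq> v" "\<And>t. t \<in> ?Tv \<Longrightarrow> b t \<noteq> v" "\<And>t. t \<in> ?Tv \<Longrightarrow> a t \<noteq> b t"
    and D: "\<And>t. t \<in> ?Tv \<Longrightarrow> cross (a t - v) (b t - v) \<noteq> 0"
    and hull: "\<And>t. t \<in> ?Tv \<Longrightarrow> convex hull {v, a t, b t} = t"
    unfolding a_def b_def using q by blast+
  define S where "S t = sector (a t - v) (b t - v)" for t
  have S: "S t \<in> lmeasurable" "measure lebesgue (S t) = triangle_angle t v" if t: "t \<in> ?Tv" for t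
    using sector_measure[OF D[OF t]] triangle_angle_eq[OF ab[OF t] ne(1)[OF t] ne(2)[OF t] ne(3)[OF t]]
    unfolding S_def by simp_all
  have ev: "\<forall>\<^sub>F r in at_right 0. v + of_real r * cis \<theta> \<in> interior t" if t: "t \<in> ?Tv" and "\<theta> \<in> S t" for t \<theta>
    using sector_interior_triangle[OF D[OF t]] that(2) unfolding S_def hull[OF t] by blast
  have fin: "finite ?Tv" using finite_T by simp
  have "measure lebesgue (\<Union>(S ` ?Tv)) = (\<Sum>t\<in>?Tv. measure lebesgue (S t))"
  proof (rule measure_negligible_finite_Union_image[OF fin S(1)])
    show "pairwise (\<lambda>t s. negligible (S t \<inter> S s)) ?Tv"
    proof (rule pairwiseI)
      fix t s assume ts: "t \<in> ?Tv" "s \<in> ?Tv" "t \<noteq> s"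
      have "S t \<inter> S s = {}"
      proof (rule ccontr)
        assume "S t \<inter> S s \<noteq> {}"
        then obtain \<theta> where "\<theta> \<in> S t" "\<theta> \<in> S s" by blast
        then have "\<forall>\<^sub>F r in at_right 0. v + of_real r * cis \<theta> \<in> interior t \<and> v + of_real r * cis \<theta> \<in> interior s"
          using ev[OF ts(1)] ev[OF ts(2)] by (intro eventually_conj)
        then have "\<exists>r. v + of_real r * cis \<theta> \<in> interior t \<and> v + of_real r * cis \<theta> \<in> interior s"
          by (intro eventually_happens'[OF trivial_limit_at_right_real])
        then show False using interiors_disjoint[of t s] ts by blast
      qed
      then show "negligible (S t \<inter> S s)" by simp
    qed
  qed
  moreover have "measure lebesgue A = measure lebesgue (\<Union>(S ` ?Tv))"
  proof (rule measure_negligible_symdiff)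
    show "\<Union>(S ` ?Tv) \<in> lmeasurable" using fin S(1) by (intro fmeasurable.finite_UN)
    have "\<Union>(S ` ?Tv) \<subseteq> A"
    proof
      fix \<theta> assume "\<theta> \<in> \<Union>(S ` ?Tv)"
      then obtain t where t: "t \<in> ?Tv" "\<theta> \<in> S t" by blast
      have "\<forall>\<^sub>F r in at_right 0. v + of_real r * cis \<theta> \<in> polygon_interior p"
        using ev[OF t] by (rule eventually_mono) (use interior_triangle_subset t in blast)
      moreover have "\<theta> \<in> {0..<2 * pi}" using t unfolding S_def sector_def by blast
      ultimately show "\<theta> \<in> A" unfolding A_def by blast
    qed
    moreover have "A - \<Union>(S ` ?Tv) \<subseteq> (\<Union>w\<in>W - {v}. {\<theta> \<in> {0..<2 * pi}. cross (w - v) (cis \<theta>) = 0})"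
    proof
      fix \<theta> assume \<theta>: "\<theta> \<in> A - \<Union>(S ` ?Tv)"
      have "((\<lambda>r. v + of_real r * cis \<theta>) \<longlongrightarrow> v + of_real 0 * cis \<theta>) (at_right 0)"
        by (intro tendsto_intros)
      then have "filterlim (\<lambda>r. v + of_real r * cis \<theta>) (nhds v) (at_right 0)" by simp
      then have "\<forall>\<^sub>F r in at_right 0. \<forall>t\<in>T. v + of_real r * cis \<theta> \<in> t \<longrightarrow> v \<in> t"
        using eventually_compose_filterlim[OF eventually_triangles_near] by blast
      moreover have "\<forall>\<^sub>F r in at_right 0. v + of_real r * cis \<theta> \<in> polygon_interior p"
        using \<theta> unfolding A_def by blast
      moreover have "\<forall>\<^sub>F r::real in at_right 0. 0 < r" by (rule eventually_at_right_less)
      ultimately have "\<forall>\<^sub>F r in at_right 0. 0 < r \<and> v + of_real r * cis \<theta> \<in> polygon_interior p \<and>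
        (\<forall>t\<in>T. v + of_real r * cis \<theta> \<in> t \<longrightarrow> v \<in> t)" by eventually_elim blast
      then have "\<exists>r. 0 < r \<and> v + of_real r * cis \<theta> \<in> polygon_interior p \<and>
        (\<forall>t\<in>T. v + of_real r * cis \<theta> \<in> t \<longrightarrow> v \<in> t)"
        by (intro eventually_happens'[OF trivial_limit_at_right_real])
      \<comment> \<open>A small step in direction \<theta> lands in a triangle that contains
        \<open>v\<close>, hence has it as a vertex. As \<theta> lies in no sector, it must run along
        a side of this triangle.\<close>
      then obtain r where r: "0 < r" "v + of_real r * cis \<theta> \<in> polygon_interior p"
        "\<And>t. t \<in> T \<Longrightarrow> v + of_real r * cis \<theta> \<in> t \<Longrightarrow> v \<in> t" by blast
      obtain s where s: "s \<in> T" "v + of_real r * cis \<theta> \<in> s" using r(2) Union_T by blast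
      obtain u where u: "u \<in> T" "v \<in> vt u" using v by blast
      have "v \<in> vt s" by (rule vertex_in_triangle[OF u(1) s(1) u(2) r(3)[OF s]])
      then have sv: "s \<in> ?Tv" using s by blast
      have \<theta>2: "\<theta> \<in> {0..<2 * pi}" using \<theta> unfolding A_def by blast
      have "v + of_real r * cis \<theta> \<in> convex hull {v, a s, b s}" using s(2) hull[OF sv] by simp
      from triangle_direction_sector[OF D[OF sv] \<theta>2 r(1) this]
      have "cross (a s - v) (cis \<theta>) = 0 \<or> cross (b s - v) (cis \<theta>) = 0"
        using \<theta> sv unfolding S_def by blast
      moreover have "a s \<in> W - {v}" "b s \<in> W - {v}" using ab[OF sv] ne[OF sv] s(1) by auto
      ultimately show "\<theta> \<in> (\<Union>w\<in>W - {v}. {\<theta> \<in> {0..<2 * pi}. cross (w - v) (cis \<theta>) = 0})"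
        using \<theta>2 by blast
    qed
    moreover have "finite (\<Union>w\<in>W - {v}. {\<theta> \<in> {0..<2 * pi}. cross (w - v) (cis \<theta>) = 0})"
      using finite_W finite_parallel_directions by (intro finite_UN_I) auto
    ultimately have "finite (A - \<Union>(S ` ?Tv))" "\<Union>(S ` ?Tv) - A = {}" using finite_subset by blast+
    then show "negligible (\<Union>(S ` ?Tv) - A \<union> (A - \<Union>(S ` ?Tv)))" by (simp add: negligible_finite)
  qed
  ultimately show ?thesis
    unfolding interior_angle_def A_def[symmetric] using S(2) by simp
qed

lemma interior_angle_inner_vertex:
  assumes "v \<in> polygon_interior p"
  shows "interior_angle (polygon_interior p) v = 2 * pi"
proof -
  have "\<forall>\<^sub>F r in at_right 0. v + of_real r * cis \<theta> \<in> polygon_interior p" for \<theta>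
  proof -
    have "((\<lambda>r. v + of_real r * cis \<theta>) \<longlongrightarrow> v + of_real 0 * cis \<theta>) (at_right 0)"
      by (intro tendsto_intros)
    then have "filterlim (\<lambda>r. v + of_real r * cis \<theta>) (nhds v) (at_right 0)" by simp
    then show ?thesis
      using eventually_compose_filterlim[OF eventually_nhds_in_open[OF Jordan(2) assms]] by blast
  qed
  then have "{\<theta> \<in> {0..<2 * pi}. \<forall>\<^sub>F r in at_right 0. v + of_real r * cis \<theta> \<in> polygon_interior p} = {0..<2 * pi}"
    by blast
  then show ?thesis unfolding interior_angle_def by simp
qed

text \<open>Excludes degenerate summands in the definition of the dihedral angle: every
  \<open>C\<close> that occurs there is a genuine third vertex.\<close>

lemma triangle_of_vertices:
  assumes "A \<noteq> B" and t: "convex hull {A, B, C} \<in> T"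
  shows "vt (convex hull {A, B, C}) = {A, B, C}" "C \<noteq> A" "C \<noteq> B"
proof -
  let ?t = "convex hull {A, B, C}"
  have sub: "vt ?t \<subseteq> {A, B, C}"
    unfolding triangle_vertices_def using extreme_point_of_convex_hull by blast
  have "card {A, B, C} \<le> 3" using card_length[of "[A, B, C]"] by simp
  then show eq: "vt ?t = {A, B, C}"
    using card_seteq[OF _ sub] vt(2)[OF t] by simp
  have "card {A, B, C} = 3" using vt(2)[OF t] eq by simp
  then show "C \<noteq> A" "C \<noteq> B" using assms(1) by (auto simp: card_insert_if split: if_splits)
qed

text \<open>For an edge \<open>e\<close> of \<open>t\<close> the sum has one term; writing it as a
  sum avoids choosing the third vertex.\<close>

definition opposite_angle :: "complex set \<Rightarrow> complex set \<Rightarrow> real" where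
  "opposite_angle t e = (\<Sum>C\<in>vt t - e. triangle_angle t C)"

text \<open>Reindexing: the apexes over \<open>{A, B}\<close> correspond one to one to the triangles
  with this edge.\<close>

lemma dihedral_angle_eq_sum:
  assumes "A \<noteq> B"
  shows "dihedral_angle p T (Finite A) (Finite B) =
    (\<Sum>t\<in>{t \<in> T. {A, B} \<subseteq> vt t}. opposite_angle t {A, B})"
proof -
  have "(\<Sum>C | convex hull {A, B, C} \<in> T. euclidean_angle A C B) =
    (\<Sum>t\<in>{t \<in> T. {A, B} \<subseteq> vt t}. opposite_angle t {A, B})"
  proof (rule sum.reindex_bij_witness[of _ "\<lambda>t. the_elem (vt t - {A, B})" "\<lambda>C. convex hull {A, B, C}"])
    fix C assume "C \<in> {C. convex hull {A, B, C} \<in> T}"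
    then have C: "convex hull {A, B, C} \<in> T" by simp
    note tri = triangle_of_vertices[OF assms C]
    have diff: "vt (convex hull {A, B, C}) - {A, B} = {C}" using tri by auto
    then show "the_elem (vt (convex hull {A, B, C}) - {A, B}) = C" by simp
    show "convex hull {A, B, C} \<in> {t \<in> T. {A, B} \<subseteq> vt t}" using C tri(1) by simp
    have "triangle_angle (convex hull {A, B, C}) C = euclidean_angle A C B"
      by (rule triangle_angle_eq) (use tri assms in auto)
    then show "opposite_angle (convex hull {A, B, C}) {A, B} = euclidean_angle A C B"
      unfolding opposite_angle_def diff by simp
  next
    fix t assume "t \<in> {t \<in> T. {A, B} \<subseteq> vt t}"
    then have t: "t \<in> T" "{A, B} \<subseteq> vt t" by simp_all
    obtain c where c: "vt t = {A, B, c}" "t = convex hull {A, B, c}" "c \<noteq> A" "c \<noteq> B"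
      using triangle_third[OF t assms] by metis
    have diff: "vt t - {A, B} = {c}" using c by auto
    show "convex hull {A, B, the_elem (vt t - {A, B})} = t" unfolding diff using c(2) by simp
    then show "the_elem (vt t - {A, B}) \<in> {C. convex hull {A, B, C} \<in> T}" using t by simp
  qed
  then show ?thesis by simp
qed

section \<open>The ideal polyhedron\<close>


abbreviation "TE \<equiv> triangulation_edges T"
abbreviation "triangle_face t \<equiv> Finite ` vt t"
abbreviation "side_face d \<equiv> insert Infinity (Finite ` d)"
abbreviation "IF \<equiv> ideal_faces p T"

lemma ideal_faces_eq: "IF = triangle_face ` T \<union> side_face ` PE"
  unfolding ideal_faces_def by blast

lemma inj_Finite: "inj_on Finite S"
  by (rule inj_onI) simp

lemma Finite_image_subset_iff [simp]: "Finite ` S \<subseteq> Finite ` S' \<longleftrightarrow> S \<subseteq> S'"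
  by auto

lemma Finite_image_eq_iff: "Finite ` S = Finite ` S' \<longleftrightarrow> S = S'"
  by auto

lemma inj_triangle_face: "inj_on triangle_face T"
  by (rule inj_onI) (simp only: Finite_image_eq_iff vt_inj)

lemma inj_side_face: "inj_on side_face PE"
proof (rule inj_onI)
  fix d d' assume "side_face d = side_face d'"
  then have "side_face d - {Infinity} = side_face d' - {Infinity}" by simp
  moreover have "side_face s - {Infinity} = Finite ` s" for s by auto
  ultimately show "d = d'" using Finite_image_eq_iff by simp
qed

lemma triangle_face_ne_side_face: "triangle_face ` S \<inter> side_face ` S' = {}"
  by auto

lemma ideal_edges_eq: "ideal_edges p T = skeleton_edges IF"
  unfolding ideal_edges_def skeleton_edges_def ..

lemma finite_PE_card: "d \<in> PE \<Longrightarrow> card d = 2 \<and> finite d"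
  using card_polygon_edge[OF simple, of d] by (metis card.infinite zero_neq_numeral)

lemma PE_nonempty: "PE \<noteq> {}"
proof -
  have "set p \<noteq> {}" using simple unfolding simple_polygon_def by auto
  then show ?thesis using Union_polygon_edges[OF simple] by auto
qed

lemma PE_triangle:
  assumes "d \<in> PE"
  obtains t where "t \<in> T" "d \<subseteq> vt t"
  using assms polygon_edges_subset unfolding triangulation_edges_def by blast

lemma Union_polygon_edges_subset: "\<Union>PE \<subseteq> W"
  unfolding Union_polygon_edges[OF simple] by (rule set_p_subset_W)

lemma Union_ideal_faces: "\<Union>IF = insert Infinity (Finite ` W)"
proof -
  have "\<Union>IF = Finite ` W \<union> \<Union>(side_face ` PE)" unfolding ideal_faces_eq by auto
  also have "\<Union>(side_face ` PE) = insert Infinity (Finite ` \<Union>PE)" using PE_nonempty by auto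
  finally show ?thesis using image_mono[OF Union_polygon_edges_subset, of Finite] by auto
qed

lemma ideal_vertices_eq: "ideal_vertices T = \<Union>IF"
  unfolding ideal_vertices_def Union_ideal_faces ..

lemma card_faces_filter:
  "card {f \<in> IF. P f} = card {t \<in> T. P (triangle_face t)} + card {d \<in> PE. P (side_face d)}"
proof -
  have "{f \<in> IF. P f} = triangle_face ` {t \<in> T. P (triangle_face t)} \<union> side_face ` {d \<in> PE. P (side_face d)}"
    unfolding ideal_faces_eq by blast
  also have "card \<dots> = card (triangle_face ` {t \<in> T. P (triangle_face t)}) + card (side_face ` {d \<in> PE. P (side_face d)})"
    by (rule card_Un_disjoint)
      (use finite_T finite_polygon_edges triangle_face_ne_side_face in \<open>auto simp del: image_insert\<close>)
  also have "card (triangle_face ` {t \<in> T. P (triangle_face t)}) = card {t \<in> T. P (triangle_face t)}"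
    by (rule card_image) (rule inj_on_subset[OF inj_triangle_face], blast)
  also have "card (side_face ` {d \<in> PE. P (side_face d)}) = card {d \<in> PE. P (side_face d)}"
    by (rule card_image) (rule inj_on_subset[OF inj_side_face], blast)
  finally show ?thesis .
qed

text \<open>The finite edge of a side face is a polygon edge, so it is an edge of \<open>T\<close>
  already.\<close>

lemma skeleton_edge_cases:
  assumes "e \<in> skeleton_edges IF"
  obtains (finite) d where "e = Finite ` d" "d \<in> TE" | (infinite) v where "e = {Infinity, Finite v}" "v \<in> set p"
proof -
  obtain f where f: "f \<in> IF" "e \<subseteq> f" "card e = 2" using assms unfolding skeleton_edges_def by blast
  show ?thesis
  proof (cases "Infinity \<in> e")
    case True
    then obtain d where d: "d \<in> PE" "f = side_face d" using f unfolding ideal_faces_eq by blast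
    obtain x where x: "e = {Infinity, x}" "x \<noteq> Infinity"
      using f(3) True by (auto simp: card_2_iff)
    then obtain v where "x = Finite v" "v \<in> d" using f d by auto
    then show ?thesis using infinite x d Union_polygon_edges[OF simple] by blast
  next
    case False
    obtain t where t: "t \<in> T" "e \<subseteq> triangle_face t"
    proof (cases "f \<in> triangle_face ` T")
      case True
      then show ?thesis using that f(2) by blast
    next
      assume "f \<notin> triangle_face ` T"
      then obtain d where d: "d \<in> PE" "f = side_face d" using f(1) unfolding ideal_faces_eq by blast
      obtain t where "t \<in> T" "d \<subseteq> vt t" using PE_triangle[OF d(1)] .
      then show ?thesis using that[of t] False f(2) d(2) by blast
    qed
    then obtain d where d: "d \<subseteq> vt t" "e = Finite ` d" by (auto simp: subset_image_iff)
    then have "card d = 2" using f(3) card_image[OF inj_Finite] by metis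
    then show ?thesis using finite d t unfolding triangulation_edges_def by blast
  qed
qed

lemma finite_edge_in_skeleton:
  assumes "d \<in> TE" shows "Finite ` d \<in> skeleton_edges IF"
proof -
  obtain t where "t \<in> T" "d \<subseteq> vt t" "card d = 2" using assms unfolding triangulation_edges_def by blast
  then have "triangle_face t \<in> IF" "Finite ` d \<subseteq> triangle_face t" "card (Finite ` d) = 2"
    unfolding ideal_faces_eq by (auto simp: card_image inj_Finite)
  then show ?thesis unfolding skeleton_edges_def by blast
qed

lemma infinite_edge_in_skeleton:
  assumes "v \<in> set p" shows "{Infinity, Finite v} \<in> skeleton_edges IF"
proof -
  obtain d where "d \<in> PE" "v \<in> d" using assms Union_polygon_edges[OF simple] by blast
  then have "side_face d \<in> IF" "{Infinity, Finite v} \<subseteq> side_face d" unfolding ideal_faces_eq by blast+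
  then show ?thesis unfolding skeleton_edges_def by auto
qed

text \<open>A polygon edge lies in one triangle and one side face, any other edge of
  \<open>T\<close> in two triangles, and a vertical edge in the side faces over the two polygon
  edges at its finite end.\<close>

lemma two_ideal_faces:
  assumes "e \<in> skeleton_edges IF"
  shows "card {f \<in> IF. e \<subseteq> f} = 2"
  using assms
proof (cases rule: skeleton_edge_cases)
  case (finite d)
  have "card d = 2" using finite(2) unfolding triangulation_edges_def by blast
  then have "{d' \<in> PE. d \<subseteq> d'} = (if d \<in> PE then {d} else {})"
  proof -
    have "d \<subseteq> d' \<longleftrightarrow> d = d'" if "d' \<in> PE" for d'
      using finite_PE_card[OF that] card_subset_eq[of d' d] \<open>card d = 2\<close> by auto
    then show ?thesis by auto
  qed
  moreover have "card {t \<in> T. d \<subseteq> vt t} = (if d \<in> PE then 1 else 2)"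
    using card_triangles_polygon_edge card_triangles_inner_edge[OF finite(2)] by simp
  moreover have "Finite ` d \<subseteq> side_face d' \<longleftrightarrow> d \<subseteq> d'" for d' by auto
  ultimately show ?thesis unfolding card_faces_filter finite(1) by auto
next
  case (infinite v)
  have "{Infinity, Finite v} \<subseteq> side_face d \<longleftrightarrow> v \<in> d" "\<not> {Infinity, Finite v} \<subseteq> triangle_face t" for d t
    by auto
  then show ?thesis
    unfolding card_faces_filter infinite(1) using card_polygon_edges_at_vertex[OF simple infinite(2)]
    by (simp only:) simp
qed

lemma card_Finite_Int: "card (Finite ` S \<inter> Finite ` S') = card (S \<inter> S')"
proof -
  have "Finite ` S \<inter> Finite ` S' = Finite ` (S \<inter> S')" by auto
  then show ?thesis using card_image[OF inj_Finite] by metis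
qed

text \<open>Every side face is adjacent to a triangle along its polygon edge, which reduces the
  claim to the triangles of \<open>T\<close>.\<close>

lemma ideal_faces_connected:
  assumes X: "X \<subseteq> IF" "X \<noteq> {}"
    and closed: "\<And>t s. t \<in> X \<Longrightarrow> s \<in> IF \<Longrightarrow> card (t \<inter> s) = 2 \<Longrightarrow> s \<in> X"
  shows "X = IF"
proof -
  have adj: "card (side_face d \<inter> triangle_face t) = 2" if "d \<in> PE" "d \<subseteq> vt t" for d t
  proof -
    have "side_face d \<inter> triangle_face t = Finite ` d" using that(2) by auto
    then show ?thesis using finite_PE_card[OF that(1)] card_image[OF inj_Finite] by metis
  qed
  define Y where "Y = {t \<in> T. triangle_face t \<in> X}"
  have "Y = T"
  proof (rule triangles_connected)
    show "Y \<subseteq> T" unfolding Y_def by blast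
    obtain f where f: "f \<in> X" using X by blast
    show "Y \<noteq> {}"
    proof (cases "f \<in> triangle_face ` T")
      case True
      then show ?thesis using f unfolding Y_def by blast
    next
      case False
      then obtain d where d: "d \<in> PE" "f = side_face d" using f X unfolding ideal_faces_eq by blast
      obtain t where t: "t \<in> T" "d \<subseteq> vt t" using PE_triangle[OF d(1)] .
      then have "triangle_face t \<in> X"
        using closed[OF f] adj[OF d(1) t(2)] d(2) unfolding ideal_faces_eq by blast
      then show ?thesis using t unfolding Y_def by blast
    qed
    fix t s assume "t \<in> Y" "s \<in> T" "card (vt t \<inter> vt s) = 2"
    then show "s \<in> Y"
      using closed[of "triangle_face t" "triangle_face s"] card_Finite_Int
      unfolding Y_def ideal_faces_eq by auto
  qed
  then have tri: "triangle_face t \<in> X" if "t \<in> T" for t using that unfolding Y_def by blast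
  have "side_face d \<in> X" if d: "d \<in> PE" for d
  proof -
    obtain t where t: "t \<in> T" "d \<subseteq> vt t" using PE_triangle[OF d] .
    show ?thesis
      using closed[OF tri[OF t(1)], of "side_face d"] adj[OF d t(2)] d
      unfolding ideal_faces_eq by (simp add: Int_commute)
  qed
  then show ?thesis using tri X unfolding ideal_faces_eq by blast
qed

lemma card_side_face: "d \<in> PE \<Longrightarrow> card (side_face d) = 3"
  using finite_PE_card[of d] by (subst card_insert_disjoint) (auto simp: card_image inj_Finite)

lemma closed_surface_ideal_faces: "closed_surface IF"
proof
  show "finite IF" unfolding ideal_faces_eq using finite_T finite_polygon_edges by simp
  fix t assume "t \<in> IF"
  then show "card t = 3"
    unfolding ideal_faces_eq using vt(2) card_side_face by (auto simp: card_image inj_Finite)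
next
  show "\<And>e. e \<in> skeleton_edges IF \<Longrightarrow> card {t \<in> IF. e \<subseteq> t} = 2" by (rule two_ideal_faces)
  show "\<And>X. X \<subseteq> IF \<Longrightarrow> X \<noteq> {} \<Longrightarrow> (\<And>t s. t \<in> X \<Longrightarrow> s \<in> IF \<Longrightarrow> card (t \<inter> s) = 2 \<Longrightarrow> s \<in> X) \<Longrightarrow> X = IF"
    by (rule ideal_faces_connected)
qed

section \<open>The Euler characteristic\<close>

lemma sum_polygon_edges_Int:
  assumes "S \<subseteq> set p"
  shows "2 * card S = (\<Sum>d\<in>PE. card (d \<inter> S))"
proof -
  have fin: "finite S" using assms finite_subset by blast
  have "2 * card S = (\<Sum>v\<in>S. card {d \<in> PE. v \<in> d})"
    using card_polygon_edges_at_vertex[OF simple] assms by (simp add: subset_iff)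
  also have "\<dots> = (\<Sum>v\<in>S. \<Sum>d\<in>PE. if v \<in> d then 1 else 0)"
    using finite_polygon_edges by (simp add: sum.If_cases Int_def)
  also have "\<dots> = (\<Sum>d\<in>PE. \<Sum>v\<in>S. if v \<in> d then 1 else 0)" by (rule sum.swap)
  also have "\<dots> = (\<Sum>d\<in>PE. card (d \<inter> S))"
    using fin by (simp add: sum.If_cases Int_def conj_commute)
  finally show ?thesis .
qed

lemma card_PE: "card PE = card (set p)"
proof -
  have "card (d \<inter> set p) = 2" if "d \<in> PE" for d
    using that finite_PE_card[OF that] Union_polygon_edges[OF simple] by (metis Int_absorb2 Union_upper)
  then have "(\<Sum>d\<in>PE. card (d \<inter> set p)) = 2 * card PE" by simp
  then show ?thesis using sum_polygon_edges_Int[OF subset_refl] by linarith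
qed

lemma skeleton_triangle_faces: "skeleton_edges (triangle_face ` T) = (`) Finite ` TE"
proof
  show "(`) Finite ` TE \<subseteq> skeleton_edges (triangle_face ` T)"
    unfolding skeleton_edges_def triangulation_edges_def using card_image[OF inj_Finite] by fastforce
  show "skeleton_edges (triangle_face ` T) \<subseteq> (`) Finite ` TE"
  proof
    fix e assume "e \<in> skeleton_edges (triangle_face ` T)"
    then obtain t where t: "t \<in> T" "e \<subseteq> Finite ` vt t" "card e = 2" unfolding skeleton_edges_def by blast
    then obtain d where d: "d \<subseteq> vt t" "e = Finite ` d" by (auto simp: subset_image_iff)
    then have "card d = 2" using t(3) card_image[OF inj_Finite] by metis
    then show "e \<in> (`) Finite ` TE" using d t unfolding triangulation_edges_def by blast
  qed
qed

text \<open>The triangles omit the side faces of the closed surface, so they are collapsible; the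
  topology of the region enters through \<open>cocycle_coboundary\<close>.\<close>

lemma euler_triangulation: "card (skeleton_edges (triangle_face ` T)) + 1 \<le> card W + card T"
proof -
  interpret closed_surface IF by (rule closed_surface_ideal_faces)
  let ?X = "triangle_face ` T"
  obtain t0 w where t0: "t0 \<in> T" "w \<in> vt t0"
    using PE_nonempty PE_triangle by (metis Union_iff Union_polygon_edges equals0I finite_PE_card card.empty zero_neq_numeral simple subsetD)
  have "card (skeleton_edges ?X) + 1 \<le> card (Finite ` W) + card ?X"
  proof (rule collapse_coboundary_card_le)
    show "finite (Finite ` W)" "finite ?X" using finite_W finite_T by simp_all
    show "Finite w \<in> Finite ` W" using t0 by blast
    show "finite (skeleton_edges ?X)"
      by (rule finite_subset[OF _ finite_edges]) (auto simp: skeleton_edges_def ideal_faces_eq)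
    show "collapsible ?X"
    proof (rule collapsible_proper)
      show "?X \<subseteq> IF" unfolding ideal_faces_eq by blast
      obtain d where "d \<in> PE" using PE_nonempty by blast
      then have "side_face d \<in> IF" "side_face d \<notin> ?X" unfolding ideal_faces_eq by auto
      then show "?X \<noteq> IF" by blast
    qed
    show "card t = 3" if "t \<in> ?X" for t using card_face that unfolding ideal_faces_eq by blast
    show "e \<in> skeleton_edges ?X" if "t \<in> ?X" "e \<subseteq> t" "card e = 2" for t e
      using that unfolding skeleton_edges_def by blast
    show "e \<subseteq> Finite ` W \<and> card e = 2" if "e \<in> skeleton_edges ?X" for e
      using skeleton_edges_subset[OF that] by blast
    show "\<exists>g. \<forall>x y. {x, y} \<in> skeleton_edges ?X \<longrightarrow> c x y = g y - g x" if c: "cocycle ?X c" for c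
    proof -
      have "cocycle (vt ` T) (\<lambda>x y. c (Finite x) (Finite y))"
        unfolding cocycle_def
      proof (intro conjI allI ballI)
        show "c (Finite x) (Finite y) = - c (Finite y) (Finite x)" for x y
          by (rule cocycle_antisym[OF c])
        fix s x y z assume "s \<in> vt ` T" "x \<in> s" "y \<in> s" "z \<in> s"
        then obtain t where t: "t \<in> T" "Finite x \<in> triangle_face t" "Finite y \<in> triangle_face t" "Finite z \<in> triangle_face t"
          by blast
        show "c (Finite x) (Finite y) + c (Finite y) (Finite z) = c (Finite x) (Finite z)"
          by (rule cocycle_add[OF c imageI[OF t(1)] t(2-4)])
      qed
      then obtain g where g: "\<And>t x y. t \<in> T \<Longrightarrow> x \<in> vt t \<Longrightarrow> y \<in> vt t \<Longrightarrow>
        c (Finite x) (Finite y) = g y - g x"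
        using cocycle_coboundary[of "\<lambda>x y. c (Finite x) (Finite y)"] by blast
      \<comment> \<open>The value at \<open>Infinity\<close> is a dummy, since no edge of a triangle
        of \<open>T\<close> ends there.\<close>
      have "c x y = (case y of Finite v \<Rightarrow> g v | Infinity \<Rightarrow> 0) - (case x of Finite v \<Rightarrow> g v | Infinity \<Rightarrow> 0)"
        if xy: "{x, y} \<in> skeleton_edges ?X" for x y
      proof -
        obtain t where "t \<in> T" "{x, y} \<subseteq> triangle_face t" using xy unfolding skeleton_edges_def by blast
        then obtain u v where "x = Finite u" "y = Finite v" "u \<in> vt t" "v \<in> vt t" by blast
        then show ?thesis using g[OF \<open>t \<in> T\<close>, of u v] by simp
      qed
      then show ?thesis by blast
    qed
  qed
  moreover have "card (Finite ` W) = card W" by (rule card_image[OF inj_Finite])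
  moreover have "card ?X = card T" by (rule card_image[OF inj_triangle_face])
  ultimately show ?thesis by simp
qed

text \<open>Coning off the boundary adds one vertex, one face for each polygon edge, and at most one
  edge for each polygon vertex. The last two numbers agree, so the vertex \<open>Infinity\<close>
  raises the bound from 1 to 2.\<close>

lemma triangulated_sphere_ideal_faces: "triangulated_sphere IF"
proof -
  interpret closed_surface IF by (rule closed_surface_ideal_faces)
  let ?E = "skeleton_edges (triangle_face ` T)" and ?U = "(\<lambda>v. {Infinity, Finite v}) ` set p"
  have "skeleton_edges IF \<subseteq> ?E \<union> ?U"
    unfolding skeleton_triangle_faces
  proof
    fix e assume "e \<in> skeleton_edges IF"
    then show "e \<in> (`) Finite ` TE \<union> ?U" by (cases rule: skeleton_edge_cases) blast+
  qed
  moreover have fin: "finite ?E"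
    by (rule finite_subset[OF _ finite_edges]) (auto simp: skeleton_edges_def ideal_faces_eq)
  ultimately have "card (skeleton_edges IF) \<le> card (?E \<union> ?U)" by (intro card_mono) auto
  also have "\<dots> \<le> card ?E + card ?U" by (rule card_Un_le)
  also have "card ?U \<le> card (set p)" by (rule card_image_le) simp
  finally have "card (skeleton_edges IF) \<le> card ?E + card (set p)" by simp
  moreover have "card (\<Union>IF) = card W + 1"
    unfolding Union_ideal_faces using finite_W by (subst card_insert_disjoint) (auto simp: card_image inj_Finite)
  moreover have "card IF = card T + card PE"
    using card_faces_filter[of "\<lambda>_. True"] by simp
  ultimately show ?thesis
    using euler_triangulation card_PE by unfold_locales linarith
qed

section \<open>Angle sums over a cut\<close>

lemma interior_angle_vertex_sum:
  assumes "S \<subseteq> W"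
  shows "(\<Sum>v\<in>S. \<Sum>t\<in>{t \<in> T. v \<in> vt t}. triangle_angle t v) = (\<Sum>t\<in>T. \<Sum>v\<in>vt t \<inter> S. triangle_angle t v)"
proof -
  have fin: "finite S" using assms finite_W finite_subset by blast
  have "(\<Sum>v\<in>S. \<Sum>t\<in>{t \<in> T. v \<in> vt t}. triangle_angle t v) =
    (\<Sum>v\<in>S. \<Sum>t\<in>T. if v \<in> vt t then triangle_angle t v else 0)"
    by (rule sum.cong[OF refl], rule sum.inter_filter[OF finite_T])
  also have "\<dots> = (\<Sum>t\<in>T. \<Sum>v\<in>S. if v \<in> vt t then triangle_angle t v else 0)" by (rule sum.swap)
  also have "\<dots> = (\<Sum>t\<in>T. \<Sum>v\<in>vt t \<inter> S. triangle_angle t v)"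
  proof (rule sum.cong[OF refl])
    fix t
    have "vt t \<inter> S = {v \<in> S. v \<in> vt t}" by blast
    then show "(\<Sum>v\<in>S. if v \<in> vt t then triangle_angle t v else 0) = (\<Sum>v\<in>vt t \<inter> S. triangle_angle t v)"
      using sum.inter_filter[OF fin, of "triangle_angle t" "\<lambda>v. v \<in> vt t"] by simp
  qed
  finally show ?thesis .
qed

text \<open>The amount by which a triangle falls short of a multiple of \<pi>; the total over
  \<open>T\<close> is 2 \<Theta>.\<close>

definition excess :: "complex set \<Rightarrow> complex set \<Rightarrow> real" where
  "excess S t = (if card (vt t \<inter> S) = 2 then 2 * (\<Sum>w\<in>vt t - S. triangle_angle t w) else 0)"

text \<open>With one vertex in \<open>S\<close>, the cut edges are opposite to the other two, and
  all three angles occur once. With two vertices in \<open>S\<close>, each of their angles occurs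
  twice, once as an opposite angle and once as a vertex angle. With three, only vertex angles
  occur.\<close>

lemma triangle_contribution:
  assumes t: "t \<in> T"
  shows "(\<Sum>e\<in>{e \<in> boundary_edges TE S. e \<subseteq> vt t}. opposite_angle t e) + (\<Sum>v\<in>vt t \<inter> S. triangle_angle t v)
    = pi * real (if card (vt t \<inter> S) = 0 then 0 else if card (vt t \<inter> S) = 2 then 2 else 1) - excess S t"
proof -
  obtain a b d where abd: "vt t = {a, b, d}" "a \<noteq> b" "a \<noteq> d" "b \<noteq> d"
    using vt(2)[OF t] by (rule card_3E)
  note sum = triangle_angle_sum[OF t abd]
  have "e \<in> TE \<and> e \<subseteq> vt t \<longleftrightarrow> e \<subseteq> vt t \<and> card e = 2" for e
    using t unfolding triangulation_edges_def by blast
  then have et: "e \<in> TE \<and> e \<subseteq> vt t \<longleftrightarrow> e \<in> {{a, b}, {a, d}, {b, d}}" for e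
    unfolding abd(1) two_subsets_of_three[OF abd(2-4)] by simp
  have ne: "{a, b} \<noteq> {a, d}" "{a, b} \<noteq> {b, d}" "{a, d} \<noteq> {b, d}"
    using abd by (auto simp: doubleton_eq_iff)
  have 1: "{e \<in> boundary_edges TE S. e \<subseteq> vt t} =
    {e \<in> {{a, b}, {a, d}, {b, d}}. e \<inter> S \<noteq> {} \<and> \<not> e \<subseteq> S}"
  proof -
    have "{e \<in> boundary_edges TE S. e \<subseteq> vt t} = {e. (e \<in> TE \<and> e \<subseteq> vt t) \<and> e \<inter> S \<noteq> {} \<and> \<not> e \<subseteq> S}"
      unfolding boundary_edges_def by blast
    then show ?thesis unfolding et .
  qed
  have filt: "{e \<in> {p, q, r}. P e} = (if P p then {p} else {}) \<union> (if P q then {q} else {}) \<union> (if P r then {r} else {})"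
    for p q r :: "complex set" and P by auto
  have tS: "vt t \<inter> S = (if a \<in> S then {a} else {}) \<union> (if b \<in> S then {b} else {}) \<union> (if d \<in> S then {d} else {})"
    "vt t - S = (if a \<in> S then {} else {a}) \<union> (if b \<in> S then {} else {b}) \<union> (if d \<in> S then {} else {d})"
    unfolding abd by auto
  have opp: "opposite_angle t {a, b} = triangle_angle t d" "opposite_angle t {a, d} = triangle_angle t b"
    "opposite_angle t {b, d} = triangle_angle t a"
  proof -
    have "vt t - {a, b} = {d}" "vt t - {a, d} = {b}" "vt t - {b, d} = {a}" using abd by auto
    then show "opposite_angle t {a, b} = triangle_angle t d" "opposite_angle t {a, d} = triangle_angle t b"
    "opposite_angle t {b, d} = triangle_angle t a" unfolding opposite_angle_def by simp_all
  qed
  show ?thesis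
    unfolding 1 filt tS excess_def using ne abd(2-4) opp sum
    by (cases "a \<in> S"; cases "b \<in> S"; cases "d \<in> S") auto
qed


lemma boundary_edges_ideal:
  "boundary_edges (skeleton_edges IF) (Finite ` S) =
    (`) Finite ` boundary_edges TE S \<union> (\<lambda>v. {Infinity, Finite v}) ` (S \<inter> set p)"
proof (intro equalityI subsetI)
  fix e assume e: "e \<in> boundary_edges (skeleton_edges IF) (Finite ` S)"
  then have "e \<in> skeleton_edges IF" unfolding boundary_edges_def by blast
  then show "e \<in> (`) Finite ` boundary_edges TE S \<union> (\<lambda>v. {Infinity, Finite v}) ` (S \<inter> set p)"
  proof (cases rule: skeleton_edge_cases)
    case (finite d)
    have "d \<inter> S \<noteq> {}" "\<not> d \<subseteq> S" using e unfolding finite(1) boundary_edges_def by auto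
    then show ?thesis using finite unfolding boundary_edges_def by blast
  next
    case (infinite v)
    have "v \<in> S" using e unfolding infinite(1) boundary_edges_def by auto
    then show ?thesis using infinite by blast
  qed
next
  fix e assume "e \<in> (`) Finite ` boundary_edges TE S \<union> (\<lambda>v. {Infinity, Finite v}) ` (S \<inter> set p)"
  then consider d where "e = Finite ` d" "d \<in> TE" "d \<inter> S \<noteq> {}" "\<not> d \<subseteq> S"
    | v where "e = {Infinity, Finite v}" "v \<in> S" "v \<in> set p"
    unfolding boundary_edges_def by blast
  then show "e \<in> boundary_edges (skeleton_edges IF) (Finite ` S)"
  proof cases
    case 1
    then have "e \<inter> Finite ` S \<noteq> {}" "\<not> e \<subseteq> Finite ` S" by auto
    then show ?thesis using finite_edge_in_skeleton[OF 1(2)] 1(1) unfolding boundary_edges_def by blast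
  next
    case 2
    then have "e \<inter> Finite ` S \<noteq> {}" "\<not> e \<subseteq> Finite ` S" by auto
    then show ?thesis using infinite_edge_in_skeleton[OF 2(3)] 2(1) unfolding boundary_edges_def by blast
  qed
qed

lemma finite_TE: "finite TE"
  by (rule finite_subset[of _ "Pow W"]) (use finite_W in \<open>auto simp: triangulation_edges_def\<close>)

lemma edge_dihedral_angle_finite:
  assumes "e \<in> TE"
  shows "edge_dihedral_angle p T (Finite ` e) = (\<Sum>t\<in>{t \<in> T. e \<subseteq> vt t}. opposite_angle t e)"
proof -
  obtain a b where ab: "e = {a, b}" "a \<noteq> b"
    using assms unfolding triangulation_edges_def by (auto simp: card_2_iff)
  have "Finite ` e = {Finite a, Finite b}" using ab by simp
  then show ?thesis
    using edge_dihedral_angle_doubleton[of p T "Finite a" "Finite b"] dihedral_angle_eq_sum[OF ab(2)] ab(1) by simp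
qed

text \<open>As \<open>Infinity\<close> is on the other side, the vertical cut edges are those at the
  polygon vertices in \<open>S\<close>. Extending their angle sum to all of \<open>S\<close> allows
  it to be rearranged by triangles; each other vertex of \<open>S\<close> then contributes 2 \<pi>,
  which is subtracted.\<close>

lemma sum_boundary_dihedral_angles:
  assumes S: "S \<subseteq> W"
  shows "(\<Sum>e\<in>boundary_edges (skeleton_edges IF) (Finite ` S). edge_dihedral_angle p T e) =
    (\<Sum>t\<in>T. (\<Sum>e\<in>{e \<in> boundary_edges TE S. e \<subseteq> vt t}. opposite_angle t e) + (\<Sum>v\<in>vt t \<inter> S. triangle_angle t v))
      - 2 * pi * (real (card S) - real (card (S \<inter> set p)))"
proof -
  let ?B = "boundary_edges TE S" and ?D = "edge_dihedral_angle p T"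
  let ?ia = "interior_angle (polygon_interior p)"
  have finS: "finite S" using S finite_W finite_subset by blast
  have B: "?B \<subseteq> TE" "finite ?B"
    using finite_TE unfolding boundary_edges_def by auto
  have "(\<Sum>e\<in>boundary_edges (skeleton_edges IF) (Finite ` S). ?D e) =
    (\<Sum>e\<in>(`) Finite ` ?B. ?D e) + (\<Sum>e\<in>(\<lambda>v. {Infinity, Finite v}) ` (S \<inter> set p). ?D e)"
    unfolding boundary_edges_ideal by (rule sum.union_disjoint) (use B(2) finS in auto)
  also have "(\<Sum>e\<in>(`) Finite ` ?B. ?D e) = (\<Sum>e\<in>?B. ?D (Finite ` e))"
    by (subst sum.reindex) (auto intro!: inj_onI simp: Finite_image_eq_iff)
  also have "\<dots> = (\<Sum>e\<in>?B. \<Sum>t\<in>{t \<in> T. e \<subseteq> vt t}. opposite_angle t e)"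
    by (rule sum.cong[OF refl]) (use B(1) edge_dihedral_angle_finite in blast)
  also have "\<dots> = (\<Sum>e\<in>?B. \<Sum>t\<in>T. if e \<subseteq> vt t then opposite_angle t e else 0)"
    by (rule sum.cong[OF refl], rule sum.inter_filter[OF finite_T])
  also have "\<dots> = (\<Sum>t\<in>T. \<Sum>e\<in>?B. if e \<subseteq> vt t then opposite_angle t e else 0)" by (rule sum.swap)
  also have "\<dots> = (\<Sum>t\<in>T. \<Sum>e\<in>{e \<in> ?B. e \<subseteq> vt t}. opposite_angle t e)"
    by (rule sum.cong[OF refl], rule sum.inter_filter[OF B(2), symmetric])
  also have "(\<Sum>e\<in>(\<lambda>v. {Infinity, Finite v}) ` (S \<inter> set p). ?D e) = (\<Sum>v\<in>S \<inter> set p. ?ia v)"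
    by (subst sum.reindex) (auto intro!: inj_onI simp: doubleton_eq_iff edge_dihedral_angle_doubleton)
  also have "\<dots> = (\<Sum>v\<in>S. ?ia v) - (\<Sum>v\<in>S - set p. ?ia v)"
    using sum.Int_Diff[OF finS, of ?ia "set p"] by simp
  also have "(\<Sum>v\<in>S - set p. ?ia v) = (\<Sum>v\<in>S - set p. 2 * pi)"
  proof (rule sum.cong[OF refl])
    fix v assume v: "v \<in> S - set p"
    then have "v \<in> W" using S by blast
    then have "v \<notin> polygon_boundary p" using boundary_vertex_iff v by blast
    moreover have "v \<in> Q" using \<open>v \<in> W\<close> vt_subset Union_T by blast
    ultimately show "?ia v = 2 * pi" using interior_angle_inner_vertex by blast
  qed
  also have "\<dots> = 2 * pi * (real (card S) - real (card (S \<inter> set p)))"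
  proof -
    have "card S = card (S \<inter> set p) + card (S - set p)"
      using finS by (metis Int_Diff_Un Int_Diff_disjoint card_Un_disjoint finite_Diff finite_Int)
    then show ?thesis by simp
  qed
  also have "(\<Sum>v\<in>S. ?ia v) = (\<Sum>v\<in>S. \<Sum>t\<in>{t \<in> T. v \<in> vt t}. triangle_angle t v)"
    by (rule sum.cong[OF refl], rule interior_angle_eq_sum) (use S in blast)
  also have "\<dots> = (\<Sum>t\<in>T. \<Sum>v\<in>vt t \<inter> S. triangle_angle t v)" by (rule interior_angle_vertex_sum[OF S])
  finally show ?thesis by (simp add: sum.distrib)
qed

lemma excess_nonneg:
  assumes "t \<in> T" shows "0 \<le> excess S t"
proof -
  have "0 \<le> (\<Sum>w\<in>vt t - S. triangle_angle t w)"
    by (rule sum_nonneg) (use triangle_angle_pos[OF assms] less_imp_le in blast)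
  then show ?thesis unfolding excess_def by simp
qed

lemma excess_pos:
  assumes t: "t \<in> T" and 2: "card (vt t \<inter> S) = 2"
  shows "0 < excess S t"
proof -
  have "vt t - S \<noteq> {}"
  proof
    assume "vt t - S = {}"
    then have "vt t \<inter> S = vt t" by blast
    then show False using 2 vt(2)[OF t] by simp
  qed
  then have "0 < (\<Sum>w\<in>vt t - S. triangle_angle t w)"
    using triangle_angle_pos[OF t] finite_vt[OF t] by (intro sum_pos) auto
  then show ?thesis unfolding excess_def using 2 by simp
qed

lemma bond_angle_sum:
  assumes S: "S \<subseteq> W" "S \<noteq> {}"
    and conn: "cut_connected (Finite ` S) {e \<in> skeleton_edges IF. e \<subseteq> Finite ` S}"
      "cut_connected (\<Union>IF - Finite ` S) {e \<in> skeleton_edges IF. e \<subseteq> \<Union>IF - Finite ` S}"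
  defines "C \<equiv> boundary_edges (skeleton_edges IF) (Finite ` S)"
  shows "(\<Sum>e\<in>C. edge_dihedral_angle p T e) = (real (card C) - 2) * pi - (\<Sum>t\<in>T. excess S t)"
proof -
  interpret triangulated_sphere IF by (rule triangulated_sphere_ideal_faces)
  let ?A = "Finite ` S"
  \<comment> \<open>\<open>N\<close> counts the triangles and \<open>M\<close> the side faces by
    their vertices in \<open>S\<close>. The vertex \<open>Infinity\<close> is never among these, so
    a side face has at most two.\<close>
  define N where "N j = card {t \<in> T. card (vt t \<inter> S) = j}" for j
  define M where "M j = card {d \<in> PE. card (d \<inter> S) = j}" for j
  have A: "?A \<subseteq> \<Union>IF" "?A \<noteq> {}" "?A \<noteq> \<Union>IF"
    unfolding Union_ideal_faces using S by auto
  have meet: "card (faces_meeting ?A j) = N j + M j" for j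
  proof -
    have "card (side_face d \<inter> ?A) = card (d \<inter> S)" for d
    proof -
      have "side_face d \<inter> ?A = Finite ` d \<inter> ?A" by auto
      then show ?thesis using card_Finite_Int by simp
    qed
    then show ?thesis
      unfolding faces_meeting_def card_faces_filter N_def M_def card_Finite_Int by simp
  qed
  have M_le: "card (d \<inter> S) = 0 \<or> card (d \<inter> S) = 1 \<or> card (d \<inter> S) = 2" if d: "d \<in> PE" for d
  proof -
    have "card (d \<inter> S) \<le> 2" using card_mono[of d "d \<inter> S"] finite_PE_card[OF d] by simp
    then show ?thesis by linarith
  qed
  have M3: "M 3 = 0"
  proof -
    have "{d \<in> PE. card (d \<inter> S) = 3} = {}" using M_le by force
    then show ?thesis unfolding M_def by (metis card.empty)
  qed
  have cardA: "card ?A = card S" by (rule card_image[OF inj_Finite])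
  have 1: "2 * card S = 2 + (N 2 + M 2) + (N 3 + M 3)"
    using bond_card[OF A conn] unfolding meet cardA .
  have 2: "card C = (N 1 + M 1) + (N 2 + M 2)"
    unfolding C_def card_boundary_edges meet ..
  have 3: "2 * card (S \<inter> set p) = M 1 + 2 * M 2"
  proof -
    have "2 * card (S \<inter> set p) = (\<Sum>d\<in>PE. card (d \<inter> (S \<inter> set p)))"
      by (rule sum_polygon_edges_Int) blast
    also have "\<dots> = (\<Sum>d\<in>PE. card (d \<inter> S))"
    proof (rule sum.cong[OF refl])
      fix d assume "d \<in> PE"
      then have "d \<inter> (S \<inter> set p) = d \<inter> S" using Union_polygon_edges[OF simple] by blast
      then show "card (d \<inter> (S \<inter> set p)) = card (d \<inter> S)" by simp
    qed
    also have "\<dots> = (\<Sum>d\<in>PE. (if card (d \<inter> S) = 1 then 1 else 0) + 2 * (if card (d \<inter> S) = 2 then 1 else 0))"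
    proof (rule sum.cong[OF refl])
      fix d assume "d \<in> PE"
      from M_le[OF this] show "card (d \<inter> S) =
        (if card (d \<inter> S) = 1 then 1 else 0) + 2 * (if card (d \<inter> S) = 2 then 1 else 0)" by auto
    qed
    also have "\<dots> = M 1 + 2 * M 2"
      unfolding M_def using finite_polygon_edges
      by (simp add: sum.distrib sum_distrib_left[symmetric] sum.If_cases Int_def)
    finally show ?thesis .
  qed
  have N_le: "card (vt t \<inter> S) = 0 \<or> card (vt t \<inter> S) = 1 \<or> card (vt t \<inter> S) = 2 \<or> card (vt t \<inter> S) = 3"
    if t: "t \<in> T" for t
  proof -
    have "card (vt t \<inter> S) \<le> 3"
      using card_mono[of "vt t" "vt t \<inter> S"] finite_vt[OF t] vt(2)[OF t] by simp
    then show ?thesis by linarith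
  qed
  have 4: "(\<Sum>t\<in>T. if card (vt t \<inter> S) = 0 then 0 else if card (vt t \<inter> S) = 2 then 2 else 1) = N 1 + 2 * N 2 + N 3"
  proof -
    have "(\<Sum>t\<in>T. if card (vt t \<inter> S) = 0 then 0 else if card (vt t \<inter> S) = 2 then 2 else 1) =
      (\<Sum>t\<in>T. (if card (vt t \<inter> S) = 1 then 1 else 0) + 2 * (if card (vt t \<inter> S) = 2 then 1 else 0)
        + (if card (vt t \<inter> S) = 3 then 1 else (0::nat)))"
    proof (rule sum.cong[OF refl])
      fix t assume "t \<in> T"
      from N_le[OF this] show "(if card (vt t \<inter> S) = 0 then 0 else if card (vt t \<inter> S) = 2 then 2 else 1) =
        (if card (vt t \<inter> S) = 1 then 1 else 0) + 2 * (if card (vt t \<inter> S) = 2 then 1 else 0)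
        + (if card (vt t \<inter> S) = 3 then 1 else (0::nat))" by auto
    qed
    also have "\<dots> = N 1 + 2 * N 2 + N 3"
      unfolding N_def using finite_T
      by (simp add: sum.distrib sum_distrib_left[symmetric] sum.If_cases Int_def)
    finally show ?thesis .
  qed
  have "(\<Sum>e\<in>C. edge_dihedral_angle p T e) =
    (\<Sum>t\<in>T. pi * real (if card (vt t \<inter> S) = 0 then 0 else if card (vt t \<inter> S) = 2 then 2 else 1) - excess S t)
     - 2 * pi * (real (card S) - real (card (S \<inter> set p)))"
    unfolding C_def sum_boundary_dihedral_angles[OF S(1)]
    by (simp only: triangle_contribution cong: sum.cong)
  also have "(\<Sum>t\<in>T. pi * real (if card (vt t \<inter> S) = 0 then 0 else if card (vt t \<inter> S) = 2 then 2 else 1) - excess S t)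
    = pi * real (N 1 + 2 * N 2 + N 3) - (\<Sum>t\<in>T. excess S t)"
    unfolding sum_subtractf sum_distrib_left[symmetric] of_nat_sum[symmetric] 4 ..
  also have "pi * real (N 1 + 2 * N 2 + N 3) - (\<Sum>t\<in>T. excess S t) - 2 * pi * (real (card S) - real (card (S \<inter> set p)))
    = pi * (real (N 1 + 2 * N 2 + N 3) - real (2 * card S) + real (2 * card (S \<inter> set p))) - (\<Sum>t\<in>T. excess S t)"
    by (simp add: algebra_simps)
  \<comment> \<open>The bond identity removes N 2 + N 3 + M 2 + 2, and doubling the polygon vertices
    restores M 1 + 2 M 2. What remains is N 1 + N 2 + M 1 + M 2 - 2, the number of cut edges minus
    2.\<close>
  also have "real (N 1 + 2 * N 2 + N 3) - real (2 * card S) + real (2 * card (S \<inter> set p)) = real (card C) - 2"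
    unfolding 1 2 3 M3 by simp
  finally show ?thesis by (simp add: mult.commute)
qed

section \<open>The case of equality\<close>

lemma triangle_subset_of_two_vertices:
  assumes t: "t \<in> T" and 2: "2 \<le> card (vt t \<inter> S)" "card (vt t \<inter> S) \<noteq> 2"
  shows "vt t \<subseteq> S"
proof -
  have "card (vt t \<inter> S) \<le> 3"
    using card_mono[of "vt t" "vt t \<inter> S"] finite_vt[OF t] vt(2)[OF t] by simp
  then have "card (vt t \<inter> S) = card (vt t)" using 2 vt(2)[OF t] by linarith
  then have "vt t \<inter> S = vt t" using card_subset_eq[OF finite_vt[OF t]] by blast
  then show ?thesis by blast
qed

text \<open>By \<open>bond_at_vertex\<close>, the side containing \<open>v\<close> is the single
  vertex \<open>v\<close>. If it is \<open>S\<close>, a triangle has at most one vertex in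
  \<open>S\<close>; otherwise it is \<open>Infinity\<close>, and every triangle has all
  three.\<close>

lemma bond_at_vertex_triangles:
  assumes S: "S \<subseteq> W" "S \<noteq> {}"
    and conn: "cut_connected (Finite ` S) {e \<in> skeleton_edges IF. e \<subseteq> Finite ` S}"
      "cut_connected (\<Union>IF - Finite ` S) {e \<in> skeleton_edges IF. e \<subseteq> \<Union>IF - Finite ` S}"
    and v: "v \<in> \<Union>IF" "\<And>e. e \<in> boundary_edges (skeleton_edges IF) (Finite ` S) \<Longrightarrow> v \<in> e"
    and t: "t \<in> T"
  shows "card (vt t \<inter> S) \<noteq> 2"
proof -
  interpret triangulated_sphere IF by (rule triangulated_sphere_ideal_faces)
  let ?A = "Finite ` S"
  have A: "?A \<subseteq> \<Union>IF" "?A \<noteq> {}"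
    unfolding Union_ideal_faces using S by auto
  have inf: "Infinity \<in> \<Union>IF - ?A" unfolding Union_ideal_faces by auto
  show ?thesis
  proof (cases "v \<in> ?A")
    case True
    have diff: "\<Union>IF - (\<Union>IF - ?A) = ?A" by (rule double_diff[OF A(1) subset_refl])
    have bd: "boundary_edges E (\<Union>IF - ?A) = boundary_edges E ?A"
      by (rule boundary_edges_Diff) (rule skeleton_edges_subset[THEN conjunct1])
    have "\<Union>IF - (\<Union>IF - ?A) = {v}"
    proof (rule bond_at_vertex)
      show "\<Union>IF - ?A \<noteq> {}" using inf by (metis empty_iff)
      show "v \<in> \<Union>IF - (\<Union>IF - ?A)" unfolding diff by (fact True)
      show "v \<in> e" if "e \<in> boundary_edges E (\<Union>IF - ?A)" for e using v(2) that unfolding bd .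
    qed (use conn in \<open>simp_all only: diff Diff_subset\<close>)
    then have "?A = {v}" unfolding diff .
    then have "card S = 1" using card_image[OF inj_Finite, of S] by simp
    moreover have "finite S" using S(1) finite_W by (rule finite_subset)
    then have "card (vt t \<inter> S) \<le> card S" by (intro card_mono) auto
    ultimately show ?thesis by linarith
  next
    case False
    then have "v \<in> \<Union>IF - ?A" using v(1) by (rule DiffI[rotated])
    then have "\<Union>IF - ?A = {v}" by (rule bond_at_vertex[OF A conn _ v(2)])
    then have "\<Union>IF - ?A = {Infinity}" using inf by simp
    then have "W \<subseteq> S" unfolding Union_ideal_faces by auto
    then have "vt t \<inter> S = vt t" using t by blast
    then show ?thesis using vt(2)[OF t] by simp
  qed
qed

text \<open>If \<open>S\<close> contains a triangle, it contains two vertices and thus all vertices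
  of each neighbour, so it spreads over \<open>T\<close> and only \<open>Infinity\<close> is left
  opposite. If it contains none, an edge inside \<open>S\<close> would produce a triangle with
  exactly two vertices in \<open>S\<close>, so connectedness leaves a single vertex.\<close>

lemma bond_without_pairs_at_vertex:
  assumes S: "S \<subseteq> W" "S \<noteq> {}"
    and conn: "cut_connected (Finite ` S) {e \<in> skeleton_edges IF. e \<subseteq> Finite ` S}"
    and no2: "\<And>t. t \<in> T \<Longrightarrow> card (vt t \<inter> S) \<noteq> 2"
  shows "\<exists>v\<in>\<Union>IF. \<forall>e\<in>boundary_edges (skeleton_edges IF) (Finite ` S). v \<in> e"
proof (cases "\<exists>t\<in>T. vt t \<subseteq> S")
  case True
  have "{t \<in> T. vt t \<subseteq> S} = T"
  proof (rule triangles_connected)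
    show "{t \<in> T. vt t \<subseteq> S} \<noteq> {}" using True by blast
    fix t s assume ts: "t \<in> {t \<in> T. vt t \<subseteq> S}" "s \<in> T" "card (vt t \<inter> vt s) = 2"
    have "vt t \<inter> vt s \<subseteq> vt s \<inter> S" using ts by blast
    then have "card (vt t \<inter> vt s) \<le> card (vt s \<inter> S)"
      using finite_vt[OF ts(2)] by (intro card_mono) auto
    then have "vt s \<subseteq> S" using triangle_subset_of_two_vertices[OF ts(2) _ no2[OF ts(2)]] ts(3) by simp
    then show "s \<in> {t \<in> T. vt t \<subseteq> S}" using ts(2) by blast
  qed blast
  then have WS: "W \<subseteq> S" by blast
  have "Infinity \<in> e" if e: "e \<in> boundary_edges (skeleton_edges IF) (Finite ` S)" for e
  proof -
    have "e \<in> skeleton_edges IF" "\<not> e \<subseteq> Finite ` S" using e unfolding boundary_edges_def by blast+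
    then have "e \<subseteq> insert Infinity (Finite ` W)"
      using skeleton_edges_subset unfolding Union_ideal_faces[symmetric] by blast
    then show ?thesis using WS \<open>\<not> e \<subseteq> Finite ` S\<close> by blast
  qed
  moreover have "Infinity \<in> \<Union>IF" unfolding Union_ideal_faces by simp
  ultimately show ?thesis by blast
next
  case False
  obtain a where a: "a \<in> S" using S by blast
  have "Finite ` S = {Finite a}"
  proof (rule ccontr)
    assume ne: "Finite ` S \<noteq> {Finite a}"
    obtain x y where xy: "x \<in> {Finite a}" "y \<in> Finite ` S - {Finite a}"
      "{x, y} \<in> {e \<in> skeleton_edges IF. e \<subseteq> Finite ` S}"
      by (rule cut_connectedD[OF conn, of "{Finite a}"]) (use a ne in auto)
    then obtain b where b: "y = Finite b" "b \<in> S" "b \<noteq> a" by auto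
    have "Finite ` {a, b} \<in> skeleton_edges IF" using xy b by simp
    then have "{a, b} \<in> TE"
    proof (cases rule: skeleton_edge_cases)
      case (finite d)
      then show ?thesis using Finite_image_eq_iff by metis
    next
      case (infinite v)
      then show ?thesis by auto
    qed
    then obtain t where t: "t \<in> T" "{a, b} \<subseteq> vt t" unfolding triangulation_edges_def by blast
    then have "{a, b} \<subseteq> vt t \<inter> S" using a b by blast
    then have "card {a, b} \<le> card (vt t \<inter> S)" using finite_vt[OF t(1)] by (intro card_mono) auto
    then have "vt t \<subseteq> S" using triangle_subset_of_two_vertices[OF t(1) _ no2[OF t(1)]] b(3) by simp
    then show False using False t by blast
  qed
  then have "Finite a \<in> e" if "e \<in> boundary_edges (skeleton_edges IF) (Finite ` S)" for e
    using that unfolding boundary_edges_def by auto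
  moreover have "a \<in> W" using a S(1) by (rule subsetD[rotated])
  then have "Finite a \<in> \<Union>IF" unfolding Union_ideal_faces by simp
  ultimately show ?thesis by blast
qed

text \<open>Complementary sets have the same boundary edges, so the side that avoids
  \<open>Infinity\<close> may be chosen.\<close>

lemma finite_side_of_bond:
  assumes C: "minimal_cutset (ideal_vertices T) (ideal_edges p T) C"
  obtains S where "S \<subseteq> W" "S \<noteq> {}" "C = boundary_edges (skeleton_edges IF) (Finite ` S)"
    "cut_connected (Finite ` S) {e \<in> skeleton_edges IF. e \<subseteq> Finite ` S}"
    "cut_connected (\<Union>IF - Finite ` S) {e \<in> skeleton_edges IF. e \<subseteq> \<Union>IF - Finite ` S}"
proof -
  interpret closed_surface IF by (rule closed_surface_ideal_faces)
  obtain A where A: "A \<subseteq> \<Union>IF" "A \<noteq> {}" "A \<noteq> \<Union>IF" "C = boundary_edges E A"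
    "cut_connected A {e \<in> E. e \<subseteq> A}" "cut_connected (\<Union>IF - A) {e \<in> E. e \<subseteq> \<Union>IF - A}"
    by (rule minimal_cutset_sides[OF skeleton_edges_subset cut_connected_skeleton
      C[unfolded ideal_vertices_eq ideal_edges_eq]])
  have "\<exists>B. B \<subseteq> \<Union>IF \<and> B \<noteq> {} \<and> C = boundary_edges E B \<and> Infinity \<notin> B
     \<and> cut_connected B {e \<in> E. e \<subseteq> B} \<and> cut_connected (\<Union>IF - B) {e \<in> E. e \<subseteq> \<Union>IF - B}"
  proof (cases "Infinity \<in> A")
    case True
    have "boundary_edges E (\<Union>IF - A) = boundary_edges E A"
      by (rule boundary_edges_Diff) (rule skeleton_edges_subset[THEN conjunct1])
    moreover have "\<Union>IF - (\<Union>IF - A) = A" by (rule double_diff[OF A(1) subset_refl])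
    moreover have "\<Union>IF - A \<noteq> {}" using A(1,3) by (metis Diff_eq_empty_iff subset_antisym)
    ultimately show ?thesis using A True by (intro exI[of _ "\<Union>IF - A"]) (simp add: Diff_subset)
  next
    case False
    then show ?thesis using A by blast
  qed
  then obtain B where B: "B \<subseteq> \<Union>IF" "B \<noteq> {}" "C = boundary_edges E B" "Infinity \<notin> B"
     "cut_connected B {e \<in> E. e \<subseteq> B}" "cut_connected (\<Union>IF - B) {e \<in> E. e \<subseteq> \<Union>IF - B}" by blast
  have "B \<subseteq> Finite ` W" using B(1,4) unfolding Union_ideal_faces by blast
  then obtain S where "S \<subseteq> W" "B = Finite ` S" by (auto simp: subset_image_iff)
  then show ?thesis using that B by blast
qed

end

theorem theorem3p12:
  fixes p :: "complex list" and T :: "complex set set" and C :: "ideal_point set set"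
  assumes "simple_polygon p"
    and "triangulates_polygon T p"
    and "minimal_cutset (ideal_vertices T) (ideal_edges p T) C"
  shows "(\<not> (\<exists>v\<in>ideal_vertices T. \<forall>e\<in>C. v \<in> e) \<longrightarrow>
            (\<Sum>e\<in>C. edge_dihedral_angle p T e) < (real (card C) - 2) * pi) \<and>
         ((\<exists>v\<in>ideal_vertices T. \<forall>e\<in>C. v \<in> e) \<longrightarrow>
            (\<Sum>e\<in>C. edge_dihedral_angle p T e) = (real (card C) - 2) * pi)"
proof -
  interpret triangulated_polygon p T using assms(1,2) by unfold_locales
  obtain S where S: "S \<subseteq> W" "S \<noteq> {}" and C: "C = boundary_edges (skeleton_edges IF) (Finite ` S)"
    and conn: "cut_connected (Finite ` S) {e \<in> skeleton_edges IF. e \<subseteq> Finite ` S}"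
    "cut_connected (\<Union>IF - Finite ` S) {e \<in> skeleton_edges IF. e \<subseteq> \<Union>IF - Finite ` S}"
    using finite_side_of_bond[OF assms(3)] by blast
  have sum: "(\<Sum>e\<in>C. edge_dihedral_angle p T e) = (real (card C) - 2) * pi - (\<Sum>t\<in>T. excess S t)"
    unfolding C by (rule bond_angle_sum[OF S conn])
  show ?thesis
  \<comment> \<open>A triangle with exactly two vertices in \<open>S\<close> excludes a common
    vertex of the cut edges and makes the excess positive; without one there is a common vertex and
    the excess vanishes. Each case settles both implications.\<close>
  proof (cases "\<exists>t\<in>T. card (vt t \<inter> S) = 2")
    case True
    then obtain t where t: "t \<in> T" "card (vt t \<inter> S) = 2" by blast
    have "0 < (\<Sum>t\<in>T. excess S t)"
      by (rule sum_pos2[where f = "excess S", OF finite_T t(1) excess_pos[OF t] excess_nonneg])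
    moreover have "\<not> (\<exists>v\<in>ideal_vertices T. \<forall>e\<in>C. v \<in> e)"
      unfolding ideal_vertices_eq C using bond_at_vertex_triangles[OF S conn] t by blast
    ultimately show ?thesis using sum by simp
  next
    case False
    then have "(\<Sum>t\<in>T. excess S t) = 0" unfolding excess_def by simp
    moreover have "\<exists>v\<in>ideal_vertices T. \<forall>e\<in>C. v \<in> e"
      unfolding ideal_vertices_eq C by (rule bond_without_pairs_at_vertex[OF S conn(1)]) (use False in blast)
    ultimately show ?thesis using sum by simp
  qed
qed

end
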